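(* For all $H\in(0,1)$, all integers $b\ge2$, and all $\alpha\in(0,1)$, $$\dim_{\rm H}\,\mathrm{graph}(Y)=\max\{2-H,\,2-K\}\qquad\mathbb P\text{-a.s.}$$
   Context: Let $(\Omega,\mathcal F,\mathbb P)$ be a probability space, $H\in(0,1)$, and let $W_H=\{W_H(t):0\le t\le 1\}$ be a continuous fractional Brownian motion with Hurst parameter $H$, i.e. a continuous centered Gaussian process with $\mathbb E[W_H(s)W_H(t)]=\frac12(s^{2H}+t^{2H}-|t-s|^{2H})$. Let $\kappa:[0,1]\to[0,1]$ be a deterministic function with $\kappa(0)=0$, $\kappa(1)=1$, Hölder continuous with some exponent $\tau\in(H,1]$, and put $B_H(u):=W_H(u)-\kappa(u)W_H(1)$, $0\le u\le1$. Let $\alpha\in(0,1)$ and $b\in\{2,3,\dots\}$. The fractional Wiener--Weierstrass bridge with parameters $\alpha,b,H$ is $$Y(t):=\sum_{n=0}^\infty\alpha^nB_H(\{b^nt\}),\qquad 0\le t\le1,$$ where $\{x\}$ denotes the fractional part of $x\ge0$. Put $K:=\min\{1,-\log_b\alpha\}$. Here $\dim_{\rm H}$ denotes Hausdorff dimension and $\mathrm{graph}(Y)=\{(t,Y(t)):t\in[0,1]\}\subset\mathbb R^2$ is the graph of the sample path. *)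

theory Defs
  imports "HOL-Probability.Probability"
begin

subsection \<open>Hausdorff measure and dimension\<close>

text \<open>
  The diameter of a set raised to the power \<open>s\<close>, with the conventions that the empty set
  contributes \<open>0\<close> for every \<open>s\<close> and that \<open>0\<close> to the power \<open>0\<close> is \<open>1\<close> (whereas
  \<open>0 powr 0 = 0\<close>), so that the \<open>0\<close>-dimensional measure is counting measure.
\<close>

definition diam_pow :: "real \<Rightarrow> 'a::metric_space set \<Rightarrow> ennreal" where
  "diam_pow s U =
     (if U = {} then 0 else if s = 0 then 1 else ennreal (diameter U powr s))"

text \<open>
  Boundedness is demanded explicitly because \<^const>\<open>diameter\<close> is real-valued and is not
  meaningful on unbounded sets. Finite covers are included, padded by the empty set.
\<close>

definition delta_covers :: "real \<Rightarrow> 'a::metric_space set \<Rightarrow> (nat \<Rightarrow> 'a set) set" where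
  "delta_covers \<delta> A =
     {U. A \<subseteq> (\<Union>i. U i) \<and> (\<forall>i. bounded (U i) \<and> diameter (U i) \<le> \<delta>)}"

definition hausdorff_premeasure :: "real \<Rightarrow> real \<Rightarrow> 'a::metric_space set \<Rightarrow> ennreal" where
  "hausdorff_premeasure s \<delta> A = (INF U\<in>delta_covers \<delta> A. \<Sum>i. diam_pow s (U i))"

definition hausdorff_measure :: "real \<Rightarrow> 'a::metric_space set \<Rightarrow> ennreal" where
  "hausdorff_measure s A = (SUP \<delta>\<in>{0<..}. hausdorff_premeasure s \<delta> A)"

definition hausdorff_dim :: "'a::metric_space set \<Rightarrow> ereal" where
  "hausdorff_dim A = (INF s\<in>{s. 0 \<le> s \<and> hausdorff_measure s A = 0}. ereal s)"


subsection \<open>Gaussian processes and fractional Brownian motion\<close>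

text \<open>Gaussian laws include the degenerate ones (point masses).\<close>

definition gaussian_rv :: "'w measure \<Rightarrow> ('w \<Rightarrow> real) \<Rightarrow> bool" where
  "gaussian_rv M X \<longleftrightarrow> X \<in> borel_measurable M \<and>
     ((\<exists>\<mu>. distr M borel X = return borel \<mu>) \<or>
      (\<exists>\<mu> \<sigma>. 0 < \<sigma> \<and> distr M borel X = density lborel (\<lambda>x. ennreal (normal_density \<mu> \<sigma> x))))"

text \<open>
  Joint normality of the finite-dimensional marginals, expressed by requiring all finite
  linear combinations to be Gaussian.
\<close>

definition gaussian_process_on ::
    "'w measure \<Rightarrow> 't set \<Rightarrow> ('t \<Rightarrow> 'w \<Rightarrow> real) \<Rightarrow> bool" where
  "gaussian_process_on M T X \<longleftrightarrow>
     (\<forall>F c. finite F \<and> F \<subseteq> T \<longrightarrow> gaussian_rv M (\<lambda>\<omega>. \<Sum>t\<in>F. c t * X t \<omega>))"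

definition continuous_fbm :: "'w measure \<Rightarrow> real \<Rightarrow> (real \<Rightarrow> 'w \<Rightarrow> real) \<Rightarrow> bool" where
  "continuous_fbm M H W \<longleftrightarrow>
     gaussian_process_on M {0..1} W \<and>
     (\<forall>t\<in>{0..1}. integral\<^sup>L M (W t) = 0) \<and>
     (\<forall>s\<in>{0..1}. \<forall>t\<in>{0..1}.
        integral\<^sup>L M (\<lambda>\<omega>. W s \<omega> * W t \<omega>) =
          (s powr (2 * H) + t powr (2 * H) - \<bar>t - s\<bar> powr (2 * H)) / 2) \<and>
     (\<forall>\<omega>\<in>space M. continuous_on {0..1} (\<lambda>t. W t \<omega>))"


subsection \<open>The fractional Wiener--Weierstrass bridge\<close>

definition holder_on :: "real \<Rightarrow> real set \<Rightarrow> (real \<Rightarrow> real) \<Rightarrow> bool" where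
  "holder_on \<tau> S f \<longleftrightarrow>
     (\<exists>C\<ge>0. \<forall>s\<in>S. \<forall>t\<in>S. \<bar>f s - f t\<bar> \<le> C * \<bar>s - t\<bar> powr \<tau>)"

definition bridge ::
    "(real \<Rightarrow> real) \<Rightarrow> (real \<Rightarrow> 'w \<Rightarrow> real) \<Rightarrow> real \<Rightarrow> 'w \<Rightarrow> real" where
  "bridge \<kappa> W u \<omega> = W u \<omega> - \<kappa> u * W 1 \<omega>"

definition ww_bridge ::
    "real \<Rightarrow> nat \<Rightarrow> (real \<Rightarrow> real) \<Rightarrow> (real \<Rightarrow> 'w \<Rightarrow> real) \<Rightarrow> real \<Rightarrow> 'w \<Rightarrow> real" where
  "ww_bridge \<alpha> b \<kappa> W t \<omega> = (\<Sum>n. \<alpha> ^ n * bridge \<kappa> W (frac (real b ^ n * t)) \<omega>)"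

definition path_graph :: "(real \<Rightarrow> 'w \<Rightarrow> real) \<Rightarrow> 'w \<Rightarrow> (real \<times> real) set" where
  "path_graph Y \<omega> = (\<lambda>t. (t, Y t \<omega>)) ` {0..1}"

end

(*
  Let h = min H s with alpha = b^(-s), so that the claimed dimension is 2 - h.

  Upper bound: almost surely W is Hoelder continuous of every order below H (Kolmogorov), hence Y is
  Hoelder continuous of every order gamma < h, and its graph is covered by boxes.

  Lower bound: put a measure of dimension close to 1 on a Cantor set of times t whose orbit b^n t mod 1
  returns to a small interval [0, theta) only when L divides n. A function f supported in (0, theta) lets
  one read off isolated terms of the series; if f is a combination of tents, it lies in the reproducing
  kernel Hilbert space of W, and Cauchy-Schwarz there bounds Var (Y t - Y u) from below by the square of
  the corresponding difference of sum alpha^n f(b^n t mod 1). A narrow tent around t gives |t - u|^(2H),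
  a fixed bump that recognises the first digit in which t and u differ gives |t - u|^(2s). With these
  variances, Gaussian small-ball estimates and the mass distribution principle yield the dimension.
*)

theory Submission
  imports Defs "HOL-Real_Asymp.Real_Asymp"
begin

section \<open>Hausdorff dimension\<close>

text \<open>All terms of the series use one and the same path, so the contributions of different
  scales to \<open>Y t - Y u\<close> are dependent and could cancel. Thinning the times removes
  this: only one term in \<open>L\<close> meets the support of \<open>f\<close>, and once
  \<open>\<alpha> ^ L\<close> is at most 1/3 the first surviving discrepancy outweighs all later
  ones. Moreover \<open>f\<close> vanishes at 0, as every member of the Hilbert space does, and at
  1, where it kills the contribution of \<open>\<kappa> u * W 1\<close>. The price is that the times
  only carry dimension \<open>log Q / log B\<close>, where \<open>B = b ^ L\<close> and
  \<open>Q\<close> counts the admissible digit words; this tends to 1 for long words. Two times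
  whose words first differ at index \<open>q\<close> lie at distance at least of order B^(-q), their
  increment has variance at least of order B^(-2hq), and such pairs have mass of order at most
  Q^(-q). The expected discretised energy of order u >= 1 is then finite as soon as B^(u+h-1) < Q,
  which can be arranged for every u < 2 - h.\<close>

lemma hausdorff_dim_geI:
  fixes A :: "'a::metric_space set" and c :: ennreal
  assumes "0 < c" "0 < u"
    and cover: "\<And>U. A \<subseteq> (\<Union>i. U i) \<Longrightarrow> (\<And>i. bounded (U i)) \<Longrightarrow> (\<And>i. diameter (U i) \<le> 1) \<Longrightarrow>
                  c \<le> (\<Sum>i. diam_pow u (U i))"
  shows "ereal u \<le> hausdorff_dim A"
  unfolding hausdorff_dim_def
proof (rule INF_greatest)
  fix s assume "s \<in> {s. 0 \<le> s \<and> hausdorff_measure s A = 0}"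
  then have s: "0 \<le> s" "hausdorff_measure s A = 0" by auto
  show "ereal u \<le> ereal s"
  proof (rule ccontr)
    assume "\<not> ereal u \<le> ereal s"
    then have su: "s < u" by simp
    \<comment> \<open>For diameters at most 1 the power decreases in the exponent, so a cover that
      is cheap for \<open>s\<close> is cheaper still for \<open>u\<close>. The bound by 1 below
      serves the case \<open>s = 0\<close>, where every nonempty set costs 1.\<close>
    have mono: "diam_pow u U \<le> diam_pow s U" if "bounded U" "diameter U \<le> 1" for U :: "'a set"
    proof -
      have "0 \<le> diameter U" using that by (simp add: diameter_ge_0)
      then have "diameter U powr u \<le> diameter U powr s"
        using that su by (intro powr_mono') auto
      moreover have "diameter U powr u \<le> 1"
        using that assms \<open>0 \<le> diameter U\<close> by (intro powr_le1) auto
      ultimately show ?thesis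
        using assms by (auto simp: diam_pow_def ennreal_leI simp flip: ennreal_1)
    qed
    have "c \<le> hausdorff_premeasure s 1 A"
      unfolding hausdorff_premeasure_def
    proof (rule INF_greatest)
      fix U assume U: "U \<in> delta_covers 1 A"
      then have "c \<le> (\<Sum>i. diam_pow u (U i))"
        by (intro cover) (auto simp: delta_covers_def)
      also have "\<dots> \<le> (\<Sum>i. diam_pow s (U i))"
        using U by (intro suminf_le mono) (auto simp: delta_covers_def)
      finally show "c \<le> (\<Sum>i. diam_pow s (U i))" .
    qed
    also have "\<dots> \<le> hausdorff_measure s A"
      unfolding hausdorff_measure_def by (intro SUP_upper) auto
    finally show False using s \<open>0 < c\<close> by auto
  qed
qed

text \<open>The integral is a discretised \<open>u\<close>-energy of the image of \<open>N\<close>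
  under \<open>Z\<close>. If it is finite, the inner sum is bounded by some \<open>M\<close> on a
  set of positive mass, and around each point of that set the ball of radius \<beta>^(-k) has mass
  at most M \<beta>^(-uk). This Frostman bound limits the mass that a cover element can
  carry.\<close>

lemma hausdorff_dim_ge_mass:
  fixes A :: "'a::{metric_space,second_countable_topology} set" and Z :: "'b \<Rightarrow> 'a"
  assumes "prob_space N" and Z[measurable]: "Z \<in> borel_measurable N" and ZA: "Z ` space N \<subseteq> A"
    and u: "0 < u" and \<beta>: "1 < \<beta>"
    and fin: "(\<integral>\<^sup>+x. (\<Sum>k. ennreal (\<beta> powr (u * real k)) *
        emeasure N {y\<in>space N. dist (Z x) (Z y) \<le> \<beta> powr (- real k)}) \<partial>N) < \<infinity>"
  shows "ereal u \<le> hausdorff_dim A"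
proof -
  interpret prob_space N by fact
  define \<phi> where "\<phi> x = (\<Sum>k. ennreal (\<beta> powr (u * real k)) *
        emeasure N {y\<in>space N. dist (Z x) (Z y) \<le> \<beta> powr (- real k)})" for x
  have em: "(\<lambda>x. emeasure N {y\<in>space N. dist (Z x) (Z y) \<le> r}) \<in> borel_measurable N" for r
  proof -
    have "(\<lambda>x. \<integral>\<^sup>+y. indicator {y\<in>space N. dist (Z x) (Z y) \<le> r} y \<partial>N) \<in> borel_measurable N"
      by measurable
    moreover have "(\<integral>\<^sup>+y. indicator {y\<in>space N. dist (Z x) (Z y) \<le> r} y \<partial>N) 
        = emeasure N {y\<in>space N. dist (Z x) (Z y) \<le> r}" if "x \<in> space N" for x
      by (rule nn_integral_indicator) measurable
    ultimately show ?thesis by (simp cong: measurable_cong)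
  qed
  have \<phi>_meas[measurable]: "\<phi> \<in> borel_measurable N"
    unfolding \<phi>_def using em by measurable
  have "AE x in N. \<phi> x \<noteq> \<infinity>"
    using fin by (intro nn_integral_PInf_AE) (auto simp: \<phi>_def[symmetric])
  then have AEM: "AE x in N. \<exists>M::nat. \<phi> x \<le> of_nat M"
  proof eventually_elim
    case (elim x)
    then obtain r where "\<phi> x = ennreal r" "r \<ge> 0" by (cases "\<phi> x") auto
    moreover obtain M :: nat where "r \<le> of_nat M" using real_arch_simple by blast
    ultimately show ?case by (intro exI[of _ M]) (simp add: ennreal_of_nat_eq_real_of_nat ennreal_leI)
  qed
  define G where "G M = {x\<in>space N. \<phi> x \<le> of_nat M}" for M :: nat
  have G[measurable]: "G M \<in> sets N" for M unfolding G_def by measurable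
  have "\<exists>M. emeasure N (G M) > 0"
  proof (rule ccontr)
    assume "\<nexists>M. emeasure N (G M) > 0"
    then have "AE x in N. \<forall>M. x \<notin> G M"
      by (intro AE_all_countable[THEN iffD2] allI AE_not_in) (auto simp: null_sets_def)
    with AEM AE_space have "AE x in N. False" by eventually_elim (auto simp: G_def)
    then show False by simp
  qed
  then obtain M where M: "emeasure N (G M) > 0" by auto
  \<comment> \<open>The factor \<open>\<beta> powr u\<close> pays for rounding a diameter up to a
    power of \<beta>; the summand 1 keeps \<open>C\<close> nonzero when
    \<open>M = 0\<close>.\<close>
  define C where "C = (of_nat M + 1) * ennreal (\<beta> powr u)"
  have C: "C \<noteq> 0" "C \<noteq> \<infinity>" using \<beta>
    by (auto simp: C_def ennreal_mult_eq_top_iff ennreal_of_nat_eq_real_of_nat simp flip: ennreal_1 ennreal_plus)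
  show ?thesis
  proof (rule hausdorff_dim_geI[OF _ u])
    show "0 < emeasure N (G M) / C" using M C
      by (simp add: ennreal_zero_less_divide less_top)
    fix U :: "nat \<Rightarrow> 'a set"
    assume U: "A \<subseteq> (\<Union>i. U i)" and bd: "\<And>i. bounded (U i)" and dm: "\<And>i. diameter (U i) \<le> 1"
    define p where "p i = (SOME x. x \<in> G M \<and> Z x \<in> U i)" for i
    have p: "p i \<in> G M \<and> Z (p i) \<in> U i" if "x \<in> G M" "Z x \<in> U i" for x i
      unfolding p_def using that by (intro someI_ex[of "\<lambda>x. x \<in> G M \<and> Z x \<in> U i"]) auto
    \<comment> \<open>Cover elements may be non-measurable. Each one that meets the good set is
      replaced by the closed ball around one of its good points whose radius is its diameter, pulled
      back to \<open>N\<close>.\<close>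
    define V where "V i = (if Z ` G M \<inter> U i = {} then {} 
        else {y\<in>space N. dist (Z (p i)) (Z y) \<le> diameter (U i)})" for i
    have Vm: "V i \<in> sets N" for i
    proof (cases "Z ` G M \<inter> U i = {}")
      case False
      then have "p i \<in> space N" using p G[THEN sets.sets_into_space] by blast
      then show ?thesis unfolding V_def by (auto intro!: borel_measurable_le borel_measurable_dist)
    qed (simp add: V_def)
    have ballM: "emeasure N {y\<in>space N. dist (Z x) (Z y) \<le> \<beta> powr (- real k)} \<le> of_nat M * ennreal (\<beta> powr (- u * real k))"
      if "x \<in> G M" for x k
    proof -
      have "ennreal (\<beta> powr (u * real k)) * emeasure N {y\<in>space N. dist (Z x) (Z y) \<le> \<beta> powr (- real k)} \<le> \<phi> x"
        unfolding \<phi>_def using sum_le_suminf[of "\<lambda>k. ennreal (\<beta> powr (u * real k)) *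
          emeasure N {y\<in>space N. dist (Z x) (Z y) \<le> \<beta> powr (- real k)}" "{k}"] by simp
      also have "\<dots> \<le> of_nat M" using that by (simp add: G_def)
      finally have "ennreal (\<beta> powr (- u * real k)) * (ennreal (\<beta> powr (u * real k)) * 
          emeasure N {y\<in>space N. dist (Z x) (Z y) \<le> \<beta> powr (- real k)}) \<le> ennreal (\<beta> powr (- u * real k)) * of_nat M"
        by (rule mult_left_mono) simp
      moreover have "ennreal (\<beta> powr (- u * real k)) * ennreal (\<beta> powr (u * real k)) = 1"
        using \<beta> by (simp flip: ennreal_mult add: powr_add[symmetric])
      ultimately show ?thesis by (simp add: mult.assoc[symmetric] mult.commute)
    qed
    have Vle: "emeasure N (V i) \<le> C * diam_pow u (U i)" for i
    proof (cases "Z ` G M \<inter> U i = {}")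
      case False
      then have pi: "p i \<in> G M" "Z (p i) \<in> U i" "U i \<noteq> {}" using p by blast+
      let ?d = "diameter (U i)"
      have d0: "0 \<le> ?d" using bd by (simp add: diameter_ge_0)
      have sub: "V i \<subseteq> {y\<in>space N. dist (Z (p i)) (Z y) \<le> \<beta> powr (- real k)}" 
        if "?d \<le> \<beta> powr (- real k)" for k
        using that by (auto simp: V_def)
      have bound: "emeasure N (V i) \<le> of_nat M * ennreal (\<beta> powr (- u * real k))" 
        if "?d \<le> \<beta> powr (- real k)" for k
      proof -
        have "p i \<in> space N" using pi by (auto simp: G_def)
        then have "emeasure N (V i) \<le> emeasure N {y\<in>space N. dist (Z (p i)) (Z y) \<le> \<beta> powr (- real k)}"
          by (intro emeasure_mono sub that) measurable
        also have "\<dots> \<le> of_nat M * ennreal (\<beta> powr (- u * real k))" by (rule ballM[OF pi(1)])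
        finally show ?thesis .
      qed
      show ?thesis
      \<comment> \<open>A set of diameter 0 fits into every scale, and letting the scale tend to 0
        leaves no mass.\<close>
      proof (cases "?d = 0")
        case True
        have "(\<lambda>k. \<beta> powr (- u * real k)) \<longlonglongrightarrow> 0"
        proof -
          have "(\<lambda>k. (\<beta> powr (-u)) ^ k) \<longlonglongrightarrow> 0" using \<beta> u
            by (intro LIMSEQ_power_zero) (auto simp: powr_less_one)
          moreover have "(\<beta> powr (-u)) ^ k = \<beta> powr (- u * real k)" for k
            using \<beta> powr_realpow[of "\<beta> powr (-u)" k] by (simp add: powr_powr)
          ultimately show ?thesis by simp
        qed
        then have "(\<lambda>k. real M * \<beta> powr (- u * real k)) \<longlonglongrightarrow> 0" by (rule tendsto_mult_right_zero)
        then have "(\<lambda>k. ennreal (real M * \<beta> powr (- u * real k))) \<longlonglongrightarrow> ennreal 0"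
          by (intro tendsto_ennrealI)
        then have "emeasure N (V i) \<le> ennreal 0"
          using bound True by (intro LIMSEQ_le_const) (auto simp: ennreal_mult ennreal_of_nat_eq_real_of_nat)
        then show ?thesis by simp
      next
        case False
        then have d: "0 < ?d" using d0 by simp
        define k where "k = nat \<lfloor>- log \<beta> ?d\<rfloor>"
        have l0: "0 \<le> - log \<beta> ?d" using d dm[of i] \<beta> by (simp add: log_le_zero_cancel_iff)
        then have k: "real k \<le> - log \<beta> ?d" "- log \<beta> ?d \<le> real k + 1" unfolding k_def by linarith+
        have eq: "?d = \<beta> powr (log \<beta> ?d)" using d \<beta> by simp
        have "?d \<le> \<beta> powr (- real k)"
          using k \<beta> by (subst eq) (auto intro!: powr_mono)
        then have "emeasure N (V i) \<le> of_nat M * ennreal (\<beta> powr (- u * real k))" by (rule bound)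
        also have "\<beta> powr (- u * real k) \<le> \<beta> powr u * ?d powr u"
        proof -
          have "?d powr u = \<beta> powr (log \<beta> ?d * u)" by (subst eq) (rule powr_powr)
          then have "\<beta> powr u * ?d powr u = \<beta> powr (u + log \<beta> ?d * u)" by (simp add: powr_add)
          moreover have "- u * real k \<le> u + log \<beta> ?d * u"
          proof -
            have "u * (- log \<beta> ?d) \<le> u * (real k + 1)" using k u by (intro mult_left_mono) auto
            then show ?thesis by (simp add: algebra_simps)
          qed
          ultimately show ?thesis using \<beta> by (auto intro!: powr_mono)
        qed
        then have "of_nat M * ennreal (\<beta> powr (- u * real k)) \<le> (of_nat M + 1) * ennreal (\<beta> powr u * ?d powr u)"
          by (intro mult_mono ennreal_leI) auto
        also have "\<dots> = C * diam_pow u (U i)"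
          using u pi by (simp add: C_def diam_pow_def ennreal_mult mult.assoc)
        finally show ?thesis .
      qed
    qed (simp add: V_def)
    have "G M \<subseteq> (\<Union>i. V i)"
    proof
      fix x assume x: "x \<in> G M"
      then have "Z x \<in> A" using ZA by (auto simp: G_def)
      then obtain i where i: "Z x \<in> U i" using U by auto
      then have "Z (p i) \<in> U i" using p x by blast
      then have "dist (Z (p i)) (Z x) \<le> diameter (U i)"
        using i bd by (intro diameter_bounded_bound) auto
      then show "x \<in> (\<Union>i. V i)" using x i by (auto simp: V_def G_def intro!: exI[of _ i])
    qed
    then have "emeasure N (G M) \<le> emeasure N (\<Union>i. V i)"
      using Vm by (intro emeasure_mono) auto
    also have "\<dots> \<le> (\<Sum>i. emeasure N (V i))"
      using Vm by (intro emeasure_subadditive_countably) auto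
    also have "\<dots> \<le> (\<Sum>i. C * diam_pow u (U i))"
      by (intro suminf_le Vle) auto
    also have "\<dots> = C * (\<Sum>i. diam_pow u (U i))" by simp
    finally show "emeasure N (G M) / C \<le> (\<Sum>i. diam_pow u (U i))"
      using C by (subst divide_le_posI_ennreal) (auto simp: mult.commute zero_less_iff_neq_zero)
  qed
qed

text \<open>Cut the time axis into \<open>n\<close> columns of width 1/n. Over one column the graph
  stays in a band of height 2 C n^(-\<gamma>), so of the order of n^(1-\<gamma>) squares of side 1/n
  suffice there. The total cost \<open>E n\<close> tends to 0 for
  \<open>s > 2 - \<gamma>\<close>.\<close>

lemma hausdorff_dim_holder_graph_le:
  fixes f :: "real \<Rightarrow> real"
  assumes C: "0 \<le> C" and \<gamma>: "0 < \<gamma>" "\<gamma> \<le> 1"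
    and hold: "\<And>s t. s \<in> {0..1} \<Longrightarrow> t \<in> {0..1} \<Longrightarrow> \<bar>f s - f t\<bar> \<le> C * \<bar>s - t\<bar> powr \<gamma>"
  shows "hausdorff_dim ((\<lambda>t. (t, f t)) ` {0..1}) \<le> ereal (2 - \<gamma>)"
proof -
  let ?A = "(\<lambda>t. (t, f t)) ` {0..1}"
  have zero: "hausdorff_measure s ?A = 0" if s: "2 - \<gamma> < s" for s
  proof -
    define E where "E n = (4 * C + 4) * 2 powr s * real n powr (2 - \<gamma> - s)" for n :: nat
    have pre: "hausdorff_premeasure s \<delta> ?A \<le> ennreal (E n)" if n: "0 < n" "2 / real n \<le> \<delta>" for n \<delta>
    proof -
      define J where "J = nat \<lceil>2 * C * real n powr (1 - \<gamma>)\<rceil> + 1"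
      define V where "V i j = {real i / n .. (real i + 1) / n} \<times> 
        {f (real i / n) - C * real n powr (-\<gamma>) + real j / n .. f (real i / n) - C * real n powr (-\<gamma>) + (real j + 1) / n}" for i j :: nat
      \<comment> \<open>\<open>div\<close> and \<open>mod\<close> enumerate the squares by column
        and row; the rest of the sequence is padded with the empty set, which costs nothing.\<close>
      define U where "U k = (if k < n * J then V (k div J) (k mod J) else {})" for k
      have n0: "real n > 0" using n by simp
      have n1: "1 \<le> real n powr (1 - \<gamma>)" using n \<gamma> by (intro ge_one_powr_ge_zero) auto
      have J: "0 < J" "real J \<le> (2 * C + 2) * real n powr (1 - \<gamma>)" "2 * C * real n powr (1 - \<gamma>) < real J"
      proof -
        show "0 < J" by (simp add: J_def)
        have "0 \<le> 2 * C * real n powr (1 - \<gamma>)" using C by simp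
        then have "real J \<le> 2 * C * real n powr (1 - \<gamma>) + 2" unfolding J_def by linarith
        then show "real J \<le> (2 * C + 2) * real n powr (1 - \<gamma>)" using n1 by (simp add: algebra_simps)
        show "2 * C * real n powr (1 - \<gamma>) < real J" unfolding J_def by linarith
      qed
      have dV: "diameter (V i j) \<le> 2 / n" "bounded (V i j)" for i j
      proof -
        have ne: "{real i / n .. (real i + 1) / n} \<noteq> {}" using n0 by (auto simp: divide_right_mono)
        show "bounded (V i j)" unfolding V_def by (intro bounded_Times) auto
        show "diameter (V i j) \<le> 2 / n"
        proof (rule diameter_le)
          fix x y assume xy: "x \<in> V i j" "y \<in> V i j"
          obtain x1 x2 y1 y2 where [simp]: "x = (x1,x2)" "y = (y1,y2)" by (cases x, cases y)
          have a: "\<bar>x1 - y1\<bar> \<le> 1/n" using xy n0 by (auto simp: V_def add_divide_distrib abs_le_iff)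
          have b: "\<bar>x2 - y2\<bar> \<le> 1/n" using xy n0 by (auto simp: V_def add_divide_distrib abs_le_iff)
          have "norm (x - y) \<le> norm (x1 - y1) + norm (x2 - y2)"
            by (simp add: norm_Pair) (rule sqrt_sum_squares_le_sum_abs)
          then show "norm (x - y) \<le> 2 / n" using a b by simp
        qed (use n0 in auto)
      qed
      have "U \<in> delta_covers \<delta> ?A"
      proof -
        have "?A \<subseteq> (\<Union>k. U k)"
        proof clarify
          fix t :: real assume t: "t \<in> {0..1}"
          \<comment> \<open>The minimum puts t = 1 into the last column.\<close>
          define i where "i = min (n - 1) (nat \<lfloor>t * n\<rfloor>)"
          have i: "i < n" "real i \<le> t * n" "t * n \<le> real i + 1"
          proof -
            show "i < n" using n by (auto simp: i_def)
            have t0: "0 \<le> t * n" "t * n \<le> n" using t n0 by (auto simp: mult_le_cancel_right1)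
            show "real i \<le> t * n" using t0 unfolding i_def by linarith
            show "t * n \<le> real i + 1"
            proof (cases "nat \<lfloor>t * n\<rfloor> \<le> n - 1")
              case True
              then show ?thesis using t0 unfolding i_def by linarith
            next
              case False
              then have "real i = real n - 1" using n by (auto simp: i_def min_def of_nat_diff)
              then show ?thesis using t0 by simp
            qed
          qed
          have ti: "real i / n \<le> t" "t \<le> (real i + 1) / n" using i n0 by (auto simp: field_simps)
          have "\<bar>f t - f (real i / n)\<bar> \<le> C * \<bar>t - real i / n\<bar> powr \<gamma>"
            using i t n0 by (intro hold) (auto simp: field_simps)
          also have "\<dots> \<le> C * (1/n) powr \<gamma>"
            using ti C \<gamma> by (intro mult_left_mono powr_mono2) (auto simp: add_divide_distrib)
          also have "(1/n) powr \<gamma> = real n powr (-\<gamma>)" using n0 by (simp add: powr_minus powr_divide inverse_eq_divide)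
          finally have ft: "\<bar>f t - f (real i / n)\<bar> \<le> C * real n powr (-\<gamma>)" .
          define v where "v = (f t - (f (real i / n) - C * real n powr (-\<gamma>))) * n"
          have pw: "real n powr (-\<gamma>) * n = real n powr (1 - \<gamma>)" using n0 by (simp add: powr_diff powr_minus field_simps)
          have v: "0 \<le> v" "v < real J"
          proof -
            show "0 \<le> v" using ft n0 unfolding v_def by (intro mult_nonneg_nonneg) auto
            have "v \<le> 2 * C * real n powr (-\<gamma>) * n" unfolding v_def using ft n0 by (intro mult_right_mono) auto
            also have "\<dots> = 2 * C * real n powr (1 - \<gamma>)" using pw by (simp add: mult.assoc)
            finally show "v < real J" using J by simp
          qed
          define j where "j = nat \<lfloor>v\<rfloor>"
          have j: "j < J" "real j \<le> v" "v \<le> real j + 1" using v unfolding j_def by linarith+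
          have "(t, f t) \<in> V i j"
          proof -
            have fv: "f t = f (real i / n) - C * real n powr (-\<gamma>) + v / n" using n0 by (simp add: v_def)
            have "real j / n \<le> v / n" "v / n \<le> (real j + 1) / n" using j n0 by (auto intro: divide_right_mono)
            then show ?thesis using ti fv unfolding V_def mem_Times_iff by auto
          qed
          moreover have "V i j = U (i * J + j)"
          proof -
            have "i * J + j < (i + 1) * J" using j by simp
            also have "\<dots> \<le> n * J" using i by (intro mult_right_mono) auto
            finally show ?thesis using j by (simp add: U_def)
          qed
          ultimately show "(t, f t) \<in> (\<Union>k. U k)" by auto
        qed
        moreover have "bounded (U k) \<and> diameter (U k) \<le> \<delta>" for k
        proof (cases "k < n * J")
          case True
          then show ?thesis using dV[of "k div J" "k mod J"] n by (auto simp: U_def)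
        next
          case False
          have "0 \<le> \<delta>" using n(2) by (rule order_trans[rotated]) simp
          then show ?thesis using False by (auto simp: U_def diameter_def)
        qed
        ultimately show ?thesis by (auto simp: delta_covers_def)
      qed
      then have "hausdorff_premeasure s \<delta> ?A \<le> (\<Sum>k. diam_pow s (U k))"
        unfolding hausdorff_premeasure_def by (intro INF_lower)
      also have "\<dots> = (\<Sum>k<n*J. diam_pow s (U k))"
        by (intro suminf_finite) (auto simp: U_def diam_pow_def)
      also have "\<dots> \<le> (\<Sum>k<n*J. ennreal ((2/n) powr s))"
      proof (intro sum_mono)
        fix k assume "k \<in> {..<n*J}"
        then have "U k = V (k div J) (k mod J)" by (simp add: U_def)
        then have "0 \<le> diameter (U k)" "diameter (U k) \<le> 2 / n" using dV by (auto simp: diameter_ge_0)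
        then show "diam_pow s (U k) \<le> ennreal ((2/n) powr s)"
          using s \<gamma> by (auto simp: diam_pow_def intro!: ennreal_leI powr_mono2)
      qed
      also have "\<dots> = ennreal (real (n * J) * (2/n) powr s)"
        by (simp add: ennreal_of_nat_eq_real_of_nat ennreal_mult)
      also have "\<dots> \<le> ennreal (E n)"
      proof (rule ennreal_leI)
        have "real (n * J) * (2/n) powr s \<le> n * ((2 * C + 2) * real n powr (1 - \<gamma>)) * (2/n) powr s"
          using J n0 by (auto intro!: mult_right_mono)
        also have "\<dots> = (2 * C + 2) * 2 powr s * (n * real n powr (1 - \<gamma>) * real n powr (-s))"
          using n0 by (simp add: powr_divide powr_minus_divide)
        also have "n * real n powr (1 - \<gamma>) * real n powr (-s) = real n powr (2 - \<gamma> - s)"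
          using n0 powr_add[of n 1 "1-\<gamma>"] powr_add[of n "2-\<gamma>" "-s"] by simp
        also have "(2 * C + 2) * 2 powr s * real n powr (2 - \<gamma> - s) \<le> E n"
          unfolding E_def using C by (intro mult_right_mono) auto
        finally show "real (n * J) * (2/n) powr s \<le> E n" .
      qed
      finally show ?thesis .
    qed
    have E0: "E \<longlonglongrightarrow> 0"
    proof -
      have "(\<lambda>n. real n powr (2 - \<gamma> - s)) \<longlonglongrightarrow> 0" using s
        by (intro tendsto_neg_powr filterlim_real_sequentially) auto
      then show ?thesis unfolding E_def by (rule tendsto_mult_right_zero)
    qed
    have "hausdorff_premeasure s \<delta> ?A = 0" if \<delta>: "0 < \<delta>" for \<delta>
    proof -
      have "(\<lambda>n. ennreal (E n)) \<longlonglongrightarrow> ennreal 0" using E0 by (intro tendsto_ennrealI)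
      moreover have "\<exists>N. \<forall>n\<ge>N. hausdorff_premeasure s \<delta> ?A \<le> ennreal (E n)"
      proof -
        obtain N :: nat where N: "2 / \<delta> < real N" using reals_Archimedean2 by blast
        show ?thesis
        proof (intro exI[of _ N] allI impI pre)
          fix n assume n: "N \<le> n"
          have "0 < real N" using N \<delta> by (meson divide_pos_pos less_trans zero_less_numeral)
          then show "0 < n" using n by simp
          then show "2 / real n \<le> \<delta>" using N n \<delta> by (simp add: field_simps)
             (smt (verit, ccfv_SIG) mult_left_mono of_nat_mono)
        qed
      qed
      ultimately have "hausdorff_premeasure s \<delta> ?A \<le> ennreal 0" by (rule LIMSEQ_le_const)
      then show ?thesis by simp
    qed
    then show ?thesis by (simp add: hausdorff_measure_def)
  qed
  show ?thesis
  proof (rule dense_ge)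
    fix z assume z: "ereal (2 - \<gamma>) < z"
    show "hausdorff_dim ?A \<le> z"
    proof (cases z)
      case (real r)
      then have "2 - \<gamma> < r" using z by simp
      then show ?thesis unfolding hausdorff_dim_def real using zero \<gamma> by (intro INF_lower) auto
    qed (use z in auto)
  qed
qed

section \<open>Fractional covariance kernel and tent functions\<close>

text \<open>Spectral integrals run over the positive half-line. Extending the power by 0 lets all of
  them be integrals over \<open>lborel\<close>, where affine substitution is available.\<close>

definition half_powr :: "real \<Rightarrow> real \<Rightarrow> real" where
  "half_powr a \<xi> = (if 0 < \<xi> then \<xi> powr a else 0)"

lemma half_powr_measurable[measurable]: "half_powr a \<in> borel_measurable borel"
  unfolding half_powr_def by measurable

lemma half_powr_nonneg[simp]: "0 \<le> half_powr a \<xi>"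
  by (simp add: half_powr_def)

lemma half_powr_scale: "0 < x \<Longrightarrow> half_powr a (x * \<xi>) = x powr a * half_powr a \<xi>"
  by (auto simp: half_powr_def powr_mult zero_less_mult_iff)

lemma half_powr_mult: "half_powr a \<xi> * half_powr c \<xi> = half_powr (a + c) \<xi>"
  by (simp add: half_powr_def powr_add)

text \<open>\<open>p\<close> is the order to which \<open>f\<close> vanishes at the origin; the two
  conditions on exponents are those for a power to be integrable near 0 and near infinity.\<close>

lemma integrable_half_powr:
  fixes f :: "real \<Rightarrow> real"
  assumes [measurable]: "f \<in> borel_measurable borel"
    and small: "\<And>\<xi>. 0 < \<xi> \<Longrightarrow> \<xi> \<le> 1 \<Longrightarrow> \<bar>f \<xi>\<bar> \<le> A * \<xi> powr p"
    and large: "\<And>\<xi>. \<bar>f \<xi>\<bar> \<le> A"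
    and ap: "-1 < p + a" "a < -1"
  shows "integrable lborel (\<lambda>\<xi>. f \<xi> * half_powr a \<xi>)"
proof -
  let ?g = "\<lambda>\<xi>. A * (indicator {0..1} \<xi> *\<^sub>R \<xi> powr (p + a)) + A * (indicator {1..} \<xi> *\<^sub>R \<xi> powr a)"
  have "set_integrable lebesgue {0..1} (\<lambda>\<xi>::real. \<xi> powr (p + a))"
    by (intro nonnegative_absolutely_integrable_1 integrable_on_powr_from_0 ap) auto
  then have 1: "integrable lborel (\<lambda>\<xi>. indicator {0..1} \<xi> *\<^sub>R \<xi> powr (p + a))"
    unfolding set_integrable_def by (subst (asm) integrable_completion) auto
  have "set_integrable lebesgue {1..} (\<lambda>\<xi>::real. \<xi> powr a)"
    using has_integral_powr_to_inf[of a 1] ap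
    by (intro nonnegative_absolutely_integrable_1) (auto simp: integrable_on_def)
  then have 2: "integrable lborel (\<lambda>\<xi>. indicator {1..} \<xi> *\<^sub>R \<xi> powr a)"
    unfolding set_integrable_def by (subst (asm) integrable_completion) auto
  have A: "0 \<le> A" using large[of 0] by linarith
  show ?thesis
  proof (rule Bochner_Integration.integrable_bound)
    show "integrable lborel ?g" by (intro Bochner_Integration.integrable_add integrable_mult_right 1 2)
    show "AE \<xi> in lborel. norm (f \<xi> * half_powr a \<xi>) \<le> norm (?g \<xi>)"
    proof (rule AE_I2)
      fix \<xi> :: real
      consider "\<xi> \<le> 0" | "0 < \<xi>" "\<xi> \<le> 1" | "1 < \<xi>" by linarith
      then show "norm (f \<xi> * half_powr a \<xi>) \<le> norm (?g \<xi>)"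
      proof cases
        case 2
        have "\<bar>f \<xi>\<bar> * \<xi> powr a \<le> A * \<xi> powr p * \<xi> powr a"
          using small 2 by (intro mult_right_mono) auto
        also have "\<dots> = A * \<xi> powr (p + a)" by (simp add: powr_add)
        also have "\<dots> \<le> ?g \<xi>" using 2 A by simp
        finally show ?thesis using 2 by (simp add: half_powr_def abs_mult)
      next
        case 3
        have "\<bar>f \<xi>\<bar> * \<xi> powr a \<le> A * \<xi> powr a" using large by (intro mult_right_mono) auto
        then show ?thesis using 3 A by (simp add: half_powr_def abs_mult)
      qed (simp add: half_powr_def)
    qed
  qed simp
qed

lemma one_minus_cos_le: "1 - cos x \<le> x\<^sup>2 / 2" for x :: real
proof -
  have "1 - cos x = 2 * (sin (x / 2))\<^sup>2" using cos_double_sin[of "x / 2"] by simp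
  also have "(sin (x / 2))\<^sup>2 \<le> (x / 2)\<^sup>2"
    using abs_sin_x_le_abs_x[of "x/2"] by (simp only: abs_le_square_iff)
  finally show ?thesis by (simp add: power2_eq_square)
qed

text \<open>The summand 2 in the constant makes it dominate the uniform bound as well, so that one
  constant serves near 0 and near infinity.\<close>

lemma one_minus_cos_le': "\<bar>1 - cos (x * \<xi>)\<bar> \<le> (2 + x\<^sup>2 / 2) * \<xi> powr 2" if "0 < \<xi>" for x \<xi> :: real
proof -
  have "\<bar>1 - cos (x * \<xi>)\<bar> \<le> (x * \<xi>)\<^sup>2 / 2" using one_minus_cos_le[of "x * \<xi>"] by simp
  also have "\<dots> = x\<^sup>2 / 2 * \<xi> powr 2" using that by (simp add: power_mult_distrib powr_numeral)
  also have "\<dots> \<le> (2 + x\<^sup>2 / 2) * \<xi> powr 2" by (intro mult_right_mono) auto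
  finally show ?thesis .
qed

lemma abs_one_minus_cos_le_2: "\<bar>1 - cos x\<bar> \<le> 2" for x :: real
  using cos_ge_minus_one[of x] cos_le_one[of x] by linarith

text \<open>Normalising constant of the spectral measure of fractional Brownian motion, whose
  density is a multiple of \<xi>^(-1-2H).\<close>

definition cos_const :: "real \<Rightarrow> real" where
  "cos_const H = (\<integral>\<xi>. (1 - cos \<xi>) * half_powr (- 1 - 2 * H) \<xi> \<partial>lborel)"

text \<open>The Fourier transform of a tent is a multiple of (1 - cos \<xi>) / \<xi>^2. Its squared
  modulus, divided by the spectral density \<xi>^(-1-2H), gives this integrand: a squared norm in
  the reproducing kernel Hilbert space, up to constants.\<close>

definition cos_sq_const :: "real \<Rightarrow> real" where
  "cos_sq_const H = (\<integral>\<xi>. (1 - cos \<xi>)\<^sup>2 * half_powr (2 * H - 3) \<xi> \<partial>lborel)"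

lemma integral_half_powr_pos:
  assumes int: "integrable lborel (\<lambda>\<xi>. f \<xi> * half_powr a \<xi>)"
    and nn: "\<And>\<xi>. 0 \<le> f \<xi>" and pos: "\<And>\<xi>. 0 < \<xi> \<Longrightarrow> \<xi> < 1 \<Longrightarrow> 0 < f \<xi>"
  shows "0 < (\<integral>\<xi>. f \<xi> * half_powr a \<xi> \<partial>lborel)"
proof -
  have "(\<integral>\<xi>. f \<xi> * half_powr a \<xi> \<partial>lborel) \<noteq> 0"
  proof
    assume "(\<integral>\<xi>. f \<xi> * half_powr a \<xi> \<partial>lborel) = 0"
    then have "AE \<xi> in lborel. f \<xi> * half_powr a \<xi> = 0"
      using int nn by (subst (asm) integral_nonneg_eq_0_iff_AE) auto
    then have "AE \<xi> in lborel. \<xi> \<notin> {0<..<1::real}"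
    proof eventually_elim
      case (elim \<xi>)
      then show ?case using pos[of \<xi>] by (auto simp: half_powr_def)
    qed
    then have "emeasure lborel {\<xi>::real. 0 < \<xi> \<and> \<xi> < 1} = 0"
      by (subst (asm) AE_iff_measurable[OF _ refl]) auto
    moreover have "{\<xi>. 0 < \<xi> \<and> \<xi> < 1} = {0<..<1::real}" by auto
    ultimately show False by simp
  qed
  moreover have "0 \<le> (\<integral>\<xi>. f \<xi> * half_powr a \<xi> \<partial>lborel)" using nn by simp
  ultimately show ?thesis by linarith
qed

lemma cos_less_one: "0 < \<xi> \<Longrightarrow> \<xi> < 1 \<Longrightarrow> cos \<xi> < 1" for \<xi> :: real
  using cos_monotone_0_pi[of 0 \<xi>] pi_gt3 by simp

lemma integrable_one_minus_cos:
  assumes "0 < H" "H < 1"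
  shows "integrable lborel (\<lambda>\<xi>. (1 - cos (x * \<xi>)) * half_powr (- 1 - 2 * H) \<xi>)"
proof (rule integrable_half_powr[where A = "2 + x\<^sup>2 / 2" and p = 2])
  show "\<bar>1 - cos (x * \<xi>)\<bar> \<le> 2 + x\<^sup>2 / 2" for \<xi>
    by (rule order_trans[OF abs_one_minus_cos_le_2]) simp
qed (use assms one_minus_cos_le' in auto)

lemma cos_const_pos: "0 < H \<Longrightarrow> H < 1 \<Longrightarrow> 0 < cos_const H"
  unfolding cos_const_def using integrable_one_minus_cos[of H 1]
  by (intro integral_half_powr_pos) (auto simp: cos_less_one)

text \<open>The weight is homogeneous, so a dilation comes out as a power. Both |x|^(2H) in the
  covariance and \<delta>^(2-2H) in the norm of a tent arise this way.\<close>

lemma has_bochner_integral_half_powr_scale: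
  assumes "has_bochner_integral lborel (\<lambda>\<xi>. f \<xi> * half_powr a \<xi>) I" and x: "0 < x"
  shows "has_bochner_integral lborel (\<lambda>\<xi>. f (x * \<xi>) * half_powr a \<xi>) (x powr (- a - 1) * I)"
proof -
  have "has_bochner_integral lborel (\<lambda>\<xi>. f (x * \<xi>) * half_powr a (x * \<xi>)) (I / x)"
    using assms lborel_has_bochner_integral_real_affine_iff[of x "\<lambda>\<xi>. f \<xi> * half_powr a \<xi>" I 0] 
    by (simp add: divide_inverse mult.commute)
  then have "has_bochner_integral lborel (\<lambda>\<xi>. x powr (-a) * (f (x * \<xi>) * half_powr a (x * \<xi>))) (x powr (-a) * (I / x))"
    by (rule has_bochner_integral_mult_right)
  moreover have "x powr (-a) * (f (x * \<xi>) * half_powr a (x * \<xi>)) = f (x * \<xi>) * half_powr a \<xi>" for \<xi>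
    using x by (simp add: half_powr_scale powr_minus)
  moreover have "x powr (-a) * (I / x) = x powr (- a - 1) * I"
    using x by (simp add: powr_diff)
  ultimately show ?thesis by simp
qed

lemma integral_one_minus_cos:
  assumes H: "0 < H" "H < 1"
  shows "has_bochner_integral lborel (\<lambda>\<xi>. (1 - cos (x * \<xi>)) * half_powr (- 1 - 2 * H) \<xi>)
           (cos_const H * \<bar>x\<bar> powr (2 * H))"
proof (cases "x = 0")
  case False
  have "has_bochner_integral lborel (\<lambda>\<xi>. (1 - cos \<xi>) * half_powr (- 1 - 2 * H) \<xi>) (cos_const H)"
    unfolding cos_const_def using integrable_one_minus_cos[OF H, of 1] by (intro has_bochner_integral_integrable) simp
  from has_bochner_integral_half_powr_scale[OF this, of "\<bar>x\<bar>"] False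
  have "has_bochner_integral lborel (\<lambda>\<xi>. (1 - cos (\<bar>x\<bar> * \<xi>)) * half_powr (- 1 - 2 * H) \<xi>)
           (cos_const H * \<bar>x\<bar> powr (2 * H))" by (simp add: mult.commute)
  moreover have "cos (\<bar>x\<bar> * \<xi>) = cos (x * \<xi>)" for \<xi> by (cases "0 \<le> x") auto
  ultimately show ?thesis by simp
qed (simp add: has_bochner_integral_zero)

lemma integrable_one_minus_cos_sq:
  assumes "0 < H" "H < 1"
  shows "integrable lborel (\<lambda>\<xi>. (1 - cos \<xi>)\<^sup>2 * half_powr (2 * H - 3) \<xi>)"
proof (rule integrable_half_powr[where A = "25" and p = 4])
  fix \<xi> :: real
  show "\<bar>(1 - cos \<xi>)\<^sup>2\<bar> \<le> 25"
    using abs_one_minus_cos_le_2[of \<xi>] power_mono[of "\<bar>1 - cos \<xi>\<bar>" 2 2] by simp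
  assume "0 < \<xi>"
  then have "\<bar>1 - cos \<xi>\<bar>\<^sup>2 \<le> ((2 + 1 / 2) * \<xi> powr 2)\<^sup>2"
    using one_minus_cos_le'[of \<xi> 1] by (intro power_mono) auto
  also have "\<dots> \<le> 25 * \<xi> powr 4" using \<open>0 < \<xi>\<close>
    by (simp add: power_mult_distrib power_divide powr_numeral flip: power_mult)
  finally show "\<bar>(1 - cos \<xi>)\<^sup>2\<bar> \<le> 25 * \<xi> powr 4" by simp
qed (use assms in auto)

lemma cos_sq_const_pos: "0 < H \<Longrightarrow> H < 1 \<Longrightarrow> 0 < cos_sq_const H"
  unfolding cos_sq_const_def using integrable_one_minus_cos_sq[of H] cos_less_one
  by (intro integral_half_powr_pos) (force simp: zero_less_power2)+

lemma integral_one_minus_cos_sq: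
  assumes H: "0 < H" "H < 1" and "0 < \<delta>"
  shows "has_bochner_integral lborel (\<lambda>\<xi>. (1 - cos (\<delta> * \<xi>))\<^sup>2 * half_powr (2 * H - 3) \<xi>)
           (cos_sq_const H * \<delta> powr (2 - 2 * H))"
proof -
  have "has_bochner_integral lborel (\<lambda>\<xi>. (1 - cos \<xi>)\<^sup>2 * half_powr (2 * H - 3) \<xi>) (cos_sq_const H)"
    unfolding cos_sq_const_def using integrable_one_minus_cos_sq[OF H] by (intro has_bochner_integral_integrable) simp
  from has_bochner_integral_half_powr_scale[OF this, of \<delta>] \<open>0 < \<delta>\<close>
  show ?thesis by (simp add: mult.commute)
qed

section \<open>Tent functions and the lower bound for the covariance form\<close>

definition tent :: "real \<Rightarrow> real" where
  "tent x = max 0 (1 - \<bar>x\<bar>)"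

lemma tent_eq: "tent x = (\<bar>x + 1\<bar> + \<bar>x - 1\<bar>) / 2 - \<bar>x\<bar>"
  by (auto simp: tent_def abs_if max_def field_simps)

lemma tent_bounds: "0 \<le> tent x" "tent x \<le> 1"
  by (auto simp: tent_def)

lemma tent_eq_0: "1 \<le> \<bar>x\<bar> \<Longrightarrow> tent x = 0"
  by (auto simp: tent_def)

text \<open>Fourier inversion for the tent function; the product of cosines reduces it to the case
  \<open>H = 1/2\<close> of the integral of \<open>1 - cos\<close>.\<close>

lemma integral_tent:
  assumes "0 < \<delta>"
  shows "has_bochner_integral lborel (\<lambda>\<xi>. (1 - cos (\<delta> * \<xi>)) * cos (y * \<xi>) * half_powr (- 2) \<xi>)
           (cos_const (1/2) * \<delta> * tent (y / \<delta>))"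
proof -
  have I: "has_bochner_integral lborel (\<lambda>\<xi>. (1 - cos (x * \<xi>)) * half_powr (- 2) \<xi>) (cos_const (1/2) * \<bar>x\<bar>)" for x
    using integral_one_minus_cos[of "1/2" x] by simp
  have "has_bochner_integral lborel (\<lambda>\<xi>. (1/2) * ((1 - cos ((y + \<delta>) * \<xi>)) * half_powr (- 2) \<xi>)
      + (1/2) * ((1 - cos ((y - \<delta>) * \<xi>)) * half_powr (- 2) \<xi>) - (1 - cos (y * \<xi>)) * half_powr (- 2) \<xi>)
      ((1/2) * (cos_const (1/2) * \<bar>y + \<delta>\<bar>) + (1/2) * (cos_const (1/2) * \<bar>y - \<delta>\<bar>) - cos_const (1/2) * \<bar>y\<bar>)"
    by (intro has_bochner_integral_diff has_bochner_integral_add has_bochner_integral_mult_right I)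
  moreover have "(1/2) * ((1 - cos ((y + \<delta>) * \<xi>)) * half_powr (- 2) \<xi>)
      + (1/2) * ((1 - cos ((y - \<delta>) * \<xi>)) * half_powr (- 2) \<xi>) - (1 - cos (y * \<xi>)) * half_powr (- 2) \<xi>
      = (1 - cos (\<delta> * \<xi>)) * cos (y * \<xi>) * half_powr (- 2) \<xi>" for \<xi>
    by (simp add: distrib_right left_diff_distrib cos_add cos_diff algebra_simps)
  moreover have "(1/2) * (cos_const (1/2) * \<bar>y + \<delta>\<bar>) + (1/2) * (cos_const (1/2) * \<bar>y - \<delta>\<bar>) - cos_const (1/2) * \<bar>y\<bar>
      = cos_const (1/2) * \<delta> * tent (y / \<delta>)"
  proof -
    have *: "\<delta> * \<bar>z / \<delta>\<bar> = \<bar>z\<bar>" for z using assms by (simp add: abs_divide)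
    from *[of y] *[of "y + \<delta>"] *[of "y - \<delta>"]
    have dt: "\<delta> * tent (y / \<delta>) = (\<bar>y + \<delta>\<bar> + \<bar>y - \<delta>\<bar>) / 2 - \<bar>y\<bar>"
      using assms by (simp add: tent_eq algebra_simps add_divide_distrib diff_divide_distrib)
    show ?thesis unfolding mult.assoc dt by (simp add: algebra_simps add_divide_distrib)
  qed
  ultimately show ?thesis by simp
qed

definition fbm_cov :: "real \<Rightarrow> real \<Rightarrow> real \<Rightarrow> real" where
  "fbm_cov H s t = (\<bar>s\<bar> powr (2 * H) + \<bar>t\<bar> powr (2 * H) - \<bar>t - s\<bar> powr (2 * H)) / 2"

text \<open>What Cauchy-Schwarz leaves in the next proof: the quotient
  \<open>D\<^sup>2 / (A * C)\<close> there, with the power \<delta>^(2H) split off.\<close>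

definition fbm_const :: "real \<Rightarrow> real" where
  "fbm_const H = (cos_const (1/2))\<^sup>2 / (2 * cos_const H * cos_sq_const H)"

lemma fbm_const_pos: "0 < H \<Longrightarrow> H < 1 \<Longrightarrow> 0 < fbm_const H"
  using cos_const_pos[of "1/2"] cos_const_pos[of H] cos_sq_const_pos[of H] by (simp add: fbm_const_def)

text \<open>Cauchy--Schwarz in the spectral domain: the tents lie in the reproducing kernel Hilbert space.\<close>

lemma fbm_cov_lower_bound:
  fixes c p :: "'i \<Rightarrow> real"
  assumes H: "0 < H" "H < 1" and fin: "finite I" and \<delta>: "0 < \<delta>"
  shows "fbm_const H * \<delta> powr (2 * H) * (\<Sum>i\<in>I. c i * (tent ((p i - t0) / \<delta>) - tent (t0 / \<delta>)))\<^sup>2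
     \<le> (\<Sum>i\<in>I. \<Sum>j\<in>I. c i * c j * fbm_cov H (p i) (p j))"
proof -
  let ?w = "half_powr (- 1 - 2 * H)"
  \<comment> \<open>\<open>U\<close> and \<open>V\<close> are the real and imaginary part of the sum
    of c_i (e^(i p_i \<xi>) - 1). Integrated against the spectral density, the squared modulus gives
    a multiple of the covariance form.\<close>
  define U where "U \<xi> = (\<Sum>i\<in>I. c i * (cos (p i * \<xi>) - 1))" for \<xi>
  define V where "V \<xi> = (\<Sum>i\<in>I. c i * sin (p i * \<xi>))" for \<xi>
  define S where "S = (\<Sum>i\<in>I. \<Sum>j\<in>I. c i * c j * fbm_cov H (p i) (p j))"
  define B where "B = (\<Sum>i\<in>I. c i * (tent ((p i - t0) / \<delta>) - tent (t0 / \<delta>)))"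
  define D where "D = cos_const (1/2) * \<delta>"
  define A where "A = cos_sq_const H * \<delta> powr (2 - 2 * H)"
  define C where "C = 2 * cos_const H"
  have S: "has_bochner_integral lborel (\<lambda>\<xi>. ((U \<xi>)\<^sup>2 + (V \<xi>)\<^sup>2) * ?w \<xi>) (C * S)"
  proof -
    have "has_bochner_integral lborel (\<lambda>\<xi>. \<Sum>i\<in>I. \<Sum>j\<in>I. c i * c j * ((1 - cos (p i * \<xi>)) * ?w \<xi> 
        + (1 - cos (p j * \<xi>)) * ?w \<xi> - (1 - cos ((p j - p i) * \<xi>)) * ?w \<xi>))
       (\<Sum>i\<in>I. \<Sum>j\<in>I. c i * c j * (cos_const H * \<bar>p i\<bar> powr (2 * H) + cos_const H * \<bar>p j\<bar> powr (2 * H)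
          - cos_const H * \<bar>p j - p i\<bar> powr (2 * H)))"
      by (intro has_bochner_integral_sum has_bochner_integral_mult_right has_bochner_integral_diff 
           has_bochner_integral_add integral_one_minus_cos H)
    moreover have "(\<Sum>i\<in>I. \<Sum>j\<in>I. c i * c j * ((1 - cos (p i * \<xi>)) * ?w \<xi> 
        + (1 - cos (p j * \<xi>)) * ?w \<xi> - (1 - cos ((p j - p i) * \<xi>)) * ?w \<xi>)) = ((U \<xi>)\<^sup>2 + (V \<xi>)\<^sup>2) * ?w \<xi>" for \<xi>
    proof -
      have "(U \<xi>)\<^sup>2 + (V \<xi>)\<^sup>2 = (\<Sum>i\<in>I. \<Sum>j\<in>I. c i * c j * ((1 - cos (p i * \<xi>)) 
        + (1 - cos (p j * \<xi>)) - (1 - cos ((p j - p i) * \<xi>))))"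
        unfolding U_def V_def power2_eq_square sum_product sum.distrib[symmetric]
        by (intro sum.cong refl) (simp add: left_diff_distrib cos_diff algebra_simps)
      then show ?thesis
        by (simp only: sum_distrib_right) (intro sum.cong refl, simp add: algebra_simps)
    qed
    moreover have "(\<Sum>i\<in>I. \<Sum>j\<in>I. c i * c j * (cos_const H * \<bar>p i\<bar> powr (2 * H) + cos_const H * \<bar>p j\<bar> powr (2 * H)
          - cos_const H * \<bar>p j - p i\<bar> powr (2 * H))) = C * S"
      unfolding S_def C_def sum_distrib_left fbm_cov_def
      by (intro sum.cong refl) (simp add: algebra_simps)
    ultimately show ?thesis by simp
  qed
  have B: "has_bochner_integral lborel (\<lambda>\<xi>. (U \<xi> * cos (t0 * \<xi>) + V \<xi> * sin (t0 * \<xi>)) * (1 - cos (\<delta> * \<xi>)) * half_powr (- 2) \<xi>) (D * B)"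
  proof -
    have "has_bochner_integral lborel (\<lambda>\<xi>. \<Sum>i\<in>I. c i * ((1 - cos (\<delta> * \<xi>)) * cos ((p i - t0) * \<xi>) * half_powr (- 2) \<xi>
       - (1 - cos (\<delta> * \<xi>)) * cos (t0 * \<xi>) * half_powr (- 2) \<xi>))
       (\<Sum>i\<in>I. c i * (cos_const (1/2) * \<delta> * tent ((p i - t0) / \<delta>) - cos_const (1/2) * \<delta> * tent (t0 / \<delta>)))"
      by (intro has_bochner_integral_sum has_bochner_integral_mult_right has_bochner_integral_diff integral_tent \<delta>)
    moreover have "(\<Sum>i\<in>I. c i * ((1 - cos (\<delta> * \<xi>)) * cos ((p i - t0) * \<xi>) * half_powr (- 2) \<xi>
       - (1 - cos (\<delta> * \<xi>)) * cos (t0 * \<xi>) * half_powr (- 2) \<xi>)) =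
       (U \<xi> * cos (t0 * \<xi>) + V \<xi> * sin (t0 * \<xi>)) * (1 - cos (\<delta> * \<xi>)) * half_powr (- 2) \<xi>" for \<xi>
      unfolding U_def V_def sum.distrib[symmetric] sum_distrib_right
      by (intro sum.cong refl) (simp add: left_diff_distrib cos_diff algebra_simps)
    moreover have "(\<Sum>i\<in>I. c i * (cos_const (1/2) * \<delta> * tent ((p i - t0) / \<delta>) - cos_const (1/2) * \<delta> * tent (t0 / \<delta>))) = D * B"
      unfolding B_def D_def sum_distrib_left by (intro sum.cong refl) (simp add: algebra_simps)
    ultimately show ?thesis by simp
  qed
  have A: "has_bochner_integral lborel (\<lambda>\<xi>. (1 - cos (\<delta> * \<xi>))\<^sup>2 * half_powr (2 * H - 3) \<xi>) A"
    unfolding A_def by (rule integral_one_minus_cos_sq) fact+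
  \<comment> \<open>Cauchy-Schwarz in the form that a quadratic polynomial in \<open>l\<close> is
    non-negative: its integrand is a sum of two squares times the weight.\<close>
  have quad: "0 \<le> C * S - (2 * l) * (D * B) + l\<^sup>2 * A" for l
  proof -
    have "has_bochner_integral lborel (\<lambda>\<xi>. ((U \<xi>)\<^sup>2 + (V \<xi>)\<^sup>2) * ?w \<xi> - 
       (2 * l) * ((U \<xi> * cos (t0 * \<xi>) + V \<xi> * sin (t0 * \<xi>)) * (1 - cos (\<delta> * \<xi>)) * half_powr (- 2) \<xi>)
       + l\<^sup>2 * ((1 - cos (\<delta> * \<xi>))\<^sup>2 * half_powr (2 * H - 3) \<xi>)) (C * S - (2 * l) * (D * B) + l\<^sup>2 * A)"
      by (intro has_bochner_integral_add has_bochner_integral_diff has_bochner_integral_mult_right S A B)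
    moreover have "((U \<xi>)\<^sup>2 + (V \<xi>)\<^sup>2) * ?w \<xi> - 
       (2 * l) * ((U \<xi> * cos (t0 * \<xi>) + V \<xi> * sin (t0 * \<xi>)) * (1 - cos (\<delta> * \<xi>)) * half_powr (- 2) \<xi>)
       + l\<^sup>2 * ((1 - cos (\<delta> * \<xi>))\<^sup>2 * half_powr (2 * H - 3) \<xi>) \<ge> 0" for \<xi>
    proof -
      \<comment> \<open>The power 2H - 1 turns the spectral weight into the weight \<xi>^(-2) of the
        tent integral; applied once more it gives the weight of \<open>cos_sq_const\<close>.\<close>
      define v where "v = l * ((1 - cos (\<delta> * \<xi>)) * half_powr (2 * H - 1) \<xi>)"
      have w1: "half_powr (2 * H - 1) \<xi> * ?w \<xi> = half_powr (- 2) \<xi>"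
        and w2: "half_powr (2 * H - 1) \<xi> * half_powr (- 2) \<xi> = half_powr (2 * H - 3) \<xi>"
        by (simp_all add: half_powr_mult)
      have "0 \<le> ((U \<xi> - v * cos (t0 * \<xi>))\<^sup>2 + (V \<xi> - v * sin (t0 * \<xi>))\<^sup>2) * ?w \<xi>" by simp
      also have "\<dots> = ((U \<xi>)\<^sup>2 + (V \<xi>)\<^sup>2) * ?w \<xi> - 2 * (U \<xi> * cos (t0 * \<xi>) + V \<xi> * sin (t0 * \<xi>)) * (v * ?w \<xi>)
           + v * (v * ?w \<xi>) * ((sin (t0 * \<xi>))\<^sup>2 + (cos (t0 * \<xi>))\<^sup>2)"
        by algebra
      also have "v * ?w \<xi> = l * (1 - cos (\<delta> * \<xi>)) * half_powr (- 2) \<xi>"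
        unfolding v_def w1[symmetric] by (simp add: algebra_simps)
      also have "v * (l * (1 - cos (\<delta> * \<xi>)) * half_powr (- 2) \<xi>) = l\<^sup>2 * ((1 - cos (\<delta> * \<xi>))\<^sup>2 * half_powr (2 * H - 3) \<xi>)"
        unfolding v_def w2[symmetric] by (simp add: power2_eq_square algebra_simps)
      finally show ?thesis by (simp add: algebra_simps)
    qed
    ultimately show ?thesis by (metis (no_types, lifting) Bochner_Integration.integral_nonneg has_bochner_integral_integral_eq)
  qed
  have pos: "0 < A" "0 < C" "0 < D" using cos_const_pos[of "1/2"] cos_const_pos[OF H] cos_sq_const_pos[OF H] \<delta>
    by (auto simp: A_def C_def D_def)
  \<comment> \<open>The quadratic polynomial is smallest at \<open>l = D * B / A\<close>.\<close>
  have "(D * B)\<^sup>2 / A \<le> C * S"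
    using quad[of "D * B / A"] pos by (simp add: power2_eq_square field_simps)
  then have "(D * B)\<^sup>2 / (A * C) \<le> S" using pos by (simp add: field_simps)
  moreover have "(D * B)\<^sup>2 / (A * C) = fbm_const H * \<delta> powr (2 * H) * B\<^sup>2"
    using pos \<delta> unfolding fbm_const_def A_def C_def D_def
    by (simp add: power_mult_distrib powr_diff powr_numeral field_simps)
  ultimately show ?thesis by (simp add: S_def B_def)
qed

section \<open>A Cantor set of times with isolated returns\<close>

lemma frac_mult_frac: "frac (real k * frac x) = frac (real k * x)"
proof -
  have "real k * x = real k * frac x + of_int (int k * \<lfloor>x\<rfloor>)"
    by (simp add: frac_def algebra_simps)
  then show ?thesis by (metis frac_add_of_int_right)
qed

text \<open>In base \<open>b\<close> the number \<open>D y\<close> consists of \<open>k\<close>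
  blocks of \<open>m\<close> digits, each with lowest digit 1 and \<open>m - 1\<close> free digits;
  this explains the count. Of the lowest \<open>j\<close> digits, the top \<open>m\<close> (or all,
  if j < m) contain one of these ones, hence \<open>D y mod b ^ j\<close> is at least
  b^(j-m).\<close>

lemma exists_digits:
  fixes b m :: nat
  assumes b: "2 \<le> b" and m: "1 \<le> m"
  shows "\<exists>D. inj_on D {..<(b ^ (m - 1)) ^ k} \<and> (\<forall>y<(b ^ (m - 1)) ^ k. D y < b ^ (m * k) \<and>
     (\<forall>j. 1 \<le> j \<and> j \<le> m * k \<longrightarrow> b ^ j \<le> b ^ m * (D y mod b ^ j)))"
proof (induction k)
  case 0
  show ?case by (intro exI[of _ "\<lambda>_. 0"]) (auto simp: inj_on_def)
next
  case (Suc k)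
  define q where "q = (b ^ (m - 1)) ^ k"
  define l where "l = m * k"
  obtain D where inj: "inj_on D {..<q}" and D: "\<And>y. y < q \<Longrightarrow> D y < b ^ l"
    and Dm: "\<And>y j. y < q \<Longrightarrow> 1 \<le> j \<Longrightarrow> j \<le> l \<Longrightarrow> b ^ j \<le> b ^ m * (D y mod b ^ j)"
    using Suc unfolding q_def[symmetric] l_def[symmetric] by blast
  have q0: "0 < q" using b by (simp add: q_def)
  \<comment> \<open>The new block goes on top: \<open>y mod q\<close> selects the old blocks and
    \<open>y div q\<close> the free digits of the new one.\<close>
  define E where "E y = D (y mod q) + (1 + b * (y div q)) * b ^ l" for y
  have EDiv: "E y div b ^ l = 1 + b * (y div q)" "E y mod b ^ l = D (y mod q)" for y
  proof -
    have "D (y mod q) < b ^ l" "b ^ l \<noteq> 0" using D[of "y mod q"] q0 b by auto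
    then show "E y div b ^ l = 1 + b * (y div q)" "E y mod b ^ l = D (y mod q)"
      unfolding E_def div_mult_self1[OF \<open>b ^ l \<noteq> 0\<close>] mod_mult_self1 by auto
  qed
  have "inj_on E {..<q * b ^ (m - 1)}"
  proof (rule inj_onI)
    fix x y assume "E x = E y"
    then have "1 + b * (x div q) = 1 + b * (y div q)" "D (x mod q) = D (y mod q)" using EDiv by metis+
    then have "x div q = y div q" "x mod q = y mod q" using b q0 inj by (auto simp: inj_on_def)
    then show "x = y" by (metis div_mult_mod_eq)
  qed
  moreover have "E y < b ^ (m + l)" "b ^ j \<le> b ^ m * (E y mod b ^ j)"
    if y: "y < q * b ^ (m - 1)" and j: "1 \<le> j" "j \<le> m + l" for y j
  proof -
    have yq: "y div q < b ^ (m - 1)" using y q0 by (simp add: less_mult_imp_div_less mult.commute)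
    then have "b * (y div q + 1) \<le> b * b ^ (m - 1)" by (intro mult_left_mono) auto
    also have "\<dots> = b ^ m" using m by (simp add: power_eq_if)
    finally have e: "1 + b * (y div q) < b ^ m" using b by simp
    have "E y < (2 + b * (y div q)) * b ^ l" using D[of "y mod q"] q0 by (simp add: E_def)
    also have "\<dots> \<le> b ^ m * b ^ l" using e by (intro mult_right_mono) auto
    finally show "E y < b ^ (m + l)" by (simp add: power_add)
    show "b ^ j \<le> b ^ m * (E y mod b ^ j)"
    proof (cases "j \<le> l")
      case True
      then have "b ^ j dvd b ^ l" by (simp add: le_imp_power_dvd)
      then have "E y mod b ^ j = D (y mod q) mod b ^ j"
        using EDiv(2)[of y] by (metis mod_mod_cancel)
      then show ?thesis using Dm[of "y mod q" j] True j q0 by simp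
    next
      case False
      then obtain i where i: "j = l + i" "1 \<le> i" 
        by (intro that[of "j - l"]) auto
      have "(E y mod b ^ j) div b ^ l = (1 + b * (y div q)) mod b ^ i"
        using EDiv(1)[of y] i b by (simp add: power_add mod_mult2_eq del: mult_Suc_right)
      also have "\<dots> \<ge> 1"
      proof -
        have "b dvd b ^ i" using i by (simp add: dvd_power)
        then have "(1 + b * (y div q)) mod b ^ i mod b = 1"
          using b by (subst mod_mod_cancel) (auto simp: mod_Suc)
        then show ?thesis by (cases "(1 + b * (y div q)) mod b ^ i") auto
      qed
      finally have "1 \<le> (E y mod b ^ j) div b ^ l" .
      then have "b ^ l \<le> E y mod b ^ j" using b by (simp add: div_greater_zero_iff Suc_le_eq)
      then have "b ^ m * b ^ l \<le> b ^ m * (E y mod b ^ j)" by simp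
      moreover have "b ^ j \<le> b ^ m * b ^ l" using j b by (simp flip: power_add)
      ultimately show ?thesis by linarith
    qed
  qed
  ultimately show ?case
    unfolding power_Suc mult.commute[of "b ^ (m - 1)"] q_def[symmetric] mult_Suc_right l_def[symmetric]
    using m by (intro exI[of _ E] conjI allI impI) auto
qed

text \<open>The numbers \<open>D y\<close> are words of length \<open>L\<close> in base
  \<open>b\<close>. \<open>D_less\<close> lets a word begin with \<open>m\<close> zeros, so a time
  starting with it lies below b^(-m); by \<open>D_mod\<close> this fails when reading starts
  strictly inside a word. \<open>D_pos\<close> keeps the tents placed at a word away from 0.\<close>

locale digit_system =
  fixes b m L Q :: nat and D :: "nat \<Rightarrow> nat"
  assumes b: "2 \<le> b" and m: "2 \<le> m" and mL: "m < L" and Q: "2 \<le> Q"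
    and D_inj: "inj_on D {..<Q}" and D_pos: "\<And>y. y < Q \<Longrightarrow> 1 \<le> D y"
    and D_less: "\<And>y. y < Q \<Longrightarrow> D y < b ^ (L - m)"
    and D_mod: "\<And>y j. y < Q \<Longrightarrow> 0 < j \<Longrightarrow> j < L \<Longrightarrow> b ^ j \<le> b ^ m * (D y mod b ^ j)"

lemma exists_digit_system:
  assumes b: "2 \<le> b" and m: "2 \<le> m"
  shows "\<exists>D. digit_system b m (m * m + m + 1) (b ^ ((m - 1) * m)) D"
proof -
  obtain D where inj: "inj_on D {..<(b ^ (m - 1)) ^ m}" 
    and D: "\<And>y. y < (b ^ (m - 1)) ^ m \<Longrightarrow> D y < b ^ (m * m)"
    and Dm: "\<And>y j. y < (b ^ (m - 1)) ^ m \<Longrightarrow> 1 \<le> j \<Longrightarrow> j \<le> m * m \<Longrightarrow> b ^ j \<le> b ^ m * (D y mod b ^ j)"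
    using exists_digits[of b m m] assms by auto
  \<comment> \<open>A word is made of \<open>m\<close> zeros, a 1, and \<open>m\<close> blocks of
    length \<open>m\<close>; hence its length \<open>m * m + m + 1\<close>. The 1 provides the lower
    bound when reading starts among the leading zeros.\<close>
  define E where "E y = b ^ (m * m) + D y" for y
  have "digit_system b m (m * m + m + 1) (b ^ ((m - 1) * m)) E"
  proof
    show "2 \<le> b ^ ((m - 1) * m)" using b m power_increasing[of 1 "(m - 1) * m" b] by (simp add: Suc_le_eq)
    show "inj_on E {..<b ^ ((m - 1) * m)}" using inj by (simp add: inj_on_def E_def power_mult)
    fix y assume y: "y < b ^ ((m - 1) * m)"
    then have y': "y < (b ^ (m - 1)) ^ m" by (simp add: power_mult)
    show "1 \<le> E y" using b by (simp add: E_def Suc_le_eq)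
    have E2: "E y < 2 * b ^ (m * m)" using D[OF y'] by (simp add: E_def)
    also have "\<dots> \<le> b ^ (m * m + 1)" using b by simp
    finally have Eb: "E y < b ^ (m * m + 1)" .
    then show "E y < b ^ (m * m + m + 1 - m)" by simp
    fix j assume j: "0 < j" "j < m * m + m + 1"
    show "b ^ j \<le> b ^ m * (E y mod b ^ j)"
    proof (cases "j \<le> m * m")
      case True
      then have "b ^ j dvd b ^ (m * m)" by (simp add: le_imp_power_dvd)
      then have "E y mod b ^ j = D y mod b ^ j" by (auto simp: E_def dvd_def)
      then show ?thesis using Dm[OF y'] True j by simp
    next
      case False
      then have "b ^ (m * m + 1) \<le> b ^ j" using b by (intro power_increasing) auto
      then have "E y mod b ^ j = E y" using Eb by simp
      moreover have "b ^ j \<le> b ^ (m + m * m)" using j b by (intro power_increasing) auto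
      moreover have "b ^ (m + m * m) \<le> b ^ m * E y" unfolding power_add by (intro mult_left_mono) (simp_all add: E_def)
      ultimately show ?thesis by simp
    qed
  qed (use b m in auto)
  then show ?thesis by blast
qed

section \<open>The coding map from base-Q digits to the Cantor set\<close>

context digit_system
begin

definition "B = real b ^ L"
definition "\<theta> = 1 / real b ^ m"
definition dig :: "real \<Rightarrow> nat" where "dig x = nat \<lfloor>real Q * x\<rfloor>"
definition shift :: "real \<Rightarrow> real" where "shift x = frac (real Q * x)"
text \<open>The base-Q digits of \<open>x\<close> are translated into words, which are read as
  digits in base \<open>B\<close>. The uniform distribution on [0,1) becomes a Cantor measure of
  dimension \<open>log Q / log B\<close>.\<close>

definition T :: "real \<Rightarrow> real" where "T x = (\<Sum>i. real (D (dig ((shift ^^ i) x))) / B ^ (i + 1))"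

lemma B_ge: "4 < B" and B_pos: "0 < B"
proof -
  have "(2::real) ^ 3 \<le> 2 ^ L" using m mL by (intro power_increasing) auto
  also have "\<dots> \<le> B" unfolding B_def using b by (intro power_mono) auto
  finally show "4 < B" "0 < B" by auto
qed

lemma \<theta>: "0 < \<theta>" "\<theta> \<le> 1/4" "B * \<theta> = real (b ^ (L - m))"
proof -
  have "(2::real) ^ 2 \<le> 2 ^ m" using m by (intro power_increasing) auto
  also have "\<dots> \<le> real b ^ m" using b by (intro power_mono) auto
  finally have "4 \<le> real b ^ m" by simp
  then show "\<theta> \<le> 1/4" unfolding \<theta>_def using b by (intro divide_left_mono[of 4 "real b ^ m" 1]) auto
  show "0 < \<theta>" using b by (simp add: \<theta>_def)
  show "B * \<theta> = real (b ^ (L - m))" using b mL by (simp add: \<theta>_def B_def power_diff flip: of_nat_power)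
       (metis less_imp_le power_diff real_of_nat_div le_imp_power_dvd not_numeral_le_zero of_nat_power)
qed

lemma shift_range: "0 \<le> shift x" "shift x < 1"
  by (simp_all add: shift_def frac_lt_1)

lemma shift_pow_range: "x \<in> {0..<1} \<Longrightarrow> (shift ^^ i) x \<in> {0..<1}"
  by (cases i) (auto simp: shift_range)

lemma dig_less: "x \<in> {0..<1} \<Longrightarrow> dig x < Q"
proof -
  assume x: "x \<in> {0..<1}"
  then have "real Q * x < real Q" using Q by simp
  then have "\<lfloor>real Q * x\<rfloor> < int Q" by linarith
  then show ?thesis using Q by (simp add: dig_def)
qed

lemma x_eq: "x \<in> {0..<1} \<Longrightarrow> x = (real (dig x) + shift x) / Q"
  using Q by (simp add: dig_def shift_def frac_def of_nat_nat field_simps)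

lemma D_dig: "x \<in> {0..<1} \<Longrightarrow> 1 \<le> real (D (dig x)) \<and> real (D (dig x)) + 1 \<le> B * \<theta>"
proof -
  assume x: "x \<in> {0..<1}"
  have "D (dig x) + 1 \<le> b ^ (L - m)" "1 \<le> D (dig x)"
    using D_less[OF dig_less[OF x]] D_pos[OF dig_less[OF x]] by auto
  then have "real (D (dig x) + 1) \<le> real (b ^ (L - m))" "real 1 \<le> real (D (dig x))"
    by (simp_all only: of_nat_le_iff)
  then show ?thesis unfolding \<theta>(3) by simp
qed

lemma T_sums:
  assumes x: "x \<in> {0..<1}"
  shows "(\<lambda>i. real (D (dig ((shift ^^ i) x))) / B ^ (i + 1)) sums T x" and "0 \<le> T x" and "T x \<le> 1/4"
proof -
  let ?f = "\<lambda>i. real (D (dig ((shift ^^ i) x))) / B ^ (i + 1)"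
  let ?g = "\<lambda>i. (B * \<theta> - 1) * (1 / B) * (1 / B) ^ i"
  have le: "?f i \<le> ?g i" for i
  proof -
    have "real (D (dig ((shift ^^ i) x))) \<le> B * \<theta> - 1" using D_dig[OF shift_pow_range[OF x], of i] by simp
    then have "?f i \<le> (B * \<theta> - 1) / B ^ (i + 1)" using B_pos by (intro divide_right_mono) auto
    then show ?thesis by (simp add: power_one_over)
  qed
  have nn: "0 \<le> ?f i" for i using B_pos by simp
  have g: "?g sums ((B * \<theta> - 1) * (1 / B) * (1 / (1 - 1 / B)))"
    using B_ge by (rule_tac sums_mult, rule_tac geometric_sums) simp
  then have "summable ?g" by (simp add: sums_iff)
  then have sf: "summable ?f" 
    by (rule summable_comparison_test'[where N = 0]) (use le nn B_pos in \<open>simp add: abs_of_pos\<close>)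
  then show "?f sums T x" unfolding T_def by (rule summable_sums)
  show "0 \<le> T x" unfolding T_def using sf nn by (intro suminf_nonneg)
  have "T x \<le> (B * \<theta> - 1) * (1 / B) * (1 / (1 - 1 / B))"
    unfolding T_def by (rule sums_le[OF le summable_sums[OF sf] g])
  also have "\<dots> = (B * \<theta> - 1) * ((1 / B) * (1 / (1 - 1 / B)))" by (simp only: mult.assoc)
  also have "(1 / B) * (1 / (1 - 1 / B)) = 1 / (B - 1)" using B_ge by (simp add: right_diff_distrib)
  also have "(B * \<theta> - 1) * (1 / (B - 1)) = (B * \<theta> - 1) / (B - 1)" by simp
  also have "\<dots> \<le> 1/4"
  proof -
    have "B * \<theta> \<le> B / 4" using mult_left_mono[of \<theta> "1/4" B] \<theta> B_pos by simp
    then have "B * \<theta> - 1 \<le> 1/4 * (B - 1)" using B_ge unfolding right_diff_distrib by linarith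
    then show ?thesis using B_ge by (subst pos_divide_le_eq) auto
  qed
  finally show "T x \<le> 1/4" .
qed

lemma T_rec: 
  assumes x: "x \<in> {0..<1}"
  shows "T x = (real (D (dig x)) + T (shift x)) / B"
proof -
  have "(\<lambda>i. real (D (dig ((shift ^^ (Suc i)) x))) / B ^ (Suc i + 1)) sums (T x - real (D (dig x)) / B)"
    using T_sums(1)[OF x] by (subst sums_Suc_iff) simp
  moreover have "real (D (dig ((shift ^^ (Suc i)) x))) / B ^ (Suc i + 1)
      = (1 / B) * (real (D (dig ((shift ^^ i) (shift x)))) / B ^ (i + 1))" for i
    by (simp add: funpow_Suc_right del: funpow.simps)
  ultimately have "(\<lambda>i. (1 / B) * (real (D (dig ((shift ^^ i) (shift x)))) / B ^ (i + 1))) sums (T x - real (D (dig x)) / B)"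
    by (simp only:)
  moreover have "(\<lambda>i. (1 / B) * (real (D (dig ((shift ^^ i) (shift x)))) / B ^ (i + 1))) sums ((1 / B) * T (shift x))"
    using shift_range[of x] by (intro sums_mult T_sums(1)) simp
  ultimately have "T x - real (D (dig x)) / B = (1 / B) * T (shift x)"
    by (rule sums_unique2)
  then show ?thesis by (simp add: add_divide_distrib)
qed

lemma T_bounds:
  assumes x: "x \<in> {0..<1}"
  shows "real (D (dig x)) / B \<le> T x" "T x \<le> (real (D (dig x)) + 1/4) / B"
  using T_rec[OF x] T_sums(2,3)[of "shift x"] shift_range[of x] B_pos by (auto intro!: divide_right_mono)

text \<open>Multiplied by \<open>B\<close>, the two values are distinct integers plus tails in
  [0, 1/4], so at least 3/4 of the gap remains.\<close>

lemma T_separated: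
  assumes "x \<in> {0..<1}" "y \<in> {0..<1}" "dig x \<noteq> dig y"
  shows "3 / 4 / B \<le> \<bar>T x - T y\<bar>"
proof -
  have "D (dig x) \<noteq> D (dig y)" using D_inj dig_less assms by (auto simp: inj_on_def)
  then have "1 \<le> \<bar>real (D (dig x)) - real (D (dig y))\<bar>" by linarith
  moreover have "T x * B = real (D (dig x)) + T (shift x)" "T y * B = real (D (dig y)) + T (shift y)"
    using T_rec[OF assms(1)] T_rec[OF assms(2)] B_pos by simp_all
  moreover have "0 \<le> T (shift x)" "T (shift x) \<le> 1/4" "0 \<le> T (shift y)" "T (shift y) \<le> 1/4"
    using T_sums(2,3)[of "shift x"] T_sums(2,3)[of "shift y"] shift_range by auto
  ultimately have "3/4 \<le> \<bar>T x * B - T y * B\<bar>" by linarith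
  also have "\<dots> = \<bar>T x - T y\<bar> * B" using B_pos by (simp add: left_diff_distrib[symmetric] abs_mult)
  finally show ?thesis using B_pos by (simp add: field_simps)
qed

text \<open>One word takes up \<open>L\<close> places, so multiplication by b^(Li) modulo 1 drops
  the first \<open>i\<close> words.\<close>

lemma frac_B_T: "x \<in> {0..<1} \<Longrightarrow> frac (real b ^ (L * i) * T x) = T ((shift ^^ i) x)"
proof (induction i arbitrary: x)
  case 0
  then show ?case using T_sums(2,3)[of x] by (simp add: frac_eq)
next
  case (Suc i)
  have "real b ^ (L * Suc i) * T x = real b ^ (L * i) * (B * T x)" by (simp add: B_def power_add)
  also have "B * T x = real (D (dig x)) + T (shift x)" using T_rec[OF Suc.prems] B_pos by simp
  also have "real b ^ (L * i) * (real (D (dig x)) + T (shift x)) 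
      = real b ^ (L * i) * T (shift x) + of_int (int (b ^ (L * i) * D (dig x)))" by (simp add: algebra_simps)
  finally have "frac (real b ^ (L * Suc i) * T x) = frac (real b ^ (L * i) * T (shift x))"
    by (metis frac_add_of_int_right)
  also have "\<dots> = T ((shift ^^ i) (shift x))" using shift_range[of x] by (intro Suc.IH) auto
  finally show ?case by (simp add: funpow_swap1)
qed

text \<open>After \<open>r\<close> places, \<open>j = L - r\<close> digits of the current word are
  left. The fractional part starts with \<open>D (dig x) mod b ^ j\<close> over b^j, which
  \<open>D_mod\<close> bounds below by b^(-m) = \<theta>.\<close>

lemma frac_offset_ge:
  assumes x: "x \<in> {0..<1}" and r: "0 < r" "r < L"
  shows "\<theta> \<le> frac (real b ^ r * T x)"
proof -
  define j where "j = L - r"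
  have j: "0 < j" "j < L" "L = r + j" using r by (auto simp: j_def)
  let ?d = "D (dig x)" and ?t = "T (shift x)"
  have t: "0 \<le> ?t" "?t \<le> 1/4" using T_sums(2,3)[of "shift x"] shift_range[of x] by auto
  have bj: "0 < real (b ^ j)" using b by simp
  have "real b ^ r * T x = (real ?d + ?t) / real (b ^ j)"
  proof -
    have "B = real b ^ r * real (b ^ j)" unfolding B_def by (subst j(3)) (simp add: power_add)
    then show ?thesis using T_rec[OF x] b by simp
  qed
  also have "real ?d = real (?d div b ^ j) * real (b ^ j) + real (?d mod b ^ j)"
    by (metis div_mult_mod_eq of_nat_add of_nat_mult)
  also have "(real (?d div b ^ j) * real (b ^ j) + real (?d mod b ^ j) + ?t) / real (b ^ j)
      = (real (?d mod b ^ j) + ?t) / real (b ^ j) + of_int (int (?d div b ^ j))"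
    using bj by (simp add: add_divide_distrib)
  finally have e: "real b ^ r * T x = (real (?d mod b ^ j) + ?t) / real (b ^ j) + of_int (int (?d div b ^ j))" .
  have "?d mod b ^ j < b ^ j" using b by simp
  then have "real (?d mod b ^ j) + 1 \<le> real (b ^ j)" by linarith
  then have "(real (?d mod b ^ j) + ?t) / real (b ^ j) < 1" using t bj by (subst divide_less_eq_1_pos) auto
  moreover have "0 \<le> (real (?d mod b ^ j) + ?t) / real (b ^ j)" using t bj by (intro divide_nonneg_pos) auto
  ultimately have f: "frac (real b ^ r * T x) = (real (?d mod b ^ j) + ?t) / real (b ^ j)"
    unfolding e frac_add_of_int_right by (simp add: frac_eq)
  have "real (b ^ j) \<le> real (b ^ m * (?d mod b ^ j))" using D_mod[OF dig_less[OF x], of j] j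
    by (simp only: of_nat_le_iff)
  then have "real (b ^ j) \<le> real b ^ m * (real (?d mod b ^ j) + ?t)"
    using t by (simp add: distrib_left add_increasing2)
  then show ?thesis unfolding f \<theta>_def using b bj by (simp add: field_simps)
qed

text \<open>Strictly inside a word the orbit stays at or above \<theta>, where \<open>f\<close> is
  0; each group of \<open>L\<close> terms keeps only its first.\<close>

lemma orbit_sum:
  assumes x: "x \<in> {0..<1}" and f: "\<And>u. \<theta> \<le> u \<Longrightarrow> f u = (0::real)"
  shows "(\<Sum>n<L * N. \<alpha> ^ n * f (frac (real b ^ n * T x))) = (\<Sum>i<N. \<alpha> ^ (L * i) * f (T ((shift ^^ i) x)))"
proof -
  have "(\<Sum>n<L * N. \<alpha> ^ n * f (frac (real b ^ n * T x))) 
     = (\<Sum>i<N. \<Sum>n\<in>{i * L..<i * L + L}. \<alpha> ^ n * f (frac (real b ^ n * T x)))"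
    by (simp only: sum.nat_group mult.commute[of L N])
  also have "\<dots> = (\<Sum>i<N. \<alpha> ^ (L * i) * f (T ((shift ^^ i) x)))"
  proof (rule sum.cong[OF refl])
    fix i
    let ?g = "\<lambda>n. \<alpha> ^ n * f (frac (real b ^ n * T x))"
    have "?g n = 0" if n: "n \<in> {i * L..<i * L + L} - {i * L}" for n
    proof -
      obtain r where r: "n = i * L + r" "0 < r" "r < L" using n by (intro that[of "n - i * L"]) auto
      have "frac (real b ^ n * T x) = frac (real (b ^ r) * (real b ^ (L * i) * T x))"
        by (simp add: r power_add mult_ac)
      also have "\<dots> = frac (real (b ^ r) * T ((shift ^^ i) x))"
        unfolding frac_B_T[OF x, symmetric] by (rule frac_mult_frac[symmetric])
      also have "\<dots> \<ge> \<theta>" using frac_offset_ge[OF shift_pow_range[OF x] r(2,3)] by simp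
      finally show ?thesis using f by simp
    qed
    then have "sum ?g {i * L..<i * L + L} = sum ?g {i * L}"
      using mL by (intro sum.mono_neutral_right) auto
    then show "sum ?g {i * L..<i * L + L} = \<alpha> ^ (L * i) * f (T ((shift ^^ i) x))"
      using frac_B_T[OF x, of i] by (simp add: mult.commute)
  qed
  finally show ?thesis .
qed

definition agree :: "nat \<Rightarrow> real \<Rightarrow> real \<Rightarrow> bool" where
  "agree q x y \<longleftrightarrow> (\<forall>i<q. dig ((shift ^^ i) x) = dig ((shift ^^ i) y))"

definition split_at :: "nat \<Rightarrow> real \<Rightarrow> real \<Rightarrow> bool" where
  "split_at q x y \<longleftrightarrow> agree q x y \<and> dig ((shift ^^ q) x) \<noteq> dig ((shift ^^ q) y)"

lemma agree_imp:
  assumes "x \<in> {0..<1}" "y \<in> {0..<1}" "agree q x y"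
  shows "x - y = ((shift ^^ q) x - (shift ^^ q) y) / real Q ^ q \<and> T x - T y = (T ((shift ^^ q) x) - T ((shift ^^ q) y)) / B ^ q"
  using assms(3)
proof (induction q)
  case (Suc q)
  let ?x = "(shift ^^ q) x" and ?y = "(shift ^^ q) y"
  have xy: "?x \<in> {0..<1}" "?y \<in> {0..<1}" "dig ?x = dig ?y" using Suc.prems shift_pow_range assms by (auto simp: agree_def)
  have "?x - ?y = (shift ?x - shift ?y) / Q"
    using x_eq[OF xy(1)] x_eq[OF xy(2)] xy(3) by (simp add: diff_divide_distrib add_divide_distrib)
  moreover have "T ?x - T ?y = (T (shift ?x) - T (shift ?y)) / B"
    using T_rec[OF xy(1)] T_rec[OF xy(2)] xy(3) by (simp add: diff_divide_distrib add_divide_distrib)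
  moreover have "x - y = (?x - ?y) / real Q ^ q" "T x - T y = (T ?x - T ?y) / B ^ q"
    using Suc by (auto simp: agree_def)
  ultimately have "x - y = (shift ?x - shift ?y) / Q / real Q ^ q" "T x - T y = (T (shift ?x) - T (shift ?y)) / B / B ^ q"
    by (simp_all only:)
  then show ?case by simp
qed simp

lemma agree_dist:
  assumes "x \<in> {0..<1}" "y \<in> {0..<1}" "agree q x y"
  shows "\<bar>x - y\<bar> \<le> 1 / real Q ^ q"
proof -
  have "\<bar>(shift ^^ q) x - (shift ^^ q) y\<bar> \<le> 1"
    using shift_pow_range[OF assms(1), of q] shift_pow_range[OF assms(2), of q] by auto
  then show ?thesis using agree_imp[OF assms] Q by (simp add: abs_mult divide_right_mono)
qed

lemma exists_split_at:
  assumes "x \<in> {0..<1}" "y \<in> {0..<1}" "x \<noteq> y"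
  shows "\<exists>q. split_at q x y"
proof (rule ccontr)
  assume *: "\<nexists>q. split_at q x y"
  have "agree q x y" for q
  proof (induction q)
    case (Suc q)
    then have "dig ((shift ^^ q) x) = dig ((shift ^^ q) y)" using * unfolding split_at_def by blast
    then show ?case using Suc by (simp add: agree_def less_Suc_eq)
  qed (simp add: agree_def)
  then have "\<bar>x - y\<bar> \<le> (1 / real Q) ^ q" for q using agree_dist[OF assms(1,2)] by (simp add: power_one_over)
  moreover have "(\<lambda>q. (1 / real Q) ^ q) \<longlonglongrightarrow> 0" using Q by (intro LIMSEQ_power_zero) auto
  ultimately have "\<bar>x - y\<bar> \<le> 0" by (intro LIMSEQ_le_const) auto
  then show False using assms by simp
qed

lemma split_at_dist:
  assumes "x \<in> {0..<1}" "y \<in> {0..<1}" "split_at q x y"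
  shows "1 / (2 * B ^ (q + 1)) \<le> \<bar>T x - T y\<bar>"
proof -
  have "3 / 4 / B \<le> \<bar>T ((shift ^^ q) x) - T ((shift ^^ q) y)\<bar>"
    using assms shift_pow_range by (intro T_separated) (auto simp: split_at_def)
  then have "3 / 4 / B / B ^ q \<le> \<bar>T x - T y\<bar>"
  proof -
    have "T x - T y = (T ((shift ^^ q) x) - T ((shift ^^ q) y)) / B ^ q"
      using agree_imp[OF assms(1,2), of q] assms(3) by (simp add: split_at_def)
    then have "\<bar>T x - T y\<bar> = \<bar>T ((shift ^^ q) x) - T ((shift ^^ q) y)\<bar> / B ^ q" using B_pos by simp
    then show ?thesis using \<open>3 / 4 / B \<le> _\<close> B_pos by (simp only:) (intro divide_right_mono, auto)
  qed
  moreover have "1 / (2 * B ^ (q + 1)) \<le> 3 / 4 / B / B ^ q" using B_pos by (simp add: field_simps)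
  ultimately show ?thesis by linarith
qed

text \<open>For a ratio of at most 1/3, all terms after the q-th together are at most half of it in
  modulus.\<close>

lemma tail_bound:
  assumes \<alpha>: "0 < \<alpha>" "\<alpha> ^ L \<le> 1/3" and qN: "q < N"
    and zero: "\<And>i. i < q \<Longrightarrow> e i = 0" and one: "e q = (1::real)" and le: "\<And>i. \<bar>e i\<bar> \<le> 1"
  shows "\<alpha> ^ (L * q) / 2 \<le> (\<Sum>i<N. \<alpha> ^ (L * i) * e i)"
proof -
  define r where "r = \<alpha> ^ L"
  have r: "0 < r" "r \<le> 1/3" using \<alpha> by (auto simp: r_def)
  \<comment> \<open>The surplus \<open>3/2 * r ^ N\<close> closes the induction: it dominates r^N /
    (1 - r), the largest possible sum of the terms still to come.\<close>
  have "r ^ q / 2 + 3/2 * r ^ N \<le> (\<Sum>i<N. r ^ i * e i)"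
    using Suc_leI[OF qN]
  proof (induction N rule: dec_induct)
    case base
    have "r ^ q * r \<le> r ^ q * (1/3)" using r by (intro mult_left_mono) auto
    have "(\<Sum>i<Suc q. r ^ i * e i) = r ^ q" using zero one by simp
    then show ?case using \<open>r ^ q * r \<le> _\<close> by (simp add: mult.commute)
  next
    case (step n)
    have "r ^ n * r \<le> r ^ n * (1/3)" using r by (intro mult_left_mono) auto
    moreover have "r ^ n * (- 1) \<le> r ^ n * e n" using r le[of n] by (intro mult_left_mono) auto
    ultimately show ?case using step.IH by (simp add: mult.commute)
  qed
  moreover have "0 < r ^ N" using r by simp
  ultimately have "r ^ q / 2 \<le> (\<Sum>i<N. r ^ i * e i)" by linarith
  then show ?thesis by (simp add: r_def power_mult)
qed

end

section \<open>Test functions that detect the first differing word\<close>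

context digit_system
begin

definition orbit_series :: "real \<Rightarrow> (real \<Rightarrow> real) \<Rightarrow> nat \<Rightarrow> real \<Rightarrow> real" where
  "orbit_series \<alpha> f N x = (\<Sum>n<L * N. \<alpha> ^ n * f (frac (real b ^ n * T x)))"

text \<open>The tent is 1 at \<open>T x\<close> and, because its half-width is the separation of
  \<open>split_at_dist\<close>, 0 at \<open>T y\<close>. So the term n = 0 contributes 1, of which
  later terms cancel at most 1/2. The first two claims put the support between 0 and
  \<theta>.\<close>

lemma small_bump:
  assumes xy: "x \<in> {0..<1}" "y \<in> {0..<1}" "split_at q x y" and \<alpha>: "0 < \<alpha>" "\<alpha> ^ L \<le> 1/3" and N: "0 < N"
  defines "\<delta> \<equiv> 1 / (2 * B ^ (q + 1))"
  defines "f \<equiv> \<lambda>u. tent ((u - T x) / \<delta>)"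
  shows "\<And>u. \<theta> \<le> u \<Longrightarrow> f u = 0" "tent (T x / \<delta>) = 0" 
    "1 / 2 \<le> orbit_series \<alpha> f N x - orbit_series \<alpha> f N y"
proof -
  have \<delta>: "0 < \<delta>" using B_pos by (simp add: \<delta>_def)
  have \<delta>B: "\<delta> * B \<le> 1 / 2"
  proof -
    have "1 \<le> B ^ q" using B_ge by (intro one_le_power) simp
    then show ?thesis using B_pos by (simp add: \<delta>_def field_simps)
  qed
  show f0: "f u = 0" if "\<theta> \<le> u" for u
  proof -
    have "B * T x \<le> real (D (dig x)) + 1/4" using T_bounds(2)[OF xy(1)] B_pos by (simp add: field_simps)
    moreover have "real (D (dig x)) + 1 \<le> B * \<theta>" using D_dig[OF xy(1)] by simp
    moreover have "B * \<theta> \<le> B * u" using that B_pos by simp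
    ultimately have "\<delta> * B \<le> B * u - B * T x" using \<delta>B by linarith
    then have "B * \<delta> \<le> B * (u - T x)" by (simp add: right_diff_distrib mult.commute)
    then have "\<delta> \<le> u - T x" using B_pos by simp
    then show ?thesis using \<delta> unfolding f_def by (intro tent_eq_0) (auto simp: le_divide_eq)
  qed
  show "tent (T x / \<delta>) = 0"
  proof -
    have "1 \<le> B * T x" using T_bounds(1)[OF xy(1)] D_dig[OF xy(1)] B_pos by (simp add: field_simps)
    then have "B * \<delta> \<le> B * T x" using \<delta>B by (simp add: mult.commute)
    then have "\<delta> \<le> T x" using B_pos by simp
    then show ?thesis using \<delta> by (intro tent_eq_0) (auto simp: le_divide_eq)
  qed
  define e where "e i = f (T ((shift ^^ i) x)) - f (T ((shift ^^ i) y))" for i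
  have "f (T y) = 0"
    using split_at_dist[OF xy] \<delta> unfolding f_def \<delta>_def[symmetric] by (intro tent_eq_0) (auto simp: le_divide_eq abs_minus_commute)
  then have e0: "e 0 = 1" by (simp add: e_def) (simp add: f_def tent_def)
  have "orbit_series \<alpha> f N z = (\<Sum>i<N. \<alpha> ^ (L * i) * f (T ((shift ^^ i) z)))" if "z \<in> {0..<1}" for z
    unfolding orbit_series_def by (rule orbit_sum[OF that]) (rule f0)
  then have "orbit_series \<alpha> f N x - orbit_series \<alpha> f N y = (\<Sum>i<N. \<alpha> ^ (L * i) * e i)"
    using xy unfolding e_def by (simp add: sum_subtractf right_diff_distrib)
  also have "\<dots> \<ge> \<alpha> ^ (L * 0) / 2"
  proof (rule tail_bound[OF \<alpha> N])
    show "\<bar>e i\<bar> \<le> 1" for i 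
      using tent_bounds[of "(T ((shift ^^ i) x) - T x) / \<delta>"] tent_bounds[of "(T ((shift ^^ i) y) - T x) / \<delta>"]
      unfolding e_def f_def by linarith
  qed (simp_all add: e0)
  finally show "1 / 2 \<le> orbit_series \<alpha> f N x - orbit_series \<alpha> f N y" by simp
qed

text \<open>Twice the tent of half-width 1/(2B) minus the one of half-width 1/(4B) is a trapezoid: 1
  up to distance 1/(4B) from \<open>t0\<close> and 0 from distance 1/(2B) on. On the Cantor set it
  is the indicator of a single first word, so all terms before \<open>q\<close> cancel exactly and
  the q-th contributes \<alpha>^(Lq). The claim keeps the tents apart because the covariance bound
  treats one tent at a time.\<close>

lemma large_bump:
  assumes xy: "x \<in> {0..<1}" "y \<in> {0..<1}" "split_at q x y" and \<alpha>: "0 < \<alpha>" "\<alpha> ^ L \<le> 1/3" and N: "q < N"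
  defines "t0 \<equiv> real (D (dig ((shift ^^ q) x))) / B"
  defines "f \<equiv> \<lambda>\<delta> u. tent ((u - t0) / \<delta>)"
  shows "\<And>u \<delta>. \<theta> \<le> u \<Longrightarrow> 0 < \<delta> \<Longrightarrow> \<delta> \<le> 1 / (2 * B) \<Longrightarrow> f \<delta> u = 0"
    "\<And>\<delta>. 0 < \<delta> \<Longrightarrow> \<delta> \<le> 1 / (2 * B) \<Longrightarrow> tent (t0 / \<delta>) = 0" 
    "\<alpha> ^ (L * q) / 2 \<le> 2 * (orbit_series \<alpha> (f (1 / (2 * B))) N x - orbit_series \<alpha> (f (1 / (2 * B))) N y)
       - (orbit_series \<alpha> (f (1 / (4 * B))) N x - orbit_series \<alpha> (f (1 / (4 * B))) N y)"
proof -
  let ?d = "D (dig ((shift ^^ q) x))"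
  have d: "1 \<le> real ?d" "real ?d + 1 \<le> B * \<theta>"
    using D_dig[OF shift_pow_range[OF xy(1), of q]] by auto
  have Bt: "B * t0 = real ?d" using B_pos by (simp add: t0_def)
  show f0: "f \<delta> u = 0" if u: "\<theta> \<le> u" and \<delta>: "0 < \<delta>" "\<delta> \<le> 1 / (2 * B)" for u \<delta>
  proof -
    have "B * \<theta> \<le> B * u" using u B_pos by simp
    moreover have "B * \<delta> \<le> 1/2" using \<delta> B_pos by (simp add: field_simps)
    ultimately have "B * \<delta> \<le> B * (u - t0)" using d unfolding right_diff_distrib Bt by linarith
    then have "\<delta> \<le> u - t0" using B_pos by simp
    then show ?thesis using \<delta> unfolding f_def by (intro tent_eq_0) (auto simp: le_divide_eq)
  qed
  show "tent (t0 / \<delta>) = 0" if \<delta>: "0 < \<delta>" "\<delta> \<le> 1 / (2 * B)" for \<delta>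
  proof -
    have "B * \<delta> \<le> 1/2" using \<delta> B_pos by (simp add: field_simps)
    then have "B * \<delta> \<le> B * t0" using d Bt by linarith
    then have "\<delta> \<le> t0" using B_pos by simp
    then show ?thesis using \<delta> by (intro tent_eq_0) (auto simp: le_divide_eq)
  qed
  define g where "g u = 2 * f (1 / (2 * B)) u - f (1 / (4 * B)) u" for u
  have BB: "0 < 1 / (2 * B)" "0 < 1 / (4 * B)" "1 / (4 * B) \<le> 1 / (2 * B)" using B_pos by (auto simp: field_simps)
  have g0: "g u = 0" if "\<theta> \<le> u" for u unfolding g_def using f0[OF that] BB by simp
  have gT: "g (T z) = (if dig z = dig ((shift ^^ q) x) then 1 else 0)" if z: "z \<in> {0..<1}" for z
  proof -
    define v where "v = B * T z - real ?d"
    have geq: "g (T z) = 2 * tent (2 * v) - tent (4 * v)"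
    proof -
      have "(T z - t0) / (1 / (2 * B)) = 2 * v" "(T z - t0) / (1 / (4 * B)) = 4 * v"
        using B_pos Bt by (simp_all add: v_def right_diff_distrib left_diff_distrib mult_ac)
      then show ?thesis unfolding g_def f_def by (simp only:)
    qed
    have BT: "real (D (dig z)) \<le> B * T z" "B * T z \<le> real (D (dig z)) + 1/4"
      using T_bounds[OF z] B_pos by (auto simp: field_simps)
    show ?thesis
    proof (cases "dig z = dig ((shift ^^ q) x)")
      case True
      then have "0 \<le> v" "v \<le> 1/4" using BT by (auto simp: v_def)
      then show ?thesis unfolding geq using True by (simp add: tent_def)
    next
      case False
      then have "D (dig z) \<noteq> ?d" 
        using D_inj dig_less[OF z] dig_less[OF shift_pow_range[OF xy(1), of q]] by (auto simp: inj_on_def)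
      then have "1 \<le> \<bar>real (D (dig z)) - real ?d\<bar>" by linarith
      then have "1/2 \<le> \<bar>v\<bar>" using BT unfolding v_def by linarith
      then show ?thesis unfolding geq using False by (simp add: tent_eq_0)
    qed
  qed
  define e where "e i = g (T ((shift ^^ i) x)) - g (T ((shift ^^ i) y))" for i
  have lin: "2 * orbit_series \<alpha> (f (1 / (2 * B))) N z - orbit_series \<alpha> (f (1 / (4 * B))) N z = orbit_series \<alpha> g N z" for z
    unfolding orbit_series_def g_def by (simp add: sum_distrib_left sum_subtractf right_diff_distrib mult_ac)
  have "orbit_series \<alpha> g N z = (\<Sum>i<N. \<alpha> ^ (L * i) * g (T ((shift ^^ i) z)))" if "z \<in> {0..<1}" for z
    unfolding orbit_series_def by (rule orbit_sum[OF that]) (rule g0)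
  then have "orbit_series \<alpha> g N x - orbit_series \<alpha> g N y = (\<Sum>i<N. \<alpha> ^ (L * i) * e i)"
    using xy unfolding e_def by (simp add: sum_subtractf right_diff_distrib)
  also have "\<dots> \<ge> \<alpha> ^ (L * q) / 2"
  proof (rule tail_bound[OF \<alpha> N])
    note gx = gT[OF shift_pow_range[OF xy(1)]] and gy = gT[OF shift_pow_range[OF xy(2)]]
    show "e i = 0" if "i < q" for i
      using xy(3) that unfolding e_def gx gy split_at_def agree_def by simp
    show "e q = 1" using xy(3) unfolding e_def gx gy split_at_def by auto
    show "\<bar>e i\<bar> \<le> 1" for i unfolding e_def gx gy by simp
  qed
  finally have "\<alpha> ^ (L * q) / 2 \<le> orbit_series \<alpha> g N x - orbit_series \<alpha> g N y" .
  moreover have eq: "2 * (a - a') - (c - c') = (2 * a - c) - (2 * a' - c')" for a a' c c' :: real by simp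
  ultimately show "\<alpha> ^ (L * q) / 2 \<le> 2 * (orbit_series \<alpha> (f (1 / (2 * B))) N x - orbit_series \<alpha> (f (1 / (2 * B))) N y)
       - (orbit_series \<alpha> (f (1 / (4 * B))) N x - orbit_series \<alpha> (f (1 / (4 * B))) N y)"
    unfolding eq lin by blast
qed

end

section \<open>Kolmogorov continuity and Gaussian estimates\<close>

text \<open>Chaining: successive dyadic truncations \<open>ap n x\<close> are equal or neighbours on
  the finer grid, so by continuity \<open>f x - f (ap n x)\<close> is bounded by a geometric tail.
  Comparing \<open>s\<close> and \<open>t\<close> at a level n with 2^(-n) of the order of |s - t|
  gives the exponent.\<close>

lemma dyadic_holder:
  fixes f :: "real \<Rightarrow> real"
  assumes cont: "continuous_on {0..1} f" and \<gamma>: "0 < \<gamma>" "\<gamma> \<le> 1" and C: "0 \<le> C"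
    and incr: "\<And>n k. k < 2 ^ n \<Longrightarrow> \<bar>f (real (k + 1) / 2 ^ n) - f (real k / 2 ^ n)\<bar> \<le> C * (2 powr (- \<gamma>)) ^ n"
  shows "\<exists>C'\<ge>0. \<forall>s\<in>{0..1}. \<forall>t\<in>{0..1}. \<bar>f s - f t\<bar> \<le> C' * \<bar>s - t\<bar> powr \<gamma>"
proof -
  define r :: real where "r = 2 powr (- \<gamma>)"
  have r: "0 < r" "r < 1" using \<gamma> by (auto simp: r_def powr_less_one)
  define fl where "fl n x = nat \<lfloor>2 ^ n * x\<rfloor>" for n and x :: real
  define ap where "ap n x = real (fl n x) / 2 ^ n" for n x
  have fl: "real (fl n x) \<le> 2 ^ n * x" "2 ^ n * x < real (fl n x) + 1" if "x \<in> {0..1}" for n x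
  proof -
    have "0 \<le> 2 ^ n * x" using that by simp
    then show "real (fl n x) \<le> 2 ^ n * x" "2 ^ n * x < real (fl n x) + 1" unfolding fl_def by linarith+
  qed
  have fl_le: "fl n x \<le> 2 ^ n" if "x \<in> {0..1}" for n x
  proof -
    have "real (fl n x) \<le> 2 ^ n * 1" using that by (intro order_trans[OF fl(1)[OF that, of n]] mult_left_mono) auto
    then have "real (fl n x) \<le> real (2 ^ n)" by simp
    then show ?thesis by (simp only: of_nat_le_iff)
  qed
  have step: "\<bar>f (ap (Suc n) x) - f (ap n x)\<bar> \<le> C * r ^ Suc n" if x: "x \<in> {0..1}" for n x
  proof -
    have "real (fl (Suc n) x) < real (2 * fl n x + 2)" "real (2 * fl n x) < real (fl (Suc n) x + 1)"
      using fl[OF x, of n] fl[OF x, of "Suc n"] by auto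
    then consider "fl (Suc n) x = 2 * fl n x" | "fl (Suc n) x = 2 * fl n x + 1" by linarith
    then show ?thesis
    proof cases
      case 1
      then have "ap (Suc n) x = ap n x" by (simp add: ap_def)
      then show ?thesis using C r by simp
    next
      case 2
      have "ap n x = real (2 * fl n x) / 2 ^ Suc n" by (simp add: ap_def)
      moreover have "2 * fl n x < 2 ^ Suc n" using 2 fl_le[OF x, of "Suc n"] by simp
      ultimately show ?thesis using incr[of "2 * fl n x" "Suc n"] 2 unfolding ap_def r_def by simp
    qed
  qed
  define R where "R = r / (1 - r)"
  have R: "0 < R" using r by (simp add: R_def)
  have tele: "\<bar>f (ap (n + j) x) - f (ap n x)\<bar> \<le> C * ((r ^ (n + 1) - r ^ (n + j + 1)) / (1 - r))" if x: "x \<in> {0..1}" for n j x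
  proof (induction j)
    case (Suc j)
    have "\<bar>f (ap (n + Suc j) x) - f (ap n x)\<bar> \<le> C * r ^ (n + j + 1) + C * ((r ^ (n + 1) - r ^ (n + j + 1)) / (1 - r))"
      using step[OF x, of "n + j"] Suc by simp
    also have "\<dots> = C * ((r ^ (n + 1) - r ^ (n + Suc j + 1)) / (1 - r))"
      using r by (simp add: field_simps)
    finally show ?case .
  qed simp
  have conv: "\<bar>f x - f (ap n x)\<bar> \<le> C * R * r ^ n" if x: "x \<in> {0..1}" for n x
  proof -
    have apx: "ap m x \<in> {0..1}" "\<bar>ap m x - x\<bar> \<le> (1/2) ^ m" for m
    proof -
      show "ap m x \<in> {0..1}" using fl_le[OF x, of m] by (simp add: ap_def flip: of_nat_le_iff)
      have "\<bar>real (fl m x) - 2 ^ m * x\<bar> \<le> 1" using fl[OF x, of m] by linarith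
      moreover have "ap m x - x = (real (fl m x) - 2 ^ m * x) / 2 ^ m" by (simp add: ap_def diff_divide_distrib)
      ultimately show "\<bar>ap m x - x\<bar> \<le> (1/2) ^ m" by (simp add: power_one_over divide_right_mono)
    qed
    have "(\<lambda>m. ap m x - x) \<longlonglongrightarrow> 0"
    proof (rule Lim_null_comparison[where g = "\<lambda>m. (1/2) ^ m"])
      show "\<forall>\<^sub>F m in sequentially. norm (ap m x - x) \<le> (1/2) ^ m" using apx by simp
      show "(\<lambda>m. (1/2::real) ^ m) \<longlonglongrightarrow> 0" by (rule LIMSEQ_power_zero) simp
    qed
    then have "(\<lambda>m. ap m x) \<longlonglongrightarrow> x" by (simp add: LIM_zero_iff)
    then have "(\<lambda>m. ap (m + n) x) \<longlonglongrightarrow> x" by (rule LIMSEQ_ignore_initial_segment)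
    then have "(\<lambda>m. f (ap (m + n) x)) \<longlonglongrightarrow> f x"
      using apx x by (intro continuous_on_tendsto_compose[OF cont]) auto
    then have "(\<lambda>m. \<bar>f (ap (m + n) x) - f (ap n x)\<bar>) \<longlonglongrightarrow> \<bar>f x - f (ap n x)\<bar>"
      by (intro tendsto_intros)
    moreover have "\<bar>f (ap (m + n) x) - f (ap n x)\<bar> \<le> C * R * r ^ n" for m
    proof -
      have "\<bar>f (ap (n + m) x) - f (ap n x)\<bar> \<le> C * ((r ^ (n + 1) - r ^ (n + m + 1)) / (1 - r))" by (rule tele[OF x])
      also have "\<dots> \<le> C * (r ^ (n + 1) / (1 - r))" using C r by (intro mult_left_mono divide_right_mono) auto
      finally show ?thesis by (simp add: R_def add.commute)
    qed
    ultimately show ?thesis by (intro LIMSEQ_le_const2) auto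
  qed
  define C' where "C' = (2 * C * R + C) * 2"
  have main: "\<bar>f s - f t\<bar> \<le> C' * \<bar>s - t\<bar> powr \<gamma>" if st: "s \<in> {0..1}" "t \<in> {0..1}" "s < t" for s t
  proof -
    \<comment> \<open>The largest level with t - s <= 2^(-n); there the truncations of
      \<open>s\<close> and \<open>t\<close> coincide or are adjacent.\<close>
    define n where "n = nat \<lfloor>- log 2 (t - s)\<rfloor>"
    have "log 2 (t - s) \<le> 0" using st by simp
    then have n: "real n \<le> - log 2 (t - s)" "- log 2 (t - s) < real n + 1" unfolding n_def by linarith+
    have n1: "(t - s) * 2 ^ n \<le> 1"
    proof -
      have "2 powr (log 2 (t - s)) \<le> 2 powr (- real n)" using n by (intro powr_mono) auto
      then show ?thesis using st by (simp add: powr_minus powr_realpow field_simps)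
    qed
    have n2: "r ^ n \<le> 2 * (t - s) powr \<gamma>"
    proof -
      have "r ^ n = 2 powr (- \<gamma> * real n)" using powr_realpow[of r n] r by (simp add: r_def powr_powr)
      also have "\<dots> \<le> 2 powr (\<gamma> * (log 2 (t - s) + 1))"
      proof (rule powr_mono)
        have "\<gamma> * (- real n) \<le> \<gamma> * (log 2 (t - s) + 1)" using n \<gamma> by (intro mult_left_mono) auto
        then show "- \<gamma> * real n \<le> \<gamma> * (log 2 (t - s) + 1)" by simp
      qed simp
      also have "\<dots> = (2 powr (log 2 (t - s) + 1)) powr \<gamma>" by (simp add: powr_powr mult.commute)
      also have "2 powr (log 2 (t - s) + 1) = 2 * (t - s)" using st by (simp add: powr_add)
      also have "(2 * (t - s)) powr \<gamma> = 2 powr \<gamma> * (t - s) powr \<gamma>" using st by (intro powr_mult)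
      also have "\<dots> \<le> 2 powr 1 * (t - s) powr \<gamma>" using \<gamma> by (intro mult_right_mono powr_mono) auto
      finally show ?thesis by simp
    qed
    have "\<bar>f (ap n t) - f (ap n s)\<bar> \<le> C * r ^ n"
    proof -
      have "2 ^ n * t \<le> 2 ^ n * s + 1" using n1 by (simp add: algebra_simps)
      moreover have "2 ^ n * s \<le> 2 ^ n * t" using st by simp
      ultimately have "real (fl n t) < real (fl n s) + 2" "real (fl n s) < real (fl n t) + 1"
        using fl[OF st(1), of n] fl[OF st(2), of n] by linarith+
      then have "real (fl n t) < real (fl n s + 2)" "real (fl n s) < real (fl n t + 1)" by auto
      then consider "fl n t = fl n s" | "fl n t = fl n s + 1" by linarith
      then show ?thesis
      proof cases
        case 1
        then show ?thesis using C r by (simp add: ap_def)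
      next
        case 2
        then have "fl n s < 2 ^ n" using fl_le[OF st(2), of n] by simp
        then show ?thesis using incr[of "fl n s" n] 2 by (simp add: ap_def r_def)
      qed
    qed
    then have "\<bar>f s - f t\<bar> \<le> (2 * C * R + C) * r ^ n"
      using conv[OF st(1), of n] conv[OF st(2), of n] by (simp add: algebra_simps)
    also have "\<dots> \<le> (2 * C * R + C) * (2 * (t - s) powr \<gamma>)" using C R n2 by (intro mult_left_mono) auto
    finally show ?thesis using st by (simp add: C'_def algebra_simps)
  qed
  show ?thesis
  proof (intro exI[of _ C'] conjI ballI)
    show "0 \<le> C'" using C R by (simp add: C'_def)
    fix s t :: real assume st: "s \<in> {0..1}" "t \<in> {0..1}"
    consider "s < t" | "s = t" | "t < s" by linarith
    then show "\<bar>f s - f t\<bar> \<le> C' * \<bar>s - t\<bar> powr \<gamma>"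
      using main[of s t] main[of t s] st by cases (auto simp: abs_minus_commute)
  qed
qed

section \<open>Moments and small-ball probabilities of centered Gaussian variables\<close>

definition even_moment_const :: "nat \<Rightarrow> real" where
  "even_moment_const p = fact (2 * p) / (2 ^ p * fact p)"

lemma gaussian_rv_cases:
  assumes "prob_space M" and g: "gaussian_rv M X" and mean: "integral\<^sup>L M X = 0"
  obtains "AE \<omega> in M. X \<omega> = 0"
  | \<sigma> where "0 < \<sigma>" "distr M borel X = density lborel (\<lambda>x. ennreal (normal_density 0 \<sigma> x))"
proof -
  interpret prob_space M by fact
  have X[measurable]: "X \<in> borel_measurable M" using g by (simp add: gaussian_rv_def)
  from g consider \<mu> where "distr M borel X = return borel \<mu>"
    | \<mu> \<sigma> where "0 < \<sigma>" "distr M borel X = density lborel (\<lambda>x. ennreal (normal_density \<mu> \<sigma> x))"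
    unfolding gaussian_rv_def by blast
  then show thesis
  proof cases
    case 1
    have "AE x in return borel \<mu>. x = \<mu>" by (simp add: AE_return)
    then have ae: "AE \<omega> in M. X \<omega> = \<mu>" unfolding 1[symmetric] by (subst (asm) AE_distr_iff) auto
    then have "integral\<^sup>L M X = (\<integral>\<omega>. \<mu> \<partial>M)" by (intro integral_cong_AE) auto
    then have "\<mu> = 0" using mean by (simp add: prob_space)
    then show thesis using ae that by simp
  next
    case 2
    have "integral\<^sup>L M X = (\<integral>x. x \<partial>distr M borel X)" by (simp add: integral_distr)
    also have "\<dots> = \<mu>" unfolding 2(2) using integral_normal_moment_nz_1[OF 2(1), of \<mu>] by (subst integral_density) auto
    finally show thesis using 2 mean that by simp
  qed
qed

lemma gaussian_even_moment:
  assumes "prob_space M" and g: "gaussian_rv M X" and mean: "integral\<^sup>L M X = 0" and p: "1 \<le> p"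
  shows "has_bochner_integral M (\<lambda>\<omega>. X \<omega> ^ (2 * p)) (even_moment_const p * (\<integral>\<omega>. (X \<omega>)\<^sup>2 \<partial>M) ^ p)"
proof -
  interpret prob_space M by fact
  have X[measurable]: "X \<in> borel_measurable M" using g by (simp add: gaussian_rv_def)
  show ?thesis
  proof (rule gaussian_rv_cases[OF assms(1-3)])
    assume ae: "AE \<omega> in M. X \<omega> = 0"
    then have "(\<integral>\<omega>. (X \<omega>)\<^sup>2 \<partial>M) = (\<integral>\<omega>. 0 \<partial>M)" by (intro integral_cong_AE) auto
    moreover have "has_bochner_integral M (\<lambda>\<omega>. X \<omega> ^ (2 * p)) 0 \<longleftrightarrow> has_bochner_integral M (\<lambda>\<omega>. 0::real) (0::real)"
      using ae p by (intro has_bochner_integral_cong_AE) auto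
    ultimately show ?thesis using p by (simp add: has_bochner_integral_zero power_0_left)
  next
    fix \<sigma> :: real assume \<sigma>: "0 < \<sigma>" and d: "distr M borel X = density lborel (\<lambda>x. ennreal (normal_density 0 \<sigma> x))"
    have m: "has_bochner_integral M (\<lambda>\<omega>. X \<omega> ^ (2 * k)) (even_moment_const k * (\<sigma>\<^sup>2) ^ k)" for k
    proof -
      have "has_bochner_integral lborel (\<lambda>x. normal_density 0 \<sigma> x *\<^sub>R x ^ (2 * k)) (even_moment_const k * (\<sigma>\<^sup>2) ^ k)"
        using normal_moment_even[OF \<sigma>, of 0 k] \<sigma> by (simp add: even_moment_const_def power_divide)
      then have "has_bochner_integral (density lborel (\<lambda>x. ennreal (normal_density 0 \<sigma> x))) (\<lambda>x. x ^ (2 * k)) (even_moment_const k * (\<sigma>\<^sup>2) ^ k)"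
        by (intro has_bochner_integral_density) auto
      then show ?thesis unfolding d[symmetric] has_bochner_integral_iff by (simp add: integrable_distr_eq integral_distr)
    qed
    have "(\<integral>\<omega>. (X \<omega>)\<^sup>2 \<partial>M) = \<sigma>\<^sup>2"
      using has_bochner_integral_integral_eq[OF m[of 1]] by (simp add: even_moment_const_def)
    then show ?thesis using m[of p] by simp
  qed
qed

lemma gaussian_square_integrable:
  assumes "prob_space M" "gaussian_rv M X" "integral\<^sup>L M X = 0"
  shows "integrable M (\<lambda>\<omega>. (X \<omega>)\<^sup>2)"
  using gaussian_even_moment[OF assms, of 1] by (auto simp: has_bochner_integral_iff)

text \<open>A normal density of deviation \<sigma> is at most 1/(2\<sigma>), since 2 pi > 4, and the
  interval has length 2\<rho>. A positive lower bound on the variance rules out the point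
  mass.\<close>

lemma gaussian_small_ball:
  assumes "prob_space M" and g: "gaussian_rv M X" and mean: "integral\<^sup>L M X = 0"
    and v: "0 < v" "v\<^sup>2 \<le> (\<integral>\<omega>. (X \<omega>)\<^sup>2 \<partial>M)" and \<rho>: "0 \<le> \<rho>"
  shows "emeasure M {\<omega>\<in>space M. \<bar>X \<omega>\<bar> \<le> \<rho>} \<le> ennreal (\<rho> / v)"
proof -
  interpret prob_space M by fact
  have X[measurable]: "X \<in> borel_measurable M" using g by (simp add: gaussian_rv_def)
  show ?thesis
  proof (rule gaussian_rv_cases[OF assms(1-3)])
    assume "AE \<omega> in M. X \<omega> = 0"
    then have "(\<integral>\<omega>. (X \<omega>)\<^sup>2 \<partial>M) = (\<integral>\<omega>. 0 \<partial>M)" by (intro integral_cong_AE) auto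
    then show ?thesis using v by simp
  next
    fix \<sigma> :: real assume \<sigma>: "0 < \<sigma>" and d: "distr M borel X = density lborel (\<lambda>x. ennreal (normal_density 0 \<sigma> x))"
    have "(\<integral>\<omega>. (X \<omega>)\<^sup>2 \<partial>M) = (\<integral>x. x\<^sup>2 \<partial>distr M borel X)" by (simp add: integral_distr)
    also have "\<dots> = \<sigma>\<^sup>2"
      unfolding d using integral_normal_moment_even[OF \<sigma>, of 0 1] \<sigma> by (subst integral_density) auto
    finally have v\<sigma>: "v \<le> \<sigma>" using v \<sigma> by (auto intro: power2_le_imp_le)
    have "emeasure M {\<omega>\<in>space M. \<bar>X \<omega>\<bar> \<le> \<rho>} = emeasure (distr M borel X) {-\<rho>..\<rho>}"
      by (subst emeasure_distr) (auto intro!: arg_cong2[where f = emeasure])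
    also have "\<dots> = (\<integral>\<^sup>+x. ennreal (normal_density 0 \<sigma> x) * indicator {-\<rho>..\<rho>} x \<partial>lborel)"
      unfolding d by (subst emeasure_density) auto
    also have "\<dots> \<le> (\<integral>\<^sup>+x. ennreal (1 / (2 * \<sigma>)) * indicator {-\<rho>..\<rho>} x \<partial>lborel)"
    proof (intro nn_integral_mono mult_right_mono ennreal_leI)
      fix x :: real
      have "2 * \<sigma> \<le> sqrt (2 * pi * \<sigma>\<^sup>2)"
        using pi_gt3 \<sigma> by (intro real_le_rsqrt) (simp add: power_mult_distrib)
      then have "1 / sqrt (2 * pi * \<sigma>\<^sup>2) * exp (- (x - 0)\<^sup>2 / (2 * \<sigma>\<^sup>2)) \<le> 1 / (2 * \<sigma>) * 1"
        using \<sigma> by (intro mult_mono divide_left_mono) auto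
      then show "normal_density 0 \<sigma> x \<le> 1 / (2 * \<sigma>)" by (simp add: normal_density_def)
    qed simp
    also have "\<dots> = ennreal (1 / (2 * \<sigma>)) * ennreal (2 * \<rho>)"
      using \<rho> by (subst nn_integral_cmult_indicator) auto
    also have "\<dots> = ennreal (\<rho> / \<sigma>)" using \<sigma> \<rho> by (simp flip: ennreal_mult)
    also have "\<dots> \<le> ennreal (\<rho> / v)" using v v\<sigma> \<rho> by (intro ennreal_leI divide_left_mono) auto
    finally show ?thesis .
  qed
qed

section \<open>Linear combinations and path regularity of fractional Brownian motion\<close>

locale fbm = prob_space M for M :: "'w measure" +
  fixes H :: real and W :: "real \<Rightarrow> 'w \<Rightarrow> real"
  assumes H: "0 < H" "H < 1" and fbm: "continuous_fbm M H W"
begin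

lemma gaussian_comb:
  assumes I: "finite I" and p: "p ` I \<subseteq> {0..1}"
  shows "gaussian_rv M (\<lambda>\<omega>. \<Sum>i\<in>I. c i * W (p i) \<omega>)"
proof -
  \<comment> \<open>The points \<open>p i\<close> may coincide, whereas a Gaussian process is
    defined through sums over sets of times; coefficients of equal points are therefore added
    up.\<close>
  have "gaussian_rv M (\<lambda>\<omega>. \<Sum>t\<in>p ` I. (\<Sum>i\<in>{i\<in>I. p i = t}. c i) * W t \<omega>)"
    using fbm I p by (auto simp: continuous_fbm_def gaussian_process_on_def)
  moreover have "(\<Sum>i\<in>I. c i * W (p i) \<omega>) = (\<Sum>t\<in>p ` I. (\<Sum>i\<in>{i\<in>I. p i = t}. c i) * W t \<omega>)" for \<omega>
    by (subst sum.image_gen[OF I, of _ p]) (auto simp: sum_distrib_right intro!: sum.cong)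
  ultimately show ?thesis by simp
qed

lemma gaussian_W: "t \<in> {0..1} \<Longrightarrow> gaussian_rv M (W t)"
  using gaussian_comb[of "{()}" "\<lambda>_. t" "\<lambda>_. 1"] by simp

lemma W_measurable: "t \<in> {0..1} \<Longrightarrow> W t \<in> borel_measurable M"
  using gaussian_W by (simp add: gaussian_rv_def)

lemma W_mean: "t \<in> {0..1} \<Longrightarrow> integral\<^sup>L M (W t) = 0"
  using fbm unfolding continuous_fbm_def by blast

lemma W_integrable: "t \<in> {0..1} \<Longrightarrow> integrable M (W t)"
  by (rule square_integrable_imp_integrable[OF W_measurable gaussian_square_integrable[OF prob_space_axioms gaussian_W W_mean]])

lemma W_cov:
  assumes "s \<in> {0..1}" "t \<in> {0..1}"
  shows "has_bochner_integral M (\<lambda>\<omega>. W s \<omega> * W t \<omega>) (fbm_cov H s t)"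
proof -
  note [measurable] = W_measurable[OF assms(1)] W_measurable[OF assms(2)]
  have "integrable M (\<lambda>\<omega>. (W s \<omega>)\<^sup>2 + (W t \<omega>)\<^sup>2)"
    using assms by (intro Bochner_Integration.integrable_add gaussian_square_integrable prob_space_axioms gaussian_W W_mean)
  then have "integrable M (\<lambda>\<omega>. W s \<omega> * W t \<omega>)"
  proof (rule Bochner_Integration.integrable_bound)
    show "AE \<omega> in M. norm (W s \<omega> * W t \<omega>) \<le> norm ((W s \<omega>)\<^sup>2 + (W t \<omega>)\<^sup>2)"
    proof (rule AE_I2)
      fix \<omega>
      have "0 \<le> (\<bar>W s \<omega>\<bar> - \<bar>W t \<omega>\<bar>)\<^sup>2" by simp
      then have "2 * (\<bar>W s \<omega>\<bar> * \<bar>W t \<omega>\<bar>) \<le> (W s \<omega>)\<^sup>2 + (W t \<omega>)\<^sup>2"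
        by (simp add: power2_diff)
      moreover have "0 \<le> \<bar>W s \<omega>\<bar> * \<bar>W t \<omega>\<bar>" by simp
      ultimately show "norm (W s \<omega> * W t \<omega>) \<le> norm ((W s \<omega>)\<^sup>2 + (W t \<omega>)\<^sup>2)" 
        unfolding real_norm_def abs_mult by linarith
    qed
  qed simp
  moreover have "(\<integral>\<omega>. W s \<omega> * W t \<omega> \<partial>M) = fbm_cov H s t"
  proof -
    have "(\<integral>\<omega>. W s \<omega> * W t \<omega> \<partial>M) = (s powr (2 * H) + t powr (2 * H) - \<bar>t - s\<bar> powr (2 * H)) / 2"
      using fbm assms unfolding continuous_fbm_def by blast
    then show ?thesis using assms by (simp add: fbm_cov_def)
  qed
  ultimately show ?thesis by (simp add: has_bochner_integral_iff)
qed

lemma comb_mean: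
  assumes p: "p ` I \<subseteq> {0..1}"
  shows "(\<integral>\<omega>. (\<Sum>i\<in>I. c i * W (p i) \<omega>) \<partial>M) = 0"
proof -
  have "(\<integral>\<omega>. (\<Sum>i\<in>I. c i * W (p i) \<omega>) \<partial>M) = (\<Sum>i\<in>I. \<integral>\<omega>. c i * W (p i) \<omega> \<partial>M)"
    using p by (intro Bochner_Integration.integral_sum integrable_mult_right W_integrable) auto
  also have "\<dots> = 0" using p by (intro sum.neutral) (auto simp: W_mean)
  finally show ?thesis .
qed

lemma comb_variance:
  assumes p: "p ` I \<subseteq> {0..1}"
  shows "(\<integral>\<omega>. (\<Sum>i\<in>I. c i * W (p i) \<omega>)\<^sup>2 \<partial>M) = (\<Sum>i\<in>I. \<Sum>j\<in>I. c i * c j * fbm_cov H (p i) (p j))"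
proof -
  have "has_bochner_integral M (\<lambda>\<omega>. \<Sum>i\<in>I. \<Sum>j\<in>I. c i * c j * (W (p i) \<omega> * W (p j) \<omega>))
     (\<Sum>i\<in>I. \<Sum>j\<in>I. c i * c j * fbm_cov H (p i) (p j))"
    using p by (intro has_bochner_integral_sum has_bochner_integral_mult_right W_cov) auto
  moreover have "(\<Sum>i\<in>I. \<Sum>j\<in>I. c i * c j * (W (p i) \<omega> * W (p j) \<omega>)) = (\<Sum>i\<in>I. c i * W (p i) \<omega>)\<^sup>2" for \<omega>
    unfolding power2_eq_square sum_product by (intro sum.cong refl) (simp add: mult_ac)
  ultimately have "has_bochner_integral M (\<lambda>\<omega>. (\<Sum>i\<in>I. c i * W (p i) \<omega>)\<^sup>2)
     (\<Sum>i\<in>I. \<Sum>j\<in>I. c i * c j * fbm_cov H (p i) (p j))" by simp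
  then show ?thesis by (rule has_bochner_integral_integral_eq)
qed

lemma increment:
  assumes "s \<in> {0..1}" "t \<in> {0..1}"
  shows "gaussian_rv M (\<lambda>\<omega>. W t \<omega> - W s \<omega>)" "(\<integral>\<omega>. W t \<omega> - W s \<omega> \<partial>M) = 0"
    "(\<integral>\<omega>. (W t \<omega> - W s \<omega>)\<^sup>2 \<partial>M) = \<bar>t - s\<bar> powr (2 * H)"
proof -
  let ?c = "\<lambda>i::bool. if i then 1 else - 1 :: real" and ?p = "\<lambda>i. if i then t else s"
  have p: "?p ` UNIV \<subseteq> {0..1}" using assms by auto
  have eq: "(\<lambda>\<omega>. \<Sum>i\<in>UNIV. ?c i * W (?p i) \<omega>) = (\<lambda>\<omega>. W t \<omega> - W s \<omega>)"
    by (simp add: UNIV_bool fun_eq_iff)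
  show "gaussian_rv M (\<lambda>\<omega>. W t \<omega> - W s \<omega>)" using gaussian_comb[OF _ p, of ?c] unfolding eq by simp
  show "(\<integral>\<omega>. W t \<omega> - W s \<omega> \<partial>M) = 0" using assms W_integrable W_mean by simp
  have "(\<integral>\<omega>. (W t \<omega> - W s \<omega>)\<^sup>2 \<partial>M) = (\<integral>\<omega>. (\<Sum>i\<in>UNIV. ?c i * W (?p i) \<omega>)\<^sup>2 \<partial>M)"
    by (simp add: UNIV_bool)
  also have "\<dots> = \<bar>t - s\<bar> powr (2 * H)"
    unfolding comb_variance[OF p] by (simp add: UNIV_bool fbm_cov_def abs_minus_commute field_simps)
  finally show "(\<integral>\<omega>. (W t \<omega> - W s \<omega>)\<^sup>2 \<partial>M) = \<bar>t - s\<bar> powr (2 * H)" .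
qed

text \<open>Kolmogorov's argument with moments of order 2p. Markov's inequality and the union over
  the 2^n increments of level \<open>n\<close> bound the probability that one of them reaches
  2^(-\<gamma>n) by a multiple of \<open>q ^ n\<close>, and \<open>p\<close> is taken so large that
  q < 1. By Borel-Cantelli only finitely many levels are bad.\<close>

lemma AE_holder:
  assumes \<gamma>: "0 < \<gamma>" "\<gamma> < H"
  shows "AE \<omega> in M. \<exists>C\<ge>0. \<forall>s\<in>{0..1}. \<forall>t\<in>{0..1}. \<bar>W s \<omega> - W t \<omega>\<bar> \<le> C * \<bar>s - t\<bar> powr \<gamma>"
proof -
  obtain p :: nat where p: "1 / (2 * (H - \<gamma>)) < real p" using reals_Archimedean2 by blast
  then have p2: "1 < 2 * real p * (H - \<gamma>)" using \<gamma> by (simp add: field_simps)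
  then have p1: "1 \<le> p" by (cases p) auto
  define r :: real where "r = 2 powr (- \<gamma>)"
  have r: "0 < r" by (simp add: r_def)
  define inc where "inc n k \<omega> = W (real (k + 1) / 2 ^ n) \<omega> - W (real k / 2 ^ n) \<omega>" for n k :: nat and \<omega>
  have pts: "real k / 2 ^ n \<in> {0..1}" "real (k + 1) / 2 ^ n \<in> {0..1}" if "k < 2 ^ n" for n k :: nat
  proof -
    have "real (k + 1) \<le> real (2 ^ n)" using that by (simp only: of_nat_le_iff)
    then show "real k / 2 ^ n \<in> {0..1}" "real (k + 1) / 2 ^ n \<in> {0..1}" using that by auto
  qed
  have inc_meas[measurable]: "inc n k \<in> borel_measurable M" if "k < 2 ^ n" for n k
    unfolding inc_def using W_measurable pts[OF that] by (intro borel_measurable_diff) auto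
  define A where "A n = {\<omega>\<in>space M. \<exists>k<2^n. r ^ n \<le> \<bar>inc n k \<omega>\<bar>}" for n :: nat
  have A_eq: "A n = (\<Union>k<2^n. {\<omega>\<in>space M. r ^ n \<le> \<bar>inc n k \<omega>\<bar>})" for n by (auto simp: A_def)
  have Ak: "{\<omega>\<in>space M. r ^ n \<le> \<bar>inc n k \<omega>\<bar>} \<in> sets M" if "k < 2 ^ n" for n k
    using inc_meas[OF that] by measurable
  have A[measurable]: "A n \<in> sets M" for n unfolding A_eq using Ak by (intro sets.finite_UN) auto
  define q :: real where "q = 2 powr (1 - 2 * real p * (H - \<gamma>))"
  have q: "0 < q" "q < 1" using p2 by (auto simp: q_def powr_less_one)
  have PA: "measure M (A n) \<le> even_moment_const p * q ^ n" for n
  proof -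
    have single: "measure M {\<omega>\<in>space M. r ^ n \<le> \<bar>inc n k \<omega>\<bar>} \<le> even_moment_const p * (q / 2) ^ n" if k: "k < 2 ^ n" for k
    proof -
      let ?h = "1 / 2 ^ n :: real"
      have h: "\<bar>real (k + 1) / 2 ^ n - real k / 2 ^ n\<bar> = ?h" by (simp add: field_simps)
      have m: "has_bochner_integral M (\<lambda>\<omega>. inc n k \<omega> ^ (2 * p)) (even_moment_const p * (?h powr (2 * H)) ^ p)"
        using gaussian_even_moment[OF prob_space_axioms increment(1,2)[OF pts[OF k]] p1]
        unfolding increment(3)[OF pts[OF k]] h inc_def .
      have "{\<omega>\<in>space M. r ^ n \<le> \<bar>inc n k \<omega>\<bar>} = {\<omega>\<in>space M. (r ^ n) ^ (2 * p) \<le> inc n k \<omega> ^ (2 * p)}"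
      proof -
        have "r ^ n \<le> \<bar>x\<bar> \<longleftrightarrow> (r ^ n) ^ (2 * p) \<le> x ^ (2 * p)" for x
          using power_mono_iff[of "r ^ n" "\<bar>x\<bar>" "2 * p"] p1 r by (simp add: power_even_abs)
        then show ?thesis by simp
      qed
      also have "measure M \<dots> \<le> (\<integral>\<omega>. inc n k \<omega> ^ (2 * p) \<partial>M) / (r ^ n) ^ (2 * p)"
        using m r by (intro integral_Markov_inequality_measure[where A = "space M"]) (auto simp: has_bochner_integral_iff)
      also have "\<dots> = even_moment_const p * ((?h powr (2 * H)) ^ p / (r ^ n) ^ (2 * p))"
        using has_bochner_integral_integral_eq[OF m] by simp
      also have "(?h powr (2 * H)) ^ p / (r ^ n) ^ (2 * p) = (q / 2) ^ n"
      proof -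
        have pw: "(2 powr a) ^ m = 2 powr (a * real m)" for a :: real and m :: nat
          by (simp add: powr_powr flip: powr_realpow)
        have "?h = 2 powr (- real n)" by (simp add: powr_minus powr_realpow divide_inverse)
        then have "(?h powr (2 * H)) ^ p / (r ^ n) ^ (2 * p) = 2 powr (- real n * (2 * H) * real p - (- \<gamma> * real n * real (2 * p)))"
          by (simp only: pw powr_powr r_def powr_diff)
        also have "\<dots> = 2 powr ((1 - 2 * real p * (H - \<gamma>) - 1) * real n)"
          by (simp add: algebra_simps)
        also have "\<dots> = (2 powr (1 - 2 * real p * (H - \<gamma>) - 1)) ^ n" by (simp only: pw)
        also have "2 powr (1 - 2 * real p * (H - \<gamma>) - 1) = q / 2" by (subst powr_diff) (simp add: q_def)
        finally show ?thesis .
      qed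
      finally show ?thesis .
    qed
    have "measure M (A n) \<le> (\<Sum>k<2^n. measure M {\<omega>\<in>space M. r ^ n \<le> \<bar>inc n k \<omega>\<bar>})"
      unfolding A_eq using Ak by (intro finite_measure_subadditive_finite) auto
    also have "\<dots> \<le> (\<Sum>k<(2::nat)^n. even_moment_const p * (q / 2) ^ n)" by (intro sum_mono single) auto
    also have "\<dots> = even_moment_const p * q ^ n" by (simp add: power_divide)
    finally show ?thesis .
  qed
  have "summable (\<lambda>n. measure M (A n))"
  proof (rule summable_comparison_test'[where N = 0])
    show "summable (\<lambda>n. even_moment_const p * q ^ n)" using q by (intro summable_mult summable_geometric) auto
  qed (use PA in auto)
  then have "AE \<omega> in M. eventually (\<lambda>n. \<omega> \<in> space M - A n) sequentially"
    by (intro borel_cantelli_AE1 A) (auto simp: emeasure_eq_measure)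
  then show ?thesis
  proof eventually_elim
    case (elim \<omega>)
    then obtain N where N: "\<And>n. N \<le> n \<Longrightarrow> \<omega> \<in> space M - A n" by (auto simp: eventually_sequentially)
    then have \<omega>: "\<omega> \<in> space M" by auto
    \<comment> \<open>The finitely many bad levels are absorbed into the constant.\<close>
    define C where "C = 1 + (\<Sum>n<N. \<Sum>k<2^n. \<bar>inc n k \<omega>\<bar> / r ^ n)"
    have C: "1 \<le> C" unfolding C_def using r by (auto intro!: sum_nonneg)
    show ?case
    proof (rule dyadic_holder)
      show "continuous_on {0..1} (\<lambda>t. W t \<omega>)" using fbm \<omega> by (simp add: continuous_fbm_def)
      show "0 < \<gamma>" "\<gamma> \<le> 1" "0 \<le> C" using \<gamma> H C by auto
      fix n k :: nat assume k: "k < 2 ^ n"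
      show "\<bar>W (real (k + 1) / 2 ^ n) \<omega> - W (real k / 2 ^ n) \<omega>\<bar> \<le> C * (2 powr - \<gamma>) ^ n"
      proof (cases "N \<le> n")
        case True
        then have "\<bar>inc n k \<omega>\<bar> < r ^ n" using N[of n] k by (auto simp: A_def not_le)
        also have "r ^ n \<le> C * r ^ n" using C r by simp
        finally show ?thesis by (simp add: inc_def r_def)
      next
        case False
        have "\<bar>inc n k \<omega>\<bar> / r ^ n \<le> (\<Sum>k<2^n. \<bar>inc n k \<omega>\<bar> / r ^ n)"
          using k r by (intro member_le_sum) auto
        also have "\<dots> \<le> (\<Sum>n<N. \<Sum>k<2^n. \<bar>inc n k \<omega>\<bar> / r ^ n)"
          using False r by (intro member_le_sum[of n "{..<N}" "\<lambda>n. \<Sum>k<2^n. \<bar>inc n k \<omega>\<bar> / r ^ n"]) (auto intro!: sum_nonneg)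
        also have "\<dots> \<le> C" by (simp add: C_def)
        finally show ?thesis using r by (simp add: divide_le_eq inc_def r_def)
      qed
    qed
  qed
qed

end

section \<open>The bridge series\<close>

text \<open>If an integer separates \<open>v\<close> from \<open>u\<close>, go from
  \<open>frac v\<close> up to 1 and from 0 up to \<open>frac u\<close>. Both pieces have length at
  most |u - v| and \<open>g 0 = g 1\<close> glues them; hence the factor 2.\<close>

lemma periodic_holder:
  fixes g :: "real \<Rightarrow> real"
  assumes C: "0 \<le> C" and \<gamma>: "0 < \<gamma>" and g01: "g 0 = g 1"
    and hold: "\<And>s t. s \<in> {0..1} \<Longrightarrow> t \<in> {0..1} \<Longrightarrow> \<bar>g s - g t\<bar> \<le> C * \<bar>s - t\<bar> powr \<gamma>"
  shows "\<bar>g (frac u) - g (frac v)\<bar> \<le> 2 * C * \<bar>u - v\<bar> powr \<gamma>"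
proof -
  have main: "\<bar>g (frac u) - g (frac v)\<bar> \<le> 2 * C * \<bar>u - v\<bar> powr \<gamma>" if vu: "v \<le> u" for u v
  proof -
    have fr: "frac u \<in> {0..1}" "frac v \<in> {0..1}" using frac_lt_1[of u] frac_lt_1[of v] by (auto simp: less_imp_le)
    show ?thesis
    proof (cases "\<lfloor>u\<rfloor> = \<lfloor>v\<rfloor>")
      case True
      then have "frac u - frac v = u - v" by (simp add: frac_def)
      then have "\<bar>g (frac u) - g (frac v)\<bar> \<le> C * \<bar>u - v\<bar> powr \<gamma>" using hold[OF fr] by simp
      moreover have "0 \<le> C * \<bar>u - v\<bar> powr \<gamma>" using C by simp
      ultimately show ?thesis by linarith
    next
      case False
      then have fl: "\<lfloor>v\<rfloor> + 1 \<le> \<lfloor>u\<rfloor>" using floor_mono[OF vu] by linarith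
      then have flr: "real_of_int \<lfloor>v\<rfloor> + 1 \<le> real_of_int \<lfloor>u\<rfloor>" by linarith
      have 1: "\<bar>frac u - 0\<bar> \<le> \<bar>u - v\<bar>" using flr floor_le_iff[of u] by (simp add: frac_def) linarith
      have 2: "\<bar>1 - frac v\<bar> \<le> \<bar>u - v\<bar>" using flr by (simp add: frac_def) linarith
      have "\<bar>g (frac u) - g 0\<bar> \<le> C * \<bar>u - v\<bar> powr \<gamma>"
        using hold[OF fr(1), of 0] powr_mono2[OF less_imp_le[OF \<gamma>] _ 1] C by (auto intro: order_trans mult_left_mono)
      moreover have "\<bar>g 1 - g (frac v)\<bar> \<le> C * \<bar>u - v\<bar> powr \<gamma>"
        using hold[OF _ fr(2), of 1] powr_mono2[OF less_imp_le[OF \<gamma>] _ 2] C by (auto intro: order_trans mult_left_mono)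
      ultimately show ?thesis using g01 by linarith
    qed
  qed
  show ?thesis
  proof (cases "v \<le> u")
    case False
    then show ?thesis using main[of u v] by (simp add: abs_minus_commute)
  qed (use main in auto)
qed

text \<open>The n-th term has Hoelder constant C (\<alpha> b^\<gamma>)^n, and these form a
  convergent geometric series.\<close>

lemma weierstrass_holder:
  fixes g :: "real \<Rightarrow> real"
  assumes C: "0 \<le> C" and \<gamma>: "0 < \<gamma>" and \<alpha>: "0 < \<alpha>" "\<alpha> < 1" "\<alpha> * real b powr \<gamma> < 1" and b: "1 \<le> b"
    and hold: "\<And>u v. \<bar>g (frac u) - g (frac v)\<bar> \<le> C * \<bar>u - v\<bar> powr \<gamma>"
    and summ: "\<And>t. summable (\<lambda>n. \<alpha> ^ n * g (frac (real b ^ n * t)))"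
  shows "\<bar>(\<Sum>n. \<alpha> ^ n * g (frac (real b ^ n * s))) - (\<Sum>n. \<alpha> ^ n * g (frac (real b ^ n * t)))\<bar> 
    \<le> C / (1 - \<alpha> * real b powr \<gamma>) * \<bar>s - t\<bar> powr \<gamma>"
proof -
  define q where "q = \<alpha> * real b powr \<gamma>"
  have q: "0 \<le> q" "q < 1" using \<alpha> by (auto simp: q_def)
  have le: "\<bar>\<alpha> ^ n * g (frac (real b ^ n * s)) - \<alpha> ^ n * g (frac (real b ^ n * t))\<bar> \<le> C * \<bar>s - t\<bar> powr \<gamma> * q ^ n" for n
  proof -
    have "\<bar>real b ^ n * s - real b ^ n * t\<bar> powr \<gamma> = (real b powr \<gamma>) ^ n * \<bar>s - t\<bar> powr \<gamma>"
    proof -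
      have "\<bar>real b ^ n * s - real b ^ n * t\<bar> = real b ^ n * \<bar>s - t\<bar>"
        by (simp add: abs_mult flip: right_diff_distrib)
      moreover have "(real b ^ n) powr \<gamma> = (real b powr \<gamma>) ^ n"
        using b by (simp add: powr_powr mult.commute flip: powr_realpow)
      ultimately show ?thesis by (simp add: powr_mult)
    qed
    then have "\<alpha> ^ n * \<bar>g (frac (real b ^ n * s)) - g (frac (real b ^ n * t))\<bar> \<le> \<alpha> ^ n * (C * ((real b powr \<gamma>) ^ n * \<bar>s - t\<bar> powr \<gamma>))"
      using hold[of "real b ^ n * s" "real b ^ n * t"] \<alpha> by (intro mult_left_mono) auto
    then show ?thesis using \<alpha> by (simp add: q_def power_mult_distrib abs_mult mult_ac flip: right_diff_distrib)
  qed
  have g: "(\<lambda>n. C * \<bar>s - t\<bar> powr \<gamma> * q ^ n) sums (C * \<bar>s - t\<bar> powr \<gamma> * (1 / (1 - q)))"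
    using q by (intro sums_mult geometric_sums) auto
  have "\<bar>(\<Sum>n. \<alpha> ^ n * g (frac (real b ^ n * s))) - (\<Sum>n. \<alpha> ^ n * g (frac (real b ^ n * t)))\<bar> 
     = \<bar>\<Sum>n. \<alpha> ^ n * g (frac (real b ^ n * s)) - \<alpha> ^ n * g (frac (real b ^ n * t))\<bar>"
    by (subst suminf_diff[OF summ summ]) simp
  also have "\<dots> \<le> (\<Sum>n. C * \<bar>s - t\<bar> powr \<gamma> * q ^ n)"
    unfolding real_norm_def[symmetric]
    by (rule norm_suminf_le) (use le sums_summable[OF g] in auto)
  also have "\<dots> = C * \<bar>s - t\<bar> powr \<gamma> * (1 / (1 - q))" using sums_unique[OF g] by simp
  finally show ?thesis by (simp add: q_def)
qed

text \<open>Joint measurability of a Caratheodory function: round \<phi> to a countable grid, where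
  the claim reduces to fixed times, and pass to the limit by continuity.\<close>

lemma measurable_pair_continuous:
  fixes F :: "real \<Rightarrow> 'w \<Rightarrow> real"
  assumes meas: "\<And>t. t \<in> {0..1} \<Longrightarrow> F t \<in> borel_measurable M"
    and cont: "\<And>\<omega>. \<omega> \<in> space M \<Longrightarrow> continuous_on {0..1} (\<lambda>t. F t \<omega>)"
    and \<phi>[measurable]: "\<phi> \<in> borel_measurable N" and range: "\<And>x. x \<in> space N \<Longrightarrow> \<phi> x \<in> {0..1}"
  shows "(\<lambda>z. F (\<phi> (fst z)) (snd z)) \<in> borel_measurable (N \<Otimes>\<^sub>M M)"
proof (rule borel_measurable_LIMSEQ_real)
  \<comment> \<open>Each grid point k/(n+1) is treated separately, also those beyond 1; the minimum
    keeps them within the range where \<open>F\<close> is known to be measurable.\<close>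
  define a where "a n t = min 1 (real (nat \<lfloor>real (Suc n) * t\<rfloor>) / real (Suc n))" for n :: nat and t :: real
  have conv: "(\<lambda>n. a n t) \<longlonglongrightarrow> t" if t: "t \<in> {0..1}" for t
  proof -
    have *: "\<bar>a n t - t\<bar> \<le> 1 / real (Suc n)" for n
    proof -
      define v where "v = real (nat \<lfloor>real (Suc n) * t\<rfloor>) / real (Suc n)"
      have "0 \<le> real (Suc n) * t" using t by simp
      then have "real (Suc n) * t - 1 \<le> real (nat \<lfloor>real (Suc n) * t\<rfloor>)" "real (nat \<lfloor>real (Suc n) * t\<rfloor>) \<le> real (Suc n) * t"
        by linarith+
      from this[THEN divide_right_mono, of "real (Suc n)"]
      have "t - 1 / real (Suc n) \<le> v" "v \<le> t"
        unfolding v_def by (simp_all add: diff_divide_distrib del: of_nat_Suc)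
      moreover have "0 \<le> 1 / real (Suc n)" by simp
      moreover have "t \<le> 1" using t by simp
      moreover have "a n t = min 1 v" by (simp only: a_def v_def)
      ultimately show ?thesis by linarith
    qed
    have "(\<lambda>n. a n t - t) \<longlonglongrightarrow> 0"
    proof (rule Lim_null_comparison)
      show "\<forall>\<^sub>F n in sequentially. norm (a n t - t) \<le> inverse (real (Suc n))"
        unfolding real_norm_def inverse_eq_divide using * by (rule always_eventually[OF allI])
      show "(\<lambda>n. inverse (real (Suc n))) \<longlonglongrightarrow> 0" by (rule LIMSEQ_inverse_real_of_nat)
    qed
    then show ?thesis by (simp add: LIM_zero_iff)
  qed
  show "(\<lambda>z. F (a n (\<phi> (fst z))) (snd z)) \<in> borel_measurable (N \<Otimes>\<^sub>M M)" for n
  proof -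
    have "(\<lambda>z. F (min 1 (real k / real (Suc n))) (snd z)) \<in> borel_measurable (N \<Otimes>\<^sub>M M)" for k :: nat
      using meas[of "min 1 (real k / real (Suc n))"] by (auto intro: measurable_compose[OF measurable_snd])
    then show ?thesis unfolding a_def
      by (rule measurable_compose_countable[where g = "\<lambda>z. nat \<lfloor>real (Suc n) * \<phi> (fst z)\<rfloor>"]) measurable
  qed
  fix z assume "z \<in> space (N \<Otimes>\<^sub>M M)"
  then have z: "fst z \<in> space N" "snd z \<in> space M" by (auto simp: space_pair_measure)
  have "a n (\<phi> (fst z)) \<in> {0..1}" for n by (auto simp: a_def)
  then show "(\<lambda>n. F (a n (\<phi> (fst z))) (snd z)) \<longlonglongrightarrow> F (\<phi> (fst z)) (snd z)"
    using conv[OF range[OF z(1)]] range[OF z(1)] by (intro continuous_on_tendsto_compose[OF cont[OF z(2)]]) auto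
qed

context digit_system
begin


lemma T_measurable: "T \<in> borel_measurable borel"
proof -
  have [measurable]: "shift \<in> borel_measurable borel" unfolding shift_def frac_def by measurable
  have [measurable]: "dig \<in> borel \<rightarrow>\<^sub>M count_space UNIV" unfolding dig_def by measurable
  have [measurable]: "(shift ^^ i) \<in> borel_measurable borel" for i
    by (induction i) (simp_all add: id_def comp_def)
  have "(\<lambda>x. real (D (dig ((shift ^^ i) x))) / B ^ (i + 1)) \<in> borel_measurable borel" for i
    by measurable
  then show ?thesis unfolding T_def by (rule borel_measurable_suminf)
qed

end

section \<open>The bridge series: upper bound and Gaussian truncated differences\<close>

locale fww_bridge = fbm M H W for M :: "'w measure" and H W +
  fixes \<alpha> \<tau> :: real and b :: nat and \<kappa> :: "real \<Rightarrow> real"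
  assumes \<kappa>: "\<kappa> 0 = 0" "\<kappa> 1 = 1" and \<tau>: "H < \<tau>" and \<kappa>_holder: "holder_on \<tau> {0..1} \<kappa>"
    and \<alpha>: "0 < \<alpha>" "\<alpha> < 1" and b: "2 \<le> b"
begin

abbreviation "Y \<equiv> ww_bridge \<alpha> b \<kappa> W"

definition "s = - log (real b) \<alpha>"
definition "h = min H s"

lemma s_pos: "0 < s" unfolding s_def using \<alpha> b by simp

lemma h: "0 < h" "h < 1" "h \<le> H" "h \<le> s" using H s_pos by (auto simp: h_def)

lemma \<alpha>_eq: "\<alpha> = real b powr (- s)" unfolding s_def using \<alpha> b by simp

lemma \<kappa>_continuous: "continuous_on {0..1} \<kappa>"
proof -
  obtain C where C: "0 \<le> C" "\<And>s t. s \<in> {0..1} \<Longrightarrow> t \<in> {0..1} \<Longrightarrow> \<bar>\<kappa> s - \<kappa> t\<bar> \<le> C * \<bar>s - t\<bar> powr \<tau>"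
    using \<kappa>_holder unfolding holder_on_def by blast
  show ?thesis unfolding continuous_on_def
  proof
    fix x :: real assume x: "x \<in> {0..1}"
    have "((\<lambda>t. C * \<bar>t - x\<bar> powr \<tau>) \<longlongrightarrow> C * \<bar>x - x\<bar> powr \<tau>) (at x within {0..1})"
      using \<tau> H by (intro tendsto_intros tendsto_powr') auto
    then have "((\<lambda>t. C * \<bar>t - x\<bar> powr \<tau>) \<longlongrightarrow> 0) (at x within {0..1})" by simp
    then have "((\<lambda>t. \<kappa> t - \<kappa> x) \<longlongrightarrow> 0) (at x within {0..1})"
      by (rule Lim_null_comparison[rotated]) (use C(2) x in \<open>auto simp: eventually_at_filter\<close>)
    then show "(\<kappa> \<longlongrightarrow> \<kappa> x) (at x within {0..1})" by (rule LIM_zero_cancel)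
  qed
qed

lemma W_continuous: "\<omega> \<in> space M \<Longrightarrow> continuous_on {0..1} (\<lambda>t. W t \<omega>)"
  using fbm by (simp add: continuous_fbm_def)

lemma bridge_summable:
  assumes "\<omega> \<in> space M"
  shows "summable (\<lambda>n. \<alpha> ^ n * bridge \<kappa> W (frac (real b ^ n * t)) \<omega>)"
proof -
  have "continuous_on {0..1} (\<lambda>u. bridge \<kappa> W u \<omega>)"
    unfolding bridge_def by (intro continuous_intros W_continuous[OF assms] \<kappa>_continuous)
  then have "bounded ((\<lambda>u. bridge \<kappa> W u \<omega>) ` {0..1})"
    by (intro compact_imp_bounded compact_continuous_image) auto
  then obtain C where "\<forall>x\<in>(\<lambda>u. bridge \<kappa> W u \<omega>) ` {0..1}. norm x \<le> C" unfolding bounded_iff by blast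
  then have C: "\<bar>bridge \<kappa> W u \<omega>\<bar> \<le> C" if "u \<in> {0..1}" for u using that by auto
  show ?thesis
  proof (rule summable_comparison_test'[where N = 0])
    show "summable (\<lambda>n. C * \<alpha> ^ n)" using \<alpha> by (intro summable_mult summable_geometric) auto
    fix n
    have "\<bar>bridge \<kappa> W (frac (real b ^ n * t)) \<omega>\<bar> \<le> C" using frac_lt_1[of "real b ^ n * t"] by (intro C) (auto simp: less_imp_le)
    then have "\<alpha> ^ n * \<bar>bridge \<kappa> W (frac (real b ^ n * t)) \<omega>\<bar> \<le> \<alpha> ^ n * C" using \<alpha> by (intro mult_left_mono) auto
    then show "norm (\<alpha> ^ n * bridge \<kappa> W (frac (real b ^ n * t)) \<omega>) \<le> C * \<alpha> ^ n"
      using \<alpha> by (simp add: abs_mult mult.commute)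
  qed
qed

lemma W0: "AE \<omega> in M. W 0 \<omega> = 0"
proof -
  have "has_bochner_integral M (\<lambda>\<omega>. W 0 \<omega> * W 0 \<omega>) 0"
    using W_cov[of 0 0] by (simp add: fbm_cov_def)
  then have "AE \<omega> in M. W 0 \<omega> * W 0 \<omega> = 0"
    by (subst (asm) has_bochner_integral_iff) (auto simp: integral_nonneg_eq_0_iff_AE)
  then show ?thesis by simp
qed

lemma AE_dim_le:
  assumes \<gamma>: "0 < \<gamma>" "\<gamma> < h"
  shows "AE \<omega> in M. hausdorff_dim (path_graph Y \<omega>) \<le> ereal (2 - \<gamma>)"
proof -
  have "AE \<omega> in M. \<exists>C\<ge>0. \<forall>s\<in>{0..1}. \<forall>t\<in>{0..1}. \<bar>W s \<omega> - W t \<omega>\<bar> \<le> C * \<bar>s - t\<bar> powr \<gamma>"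
    using \<gamma> h by (intro AE_holder) auto
  with W0 AE_space show ?thesis
  proof eventually_elim
    case (elim \<omega>)
    obtain C where C: "0 \<le> C" "\<And>s t. s \<in> {0..1} \<Longrightarrow> t \<in> {0..1} \<Longrightarrow> \<bar>W s \<omega> - W t \<omega>\<bar> \<le> C * \<bar>s - t\<bar> powr \<gamma>"
      using elim(3) by blast
    obtain C' where C': "0 \<le> C'" "\<And>s t. s \<in> {0..1} \<Longrightarrow> t \<in> {0..1} \<Longrightarrow> \<bar>\<kappa> s - \<kappa> t\<bar> \<le> C' * \<bar>s - t\<bar> powr \<tau>"
      using \<kappa>_holder unfolding holder_on_def by blast
    define C2 where "C2 = C + C' * \<bar>W 1 \<omega>\<bar>"
    have C2: "0 \<le> C2" using C C' by (simp add: C2_def)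
    let ?g = "\<lambda>u. bridge \<kappa> W u \<omega>"
    have hold: "\<bar>?g s - ?g t\<bar> \<le> C2 * \<bar>s - t\<bar> powr \<gamma>" if st: "s \<in> {0..1}" "t \<in> {0..1}" for s t
    proof -
      have "\<bar>s - t\<bar> powr \<tau> \<le> \<bar>s - t\<bar> powr \<gamma>" using st \<gamma> \<tau> h by (intro powr_mono') auto
      then have "C' * \<bar>s - t\<bar> powr \<tau> \<le> C' * \<bar>s - t\<bar> powr \<gamma>" using C' by (intro mult_left_mono) auto
      then have "\<bar>\<kappa> s - \<kappa> t\<bar> \<le> C' * \<bar>s - t\<bar> powr \<gamma>" using C'(2)[OF st] by linarith
      then have k: "\<bar>\<kappa> s - \<kappa> t\<bar> * \<bar>W 1 \<omega>\<bar> \<le> C' * \<bar>s - t\<bar> powr \<gamma> * \<bar>W 1 \<omega>\<bar>" by (intro mult_right_mono) auto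
      have "?g s - ?g t = (W s \<omega> - W t \<omega>) - (\<kappa> s - \<kappa> t) * W 1 \<omega>" by (simp add: bridge_def algebra_simps)
      then have "\<bar>?g s - ?g t\<bar> \<le> \<bar>W s \<omega> - W t \<omega>\<bar> + \<bar>\<kappa> s - \<kappa> t\<bar> * \<bar>W 1 \<omega>\<bar>"
        by (metis abs_mult abs_triangle_ineq4)
      also have "\<dots> \<le> C * \<bar>s - t\<bar> powr \<gamma> + C' * \<bar>s - t\<bar> powr \<gamma> * \<bar>W 1 \<omega>\<bar>" using k C(2)[OF st] by linarith
      finally show ?thesis by (simp add: C2_def algebra_simps)
    qed
    \<comment> \<open>Both values are 0, since almost surely \<open>W 0\<close> is 0. Without this
      the periodic extension would jump at integers.\<close>
    have ends: "?g 0 = ?g 1" using elim \<kappa> by (simp add: bridge_def)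
    have lt: "\<alpha> * real b powr \<gamma> < 1"
    proof -
      have "real b powr (- s + \<gamma>) < real b powr 0" using \<gamma> h b by (intro powr_less_mono) auto
      then show ?thesis using b unfolding powr_add \<alpha>_eq[symmetric] by simp
    qed
    define C3 where "C3 = 2 * C2 / (1 - \<alpha> * real b powr \<gamma>)"
    have "\<bar>Y s \<omega> - Y t \<omega>\<bar> \<le> C3 * \<bar>s - t\<bar> powr \<gamma>" for s t
      unfolding ww_bridge_def C3_def
    proof (rule weierstrass_holder)
      show "\<bar>?g (frac u) - ?g (frac v)\<bar> \<le> 2 * C2 * \<bar>u - v\<bar> powr \<gamma>" for u v
        by (rule periodic_holder[OF C2 \<gamma>(1) ends hold])
      show "summable (\<lambda>n. \<alpha> ^ n * bridge \<kappa> W (frac (real b ^ n * t)) \<omega>)" for t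
        by (rule bridge_summable) fact
    qed (use C2 \<gamma> \<alpha> lt b in auto)
    moreover have "0 \<le> C3" using C2 lt by (simp add: C3_def)
    ultimately show ?case unfolding path_graph_def
      using \<gamma> h by (intro hausdorff_dim_holder_graph_le) auto
  qed
qed

text \<open>Truncating the series leaves a finite linear combination of values of \<open>W\<close>,
  to which the Gaussian hypothesis and the covariance bound apply.\<close>

definition partial_diff :: "nat \<Rightarrow> real \<Rightarrow> real \<Rightarrow> 'w \<Rightarrow> real" where
  "partial_diff K t u \<omega> = (\<Sum>n<K. \<alpha> ^ n * (bridge \<kappa> W (frac (real b ^ n * t)) \<omega> - bridge \<kappa> W (frac (real b ^ n * u)) \<omega>))"

text \<open>For the third claim the same linear combination is applied to a tent in place of the
  path. As the tent is 0 at 1, the multiple of \<open>W 1\<close> that comes from \<kappa> leaves no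
  trace; being 0 at 0, it matches the normalisation in the covariance bound.\<close>

lemma partial_diff_gaussian:
  shows "gaussian_rv M (partial_diff K t u)" "integral\<^sup>L M (partial_diff K t u) = 0"
    and "0 < \<delta> \<Longrightarrow> tent (t0 / \<delta>) = 0 \<Longrightarrow> tent ((1 - t0) / \<delta>) = 0 \<Longrightarrow>
      fbm_const H * \<delta> powr (2 * H) * (\<Sum>n<K. \<alpha> ^ n * (tent ((frac (real b ^ n * t) - t0) / \<delta>) - tent ((frac (real b ^ n * u) - t0) / \<delta>)))\<^sup>2
        \<le> (\<integral>\<omega>. (partial_diff K t u \<omega>)\<^sup>2 \<partial>M)"
proof -
  \<comment> \<open>\<open>None\<close> stands for time 1, which collects the total weight
    \<open>- k\<close> of the bridge correction; \<open>Some (n, e)\<close> stands for the n-th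
    orbit point of \<open>t\<close> or of \<open>u\<close>.\<close>
  define I :: "(nat \<times> bool) option set" where "I = insert None (Some ` ({..<K} \<times> UNIV))"
  define k where "k = (\<Sum>n<K. \<alpha> ^ n * (\<kappa> (frac (real b ^ n * t)) - \<kappa> (frac (real b ^ n * u))))"
  define c where "c i = (case i of None \<Rightarrow> - k | Some (n, e) \<Rightarrow> if e then \<alpha> ^ n else - (\<alpha> ^ n))" for i :: "(nat \<times> bool) option"
  define p where "p i = (case i of None \<Rightarrow> 1 | Some (n, e) \<Rightarrow> if e then frac (real b ^ n * t) else frac (real b ^ n * u))" for i :: "(nat \<times> bool) option"
  have I: "finite I" by (simp add: I_def)
  have p: "p ` I \<subseteq> {0..1}" by (auto simp: p_def I_def less_imp_le[OF frac_lt_1] split: option.splits)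
  have comb: "(\<Sum>i\<in>I. c i * G (p i)) = (\<Sum>n<K. \<alpha> ^ n * (G (frac (real b ^ n * t)) - G (frac (real b ^ n * u)))) - k * G 1" for G
  proof -
    have "(\<Sum>i\<in>I. c i * G (p i)) = - k * G 1 + (\<Sum>i\<in>{..<K} \<times> UNIV. c (Some i) * G (p (Some i)))"
      unfolding I_def by (subst sum.insert) (auto simp: sum.reindex c_def p_def)
    also have "(\<Sum>i\<in>{..<K} \<times> UNIV. c (Some i) * G (p (Some i))) = (\<Sum>n<K. \<Sum>e\<in>UNIV. c (Some (n, e)) * G (p (Some (n, e))))"
      by (subst sum.cartesian_product) (auto intro!: sum.cong)
    also have "\<dots> = (\<Sum>n<K. \<alpha> ^ n * (G (frac (real b ^ n * t)) - G (frac (real b ^ n * u))))"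
      by (intro sum.cong) (auto simp: UNIV_bool c_def p_def algebra_simps)
    finally show ?thesis by simp
  qed
  have eq: "partial_diff K t u = (\<lambda>\<omega>. \<Sum>i\<in>I. c i * W (p i) \<omega>)"
  proof
    fix \<omega>
    have "partial_diff K t u \<omega> = (\<Sum>n<K. \<alpha> ^ n * (W (frac (real b ^ n * t)) \<omega> - W (frac (real b ^ n * u)) \<omega>)) - k * W 1 \<omega>"
      unfolding partial_diff_def bridge_def k_def sum_distrib_right sum_subtractf[symmetric]
      by (intro sum.cong) (auto simp: algebra_simps)
    then show "partial_diff K t u \<omega> = (\<Sum>i\<in>I. c i * W (p i) \<omega>)" using comb[of "\<lambda>t. W t \<omega>"] by simp
  qed
  show "gaussian_rv M (partial_diff K t u)" unfolding eq by (rule gaussian_comb[OF I p])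
  show "integral\<^sup>L M (partial_diff K t u) = 0" unfolding eq by (rule comb_mean[OF p])
  assume \<delta>: "0 < \<delta>" "tent (t0 / \<delta>) = 0" "tent ((1 - t0) / \<delta>) = 0"
  show "fbm_const H * \<delta> powr (2 * H) * (\<Sum>n<K. \<alpha> ^ n * (tent ((frac (real b ^ n * t) - t0) / \<delta>) - tent ((frac (real b ^ n * u) - t0) / \<delta>)))\<^sup>2
        \<le> (\<integral>\<omega>. (partial_diff K t u \<omega>)\<^sup>2 \<partial>M)"
    unfolding eq comb_variance[OF p]
    using fbm_cov_lower_bound[OF H I \<delta>(1), of c p t0] comb[of "\<lambda>v. tent ((v - t0) / \<delta>)"] \<delta> by simp
qed

lemma partial_diff_tendsto:
  assumes "\<omega> \<in> space M"
  shows "(\<lambda>K. partial_diff K t u \<omega>) \<longlonglongrightarrow> Y t \<omega> - Y u \<omega>"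
proof -
  have "(\<lambda>n. \<alpha> ^ n * bridge \<kappa> W (frac (real b ^ n * t)) \<omega> - \<alpha> ^ n * bridge \<kappa> W (frac (real b ^ n * u)) \<omega>) 
     sums (Y t \<omega> - Y u \<omega>)"
    unfolding ww_bridge_def by (intro sums_diff summable_sums bridge_summable assms)
  then show ?thesis by (simp add: sums_def partial_diff_def right_diff_distrib)
qed

lemma Y_measurable[measurable]: "Y t \<in> borel_measurable M"
proof -
  have [measurable]: "bridge \<kappa> W (frac v) \<in> borel_measurable M" for v
    unfolding bridge_def using frac_lt_1[of v] 
    by (intro borel_measurable_diff borel_measurable_times W_measurable) (auto simp: less_imp_le)
  show ?thesis unfolding ww_bridge_def by measurable
qed

end

section \<open>Variance and small-ball bounds along the Cantor set\<close>

locale fww_digits = fww_bridge M H W \<alpha> \<tau> b \<kappa> + digit_system b m L Q D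
  for M :: "'w measure" and H W \<alpha> \<tau> b \<kappa> m L Q D +
  assumes \<alpha>L: "\<alpha> ^ L \<le> 1/3"
begin

text \<open>1/(4B) is the smaller of the two fixed half-widths in \<open>large_bump\<close>. The 6
  is 2 times 3: the 2 stems from \<open>tail_bound\<close>, the 3 from separating the trapezoid into
  its tents.\<close>

definition "c0 = sqrt (fbm_const H) * (1 / (4 * B)) powr H / 6"

lemma c0_pos: "0 < c0" using fbm_const_pos[OF H] B_pos by (simp add: c0_def)

lemma orbit_bound:
  assumes xy: "x \<in> {0..<1}" "y \<in> {0..<1}" and \<delta>: "0 < \<delta>" "tent (t0 / \<delta>) = 0" 
    and f: "\<And>u. \<theta> \<le> u \<Longrightarrow> tent ((u - t0) / \<delta>) = 0"
  shows "fbm_const H * \<delta> powr (2 * H) * 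
      (orbit_series \<alpha> (\<lambda>u. tent ((u - t0) / \<delta>)) N x - orbit_series \<alpha> (\<lambda>u. tent ((u - t0) / \<delta>)) N y)\<^sup>2
        \<le> (\<integral>\<omega>. (partial_diff (L * N) (T x) (T y) \<omega>)\<^sup>2 \<partial>M)"
proof -
  have "tent ((1 - t0) / \<delta>) = 0" using f[of 1] \<theta> by simp
  from partial_diff_gaussian(3)[OF \<delta> this, where K = "L * N" and t = "T x" and u = "T y"] show ?thesis
    by (simp add: orbit_series_def sum_subtractf right_diff_distrib)
qed

text \<open>Two lower bounds hold at once. The narrow tent has half-width of order B^(-q) and sees a
  difference of at least 1/2, which gives exponent \<open>H\<close>; a tent of fixed half-width sees
  a difference of order \<alpha>^(Lq) = B^(-sq), which gives exponent \<open>s\<close>. The better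
  one has exponent \<open>h\<close>.\<close>

lemma variance_bound:
  assumes xy: "x \<in> {0..<1}" "y \<in> {0..<1}" "split_at q x y" and N: "q < N"
  shows "(c0 * B powr (- h * real q))\<^sup>2 \<le> (\<integral>\<omega>. (partial_diff (L * N) (T x) (T y) \<omega>)\<^sup>2 \<partial>M)" (is "_ \<le> ?V")
proof -
  define k where "k = fbm_const H"
  have k: "0 < k" unfolding k_def by (rule fbm_const_pos[OF H])
  define d where "d = (1 / (4 * B)) powr H"
  have d: "0 < d" using B_pos by (simp add: d_def)
  have pw: "x powr (2 * H) = (x powr H)\<^sup>2" if "0 < x" for x :: real
    using that by (simp add: power2_eq_square flip: powr_add)
  have H_case: "(c0 * B powr (- H * real q))\<^sup>2 \<le> ?V"
  proof -
    define \<delta> where "\<delta> = 1 / (2 * B ^ (q + 1))"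
    have \<delta>: "0 < \<delta>" using B_pos by (simp add: \<delta>_def)
    note bump = small_bump[OF xy \<alpha>(1) \<alpha>L, of N, folded \<delta>_def]
    have "k * \<delta> powr (2 * H) * (1/2)\<^sup>2 \<le> k * \<delta> powr (2 * H) * 
      (orbit_series \<alpha> (\<lambda>u. tent ((u - T x) / \<delta>)) N x - orbit_series \<alpha> (\<lambda>u. tent ((u - T x) / \<delta>)) N y)\<^sup>2"
      using bump(3) N k by (intro mult_left_mono power_mono) auto
    also have "\<dots> \<le> ?V" unfolding k_def using bump(1,2) N \<delta> by (intro orbit_bound xy) auto
    finally have le: "k * \<delta> powr (2 * H) * (1/2)\<^sup>2 \<le> ?V" .
    have "c0 * B powr (- H * real q) \<le> sqrt k * \<delta> powr H * (1/2)"
    proof -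
      have "\<delta> = 1 / (2 * B) * B powr (- real q)" using B_pos by (simp add: \<delta>_def powr_minus powr_realpow field_simps)
      then have "\<delta> powr H = (1 / (2 * B)) powr H * B powr (- H * real q)"
        by (simp only: powr_mult powr_powr) (simp add: mult.commute)
      moreover have "d \<le> (1 / (2 * B)) powr H" unfolding d_def using B_pos H by (intro powr_mono2) (auto simp: field_simps)
      ultimately have "d * B powr (- H * real q) \<le> \<delta> powr H" by (simp add: mult_right_mono)
      then have "sqrt k * (d * B powr (- H * real q)) * (1/6) \<le> sqrt k * \<delta> powr H * (1/2)"
        using k d by (intro mult_mono mult_left_mono) auto
      then show ?thesis by (simp add: c0_def k_def d_def mult_ac)
    qed
    then have "(c0 * B powr (- H * real q))\<^sup>2 \<le> (sqrt k * \<delta> powr H * (1/2))\<^sup>2" using c0_pos by (intro power_mono) auto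
    also have "\<dots> = k * \<delta> powr (2 * H) * (1/2)\<^sup>2" using k pw[OF \<delta>] by (simp add: power_mult_distrib power_divide)
    finally show ?thesis using le by simp
  qed
  have s_case: "(c0 * B powr (- s * real q))\<^sup>2 \<le> ?V"
  proof -
    define t0 where "t0 = real (D (dig ((shift ^^ q) x))) / B"
    define S where "S \<delta> = orbit_series \<alpha> (\<lambda>u. tent ((u - t0) / \<delta>)) N x - orbit_series \<alpha> (\<lambda>u. tent ((u - t0) / \<delta>)) N y" for \<delta>
    note bump = large_bump[OF xy \<alpha>(1) \<alpha>L N, folded t0_def]
    define v where "v = \<alpha> ^ (L * q) / 6"
    \<comment> \<open>If both tents saw less than \<open>v\<close>, twice the first minus the second
      would stay below 3v. Which of them sees enough depends on \<open>x\<close> and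
      \<open>y\<close>, so only 1/(4B) is a safe lower bound for \<delta>.\<close>
    have "3 * v \<le> 2 * S (1 / (2 * B)) - S (1 / (4 * B))" using bump(3) unfolding v_def S_def by simp
    then have "v \<le> \<bar>S (1 / (2 * B))\<bar> \<or> v \<le> \<bar>S (1 / (4 * B))\<bar>" by linarith
    then obtain \<delta> where \<delta>: "\<delta> = 1 / (2 * B) \<or> \<delta> = 1 / (4 * B)" "v \<le> \<bar>S \<delta>\<bar>" by blast
    have "0 < 1 / (2 * B)" "0 < 1 / (4 * B)" "1 / (4 * B) \<le> 1 / (2 * B)"
      using B_pos by (auto intro: divide_left_mono)
    with \<delta>(1) have \<delta>': "0 < \<delta>" "\<delta> \<le> 1 / (2 * B)" "1 / (4 * B) \<le> \<delta>"
      by (metis order_refl)+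
    have v: "0 < v" using \<alpha> by (simp add: v_def)
    have veq: "c0 * B powr (- s * real q) = sqrt k * d * v"
    proof -
      have "\<alpha> ^ (L * q) = real b powr (- s * real (L * q))"
        by (subst \<alpha>_eq) (use b in \<open>simp add: powr_powr flip: powr_realpow\<close>)
      also have "\<dots> = B powr (- s * real q)" unfolding B_def using b by (simp add: powr_powr mult_ac flip: powr_realpow)
      finally show ?thesis by (simp add: c0_def k_def d_def v_def)
    qed
    have "d\<^sup>2 \<le> \<delta> powr (2 * H)"
      unfolding pw[OF \<delta>'(1)] d_def using \<delta>' B_pos H by (intro power_mono powr_mono2) auto
    moreover have "v\<^sup>2 \<le> (S \<delta>)\<^sup>2" using \<delta> v by (metis abs_le_square_iff abs_of_pos)
    ultimately have "k * d\<^sup>2 * v\<^sup>2 \<le> k * \<delta> powr (2 * H) * (S \<delta>)\<^sup>2" using k by (intro mult_mono) auto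
    also have "\<dots> \<le> ?V" unfolding k_def S_def using bump(1,2) \<delta>' by (intro orbit_bound xy) auto
    finally show ?thesis unfolding veq using k by (simp add: power_mult_distrib)
  qed
  show ?thesis using H_case s_case by (simp add: h_def min_def)
qed

text \<open>Instead of identifying the law of the limit, its event is covered by the increasing
  events that all truncations from some index on are at most 2\<rho>. Each of these is controlled by
  a single Gaussian truncation; doubling \<rho> makes room for the convergence.\<close>

lemma small_ball:
  assumes xy: "x \<in> {0..<1}" "y \<in> {0..<1}" "split_at q x y" and \<rho>: "0 < \<rho>"
  shows "emeasure M {\<omega>\<in>space M. \<bar>Y (T x) \<omega> - Y (T y) \<omega>\<bar> \<le> \<rho>} \<le> ennreal (2 / c0 * \<rho> * B powr (h * real q))"
proof -
  define X where "X N = partial_diff (L * N) (T x) (T y)" for N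
  have Xm[measurable]: "X N \<in> borel_measurable M" for N
    using partial_diff_gaussian(1) by (simp add: X_def gaussian_rv_def)
  define A where "A n = {\<omega>\<in>space M. \<forall>N\<ge>n. \<bar>X N \<omega>\<bar> \<le> 2 * \<rho>}" for n
  have A[measurable]: "A n \<in> sets M" for n unfolding A_def by measurable
  have inc: "incseq A" by (auto simp: incseq_def A_def)
  have "{\<omega>\<in>space M. \<bar>Y (T x) \<omega> - Y (T y) \<omega>\<bar> \<le> \<rho>} \<subseteq> (\<Union>n. A n)"
  proof clarify
    fix \<omega> assume \<omega>: "\<omega> \<in> space M" "\<bar>Y (T x) \<omega> - Y (T y) \<omega>\<bar> \<le> \<rho>"
    have "strict_mono (\<lambda>N. L * N)" using mL by (auto simp: strict_mono_def)
    from LIMSEQ_subseq_LIMSEQ[OF partial_diff_tendsto[OF \<omega>(1), of "T x" "T y"] this]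
    have "(\<lambda>N. X N \<omega>) \<longlonglongrightarrow> Y (T x) \<omega> - Y (T y) \<omega>" by (simp add: X_def comp_def)
    then have "(\<lambda>N. \<bar>X N \<omega>\<bar>) \<longlonglongrightarrow> \<bar>Y (T x) \<omega> - Y (T y) \<omega>\<bar>" by (rule tendsto_rabs)
    moreover have "\<bar>Y (T x) \<omega> - Y (T y) \<omega>\<bar> < 2 * \<rho>" using \<omega> \<rho> by linarith
    ultimately have "\<forall>\<^sub>F N in sequentially. \<bar>X N \<omega>\<bar> < 2 * \<rho>" by (rule order_tendstoD)
    then obtain n where "\<forall>N\<ge>n. \<bar>X N \<omega>\<bar> < 2 * \<rho>" by (auto simp: eventually_sequentially)
    then show "\<omega> \<in> (\<Union>n. A n)" using \<omega> by (auto simp: A_def intro!: exI[of _ n] less_imp_le)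
  qed
  then have "emeasure M {\<omega>\<in>space M. \<bar>Y (T x) \<omega> - Y (T y) \<omega>\<bar> \<le> \<rho>} \<le> emeasure M (\<Union>n. A n)"
    by (intro emeasure_mono) auto
  also have "\<dots> = (SUP n. emeasure M (A n))" using inc A by (intro SUP_emeasure_incseq[symmetric]) auto
  also have "\<dots> \<le> ennreal (2 / c0 * \<rho> * B powr (h * real q))"
  proof (rule SUP_least)
    fix n
    \<comment> \<open>The truncation must reach beyond index \<open>q\<close> for the variance bound
      to apply.\<close>
    define N where "N = max n (Suc q)"
    have "emeasure M (A n) \<le> emeasure M {\<omega>\<in>space M. \<bar>X N \<omega>\<bar> \<le> 2 * \<rho>}"
      by (intro emeasure_mono) (auto simp: A_def N_def)
    also have "\<dots> \<le> ennreal (2 * \<rho> / (c0 * B powr (- h * real q)))"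
    proof (rule gaussian_small_ball[OF prob_space_axioms])
      show "gaussian_rv M (X N)" "integral\<^sup>L M (X N) = 0" by (simp_all add: X_def partial_diff_gaussian)
      show "0 < c0 * B powr (- h * real q)" using c0_pos B_pos by simp
      show "(c0 * B powr (- h * real q))\<^sup>2 \<le> (\<integral>\<omega>. (X N \<omega>)\<^sup>2 \<partial>M)"
        unfolding X_def by (intro variance_bound xy) (simp add: N_def)
    qed (use \<rho> in auto)
    also have "2 * \<rho> / (c0 * B powr (- h * real q)) = 2 / c0 * \<rho> * B powr (h * real q)"
      by (simp add: powr_minus field_simps)
    finally show "emeasure M (A n) \<le> ennreal (2 / c0 * \<rho> * B powr (h * real q))" .
  qed
  finally show ?thesis .
qed

end

section \<open>Expected energy of the Cantor measure lifted to the graph\<close>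

context fww_digits
begin

text \<open>Lift the uniform distribution by x -> (T x, Y (T x)). If \<open>x\<close> and
  \<open>y\<close> split at \<open>q\<close>, distance at most B^(-k) is impossible unless k <= q +
  2 and has probability of order at most B^(-k) B^(hq); such \<open>y\<close> have measure at most 2
  Q^(-q). Weighted by B^(uk), these bounds have a finite sum when B^(u+h-1) < Q.\<close>

lemma AE_dim_ge_digits:
  assumes u: "1 \<le> u" and BQ: "B powr (u + h - 1) < real Q"
  shows "AE \<omega> in M. ereal u \<le> hausdorff_dim (path_graph Y \<omega>)"
proof -
  define N where "N = restrict_space lborel {0..<1::real}"
  have spN: "space N = {0..<1}" by (simp add: N_def space_restrict_space)
  have "prob_space N" unfolding N_def by (intro prob_spaceI) (simp add: emeasure_restrict_space space_restrict_space)
  then interpret N: prob_space N .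
  interpret NN: pair_sigma_finite N N ..
  interpret MNN: pair_sigma_finite M "N \<Otimes>\<^sub>M N" ..
  have [measurable]: "T \<in> borel_measurable N"
    unfolding N_def by (intro measurable_restrict_space1) (simp add: T_measurable)
  have br: "(\<lambda>z. bridge \<kappa> W (frac (real b ^ n * T (fst z))) (snd z)) \<in> borel_measurable (N \<Otimes>\<^sub>M M)" for n
  proof -
    have [measurable]: "(\<lambda>x. frac (real b ^ n * T x)) \<in> borel_measurable N"
    proof -
      have [measurable]: "(frac :: real \<Rightarrow> real) \<in> borel_measurable borel" unfolding frac_def by measurable
      show ?thesis by measurable
    qed
    have [measurable]: "(\<lambda>z. W (frac (real b ^ n * T (fst z))) (snd z)) \<in> borel_measurable (N \<Otimes>\<^sub>M M)"
      by (rule measurable_pair_continuous[where F = W and \<phi> = "\<lambda>x. frac (real b ^ n * T x)"])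
         (auto intro: W_measurable W_continuous less_imp_le[OF frac_lt_1])
    have [measurable]: "(\<lambda>z. \<kappa> (frac (real b ^ n * T (fst z)))) \<in> borel_measurable (N \<Otimes>\<^sub>M M)"
      by (rule measurable_pair_continuous[where F = "\<lambda>t _. \<kappa> t" and \<phi> = "\<lambda>x. frac (real b ^ n * T x)"])
         (auto intro: \<kappa>_continuous less_imp_le[OF frac_lt_1])
    have [measurable]: "W 1 \<in> borel_measurable M" by (rule W_measurable) simp
    show ?thesis unfolding bridge_def by measurable
  qed
  have YT: "(\<lambda>z. Y (T (fst z)) (snd z)) \<in> borel_measurable (N \<Otimes>\<^sub>M M)"
    unfolding ww_bridge_def by (intro borel_measurable_suminf borel_measurable_times br) simp
  define Z where "Z \<omega> x = (T x, Y (T x) \<omega>)" for \<omega> x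
  have YTc[measurable (raw)]: "(\<lambda>z. Y (T (f z)) (g z)) \<in> borel_measurable P"
    if [measurable]: "f \<in> P \<rightarrow>\<^sub>M N" "g \<in> P \<rightarrow>\<^sub>M M" for f g and P :: "'z measure"
    using measurable_compose[OF measurable_Pair[OF that] YT] by simp
  define a where "a k = ennreal (B powr (u * real k))" for k :: nat
  define R where "R k \<omega> p = (indicator {p. dist (Z \<omega> (fst p)) (Z \<omega> (snd p)) \<le> B powr (- real k)} p :: ennreal)" 
    for k :: nat and \<omega> and p :: "real \<times> real"
  have Rm: "(\<lambda>z. R k (fst z) (snd z) :: ennreal) \<in> borel_measurable (M \<Otimes>\<^sub>M (N \<Otimes>\<^sub>M N))" for k
  proof -
    have "{z \<in> space (M \<Otimes>\<^sub>M (N \<Otimes>\<^sub>M N)). dist (Z (fst z) (fst (snd z))) (Z (fst z) (snd (snd z))) \<le> B powr (- real k)} 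
      \<in> sets (M \<Otimes>\<^sub>M (N \<Otimes>\<^sub>M N))"
      unfolding Z_def by measurable
    then have "(\<lambda>z. indicator {z \<in> space (M \<Otimes>\<^sub>M (N \<Otimes>\<^sub>M N)). dist (Z (fst z) (fst (snd z))) (Z (fst z) (snd (snd z))) \<le> B powr (- real k)} z :: ennreal)
       \<in> borel_measurable (M \<Otimes>\<^sub>M (N \<Otimes>\<^sub>M N))" by (rule borel_measurable_indicator)
    then show ?thesis by (rule measurable_cong[THEN iffD1, rotated]) (auto simp: R_def indicator_def)
  qed
  define g where "g \<omega> p = (\<Sum>k. a k * R k \<omega> p)" for \<omega> p
  have gm[measurable]: "(\<lambda>z. g (fst z) (snd z)) \<in> borel_measurable (M \<Otimes>\<^sub>M (N \<Otimes>\<^sub>M N))"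
    unfolding g_def using Rm by measurable
  \<comment> \<open>The restriction k <= q + 2 is replaced by the factor l^(q+2-k), which is at
    least 1 there. This decouples the double sum into geometric series with ratios B^(u-1)/l and B^h
    l/Q; any \<open>l\<close> strictly between B^(u-1) and Q/B^h makes both converge, and the
    midpoint is taken.\<close>
  define l where "l = (B powr (u - 1) + real Q / B powr h) / 2"
  have B1: "1 < B" using B_ge by simp
  have lt: "B powr (u - 1) < real Q / B powr h"
  proof -
    have "B powr (u - 1) * B powr h = B powr (u + h - 1)" by (simp flip: powr_add add: algebra_simps)
    then show ?thesis using BQ B_pos by (simp add: pos_less_divide_eq)
  qed
  have l: "1 \<le> l" "B powr (u - 1) < l" "l < real Q / B powr h"
  proof -
    have "1 \<le> B powr (u - 1)" using B1 u by (intro ge_one_powr_ge_zero) auto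
    moreover show "B powr (u - 1) < l" "l < real Q / B powr h" 
      using less_half_sum[OF lt] gt_half_sum[OF lt] by (simp_all only: l_def one_add_one)
    ultimately show "1 \<le> l" by linarith
  qed
  define c where "c = 2 / c0"
  have c: "0 < c" using c0_pos by (simp add: c_def)
  define e where "e k q = c * B powr (- real k) * B powr (h * real q) * l powr (real q + 2 - real k)" for k q :: nat
  have e0: "0 \<le> e k q" for k q using c by (simp add: e_def)
  \<comment> \<open>The sum over all \<open>q\<close> replaces the splitting index, which depends on
    the pair, by intervals that are plainly measurable in \<open>y\<close>: the true index is among
    the summands because it forces |x - y| <= Q^(-q).\<close>
  have pair: "(\<integral>\<^sup>+\<omega>. g \<omega> (x, y) \<partial>M) \<le> (\<Sum>k. a k * (\<Sum>q. ennreal (e k q) * indicator {y. \<bar>x - y\<bar> \<le> 1 / real Q ^ q} y))"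
    if xy: "x \<in> {0..<1}" "y \<in> {0..<1}" "x \<noteq> y" for x y
  proof -
    have xyN: "x \<in> space N" "y \<in> space N" using xy spN by auto
    have single: "f n \<le> (\<Sum>n. f n)" for f :: "nat \<Rightarrow> ennreal" and n
      using sum_le_suminf[of f "{n}"] by simp
    obtain q where q: "split_at q x y" using exists_split_at[OF xy] by blast
    have Rxy[measurable]: "(\<lambda>\<omega>. R k \<omega> (x, y)) \<in> borel_measurable M" for k
    proof -
      have "(\<lambda>\<omega>. (\<omega>, (x, y))) \<in> M \<rightarrow>\<^sub>M M \<Otimes>\<^sub>M (N \<Otimes>\<^sub>M N)"
        using xyN by (intro measurable_Pair measurable_ident measurable_const) (auto simp: space_pair_measure)
      from measurable_compose[OF this Rm[of k]] show ?thesis by simp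
    qed
    have "(\<integral>\<^sup>+\<omega>. g \<omega> (x, y) \<partial>M) = (\<Sum>k. a k * (\<integral>\<^sup>+\<omega>. R k \<omega> (x, y) \<partial>M))"
      unfolding g_def by (subst nn_integral_suminf) (auto simp: nn_integral_cmult)
    also have "\<dots> \<le> (\<Sum>k. a k * (\<Sum>q. ennreal (e k q) * indicator {y. \<bar>x - y\<bar> \<le> 1 / real Q ^ q} y))"
    proof (intro suminf_le mult_left_mono)
      fix k
      have "(\<integral>\<^sup>+\<omega>. R k \<omega> (x, y) \<partial>M) \<le> ennreal (e k q)"
      proof (cases "\<bar>T x - T y\<bar> \<le> B powr (- real k)")
        case False
        have "\<bar>T x - T y\<bar> \<le> dist (Z \<omega> x) (Z \<omega> y)" for \<omega>
          using dist_fst_le[of "Z \<omega> x" "Z \<omega> y"] by (simp add: Z_def dist_real_def)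
        then have "R k \<omega> (x, y) = (0 :: ennreal)" for \<omega>
          using False unfolding R_def indicator_def by (auto dest: order_trans)
        then show ?thesis by simp
      next
        case True
        \<comment> \<open>Splitting at \<open>q\<close> keeps the times 1/(2 B^(q+1)) apart, so
          closeness B^(-k) gives B^k <= 2 B^(q+1); absorbing the 2 into one more factor
          \<open>B\<close> costs one unit in k <= q + 2.\<close>
        have "1 / (2 * B ^ (q + 1)) \<le> 1 / B ^ k"
          using split_at_dist[OF xy(1,2) q] True B_pos by (simp add: powr_minus powr_realpow inverse_eq_divide)
        then have "B ^ k \<le> 2 * B ^ (q + 1)" using B_pos by (simp add: field_simps)
        also have "\<dots> \<le> B * B ^ (q + 1)" using B_ge by (intro mult_right_mono) auto
        finally have "B ^ k \<le> B ^ (q + 2)" by simp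
        then have kq: "k \<le> q + 2" using B1 by (rule power_le_imp_le_exp[rotated])
        have "(\<integral>\<^sup>+\<omega>. R k \<omega> (x, y) \<partial>M) \<le> (\<integral>\<^sup>+\<omega>. indicator {\<omega>\<in>space M. \<bar>Y (T x) \<omega> - Y (T y) \<omega>\<bar> \<le> B powr (- real k)} \<omega> \<partial>M)"
        proof (intro nn_integral_mono)
          fix \<omega> assume "\<omega> \<in> space M"
          have "\<bar>Y (T x) \<omega> - Y (T y) \<omega>\<bar> \<le> dist (Z \<omega> x) (Z \<omega> y)"
            using dist_snd_le[of "Z \<omega> x" "Z \<omega> y"] by (simp add: Z_def dist_real_def)
          then show "R k \<omega> (x, y) \<le> (indicator {\<omega>\<in>space M. \<bar>Y (T x) \<omega> - Y (T y) \<omega>\<bar> \<le> B powr (- real k)} \<omega> :: ennreal)"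
            using \<open>\<omega> \<in> space M\<close> unfolding R_def indicator_def by auto
        qed
        also have "\<dots> = emeasure M {\<omega>\<in>space M. \<bar>Y (T x) \<omega> - Y (T y) \<omega>\<bar> \<le> B powr (- real k)}"
          by (rule nn_integral_indicator) measurable
        also have "\<dots> \<le> ennreal (2 / c0 * B powr (- real k) * B powr (h * real q))"
          using B_pos by (intro small_ball xy q) auto
        also have "\<dots> \<le> ennreal (e k q)"
        proof (rule ennreal_leI)
          have "1 \<le> l powr (real q + 2 - real k)" using l kq by (intro ge_one_powr_ge_zero) auto
          then have "c * B powr (- real k) * B powr (h * real q) * 1 \<le> e k q"
            unfolding e_def using c by (intro mult_left_mono) auto
          then show "2 / c0 * B powr (- real k) * B powr (h * real q) \<le> e k q" by (simp add: c_def)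
        qed
        finally show ?thesis .
      qed
      also have "ennreal (e k q) = ennreal (e k q) * indicator {y. \<bar>x - y\<bar> \<le> 1 / real Q ^ q} y"
        using agree_dist[OF xy(1,2), of q] q by (simp add: split_at_def)
      also have "\<dots> \<le> (\<Sum>q. ennreal (e k q) * indicator {y. \<bar>x - y\<bar> \<le> 1 / real Q ^ q} y)"
        by (rule single)
      finally show "(\<integral>\<^sup>+\<omega>. R k \<omega> (x, y) \<partial>M) \<le> (\<Sum>q. ennreal (e k q) * indicator {y. \<bar>x - y\<bar> \<le> 1 / real Q ^ q} y)" .
    qed auto
    finally show ?thesis .
  qed
  define r1 where "r1 = B powr (u - 1) / l"
  define r2 where "r2 = B powr h * l / real Q"
  have r: "0 \<le> r1" "r1 < 1" "0 \<le> r2" "r2 < 1"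
    using l Q B_pos by (auto simp: r1_def r2_def field_simps)
  define S where "S = 2 * c * l\<^sup>2 * (1 / (1 - r1)) * (1 / (1 - r2))"
  have inner: "(\<integral>\<^sup>+y. (\<integral>\<^sup>+\<omega>. g \<omega> (x, y) \<partial>M) \<partial>N) \<le> ennreal S" if x: "x \<in> space N" for x
  proof -
    have im: "(\<lambda>y. indicator {y. \<bar>x - y\<bar> \<le> v} y :: ennreal) \<in> borel_measurable N" for v :: real
    proof -
      have "{y. \<bar>x - y\<bar> \<le> v} \<in> sets borel" by measurable
      then show ?thesis unfolding N_def by (intro measurable_restrict_space1) simp
    qed
    \<comment> \<open>On the diagonal there is no splitting index, but it is a null set.\<close>
    have "AE y in N. y \<noteq> x" unfolding N_def
      by (subst AE_restrict_space_iff) (auto intro: AE_mp[OF AE_lborel_singleton[of x]])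
    then have "(\<integral>\<^sup>+y. (\<integral>\<^sup>+\<omega>. g \<omega> (x, y) \<partial>M) \<partial>N) 
       \<le> (\<integral>\<^sup>+y. (\<Sum>k. a k * (\<Sum>q. ennreal (e k q) * indicator {y. \<bar>x - y\<bar> \<le> 1 / real Q ^ q} y)) \<partial>N)"
      using pair x spN by (intro nn_integral_mono_AE) (auto simp: AE_space)
    also have "\<dots> = (\<Sum>k. a k * (\<Sum>q. ennreal (e k q) * (\<integral>\<^sup>+y. indicator {y. \<bar>x - y\<bar> \<le> 1 / real Q ^ q} y \<partial>N)))"
    proof -
      define J where "J q = (\<lambda>y. indicator {y. \<bar>x - y\<bar> \<le> 1 / real Q ^ q} y :: ennreal)" for q :: nat
      have [measurable]: "J q \<in> borel_measurable N" for q unfolding J_def by (rule im)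
      have "(\<integral>\<^sup>+y. (\<Sum>k. a k * (\<Sum>q. ennreal (e k q) * J q y)) \<partial>N) = (\<Sum>k. \<integral>\<^sup>+y. a k * (\<Sum>q. ennreal (e k q) * J q y) \<partial>N)"
        by (rule nn_integral_suminf) measurable
      also have "\<dots> = (\<Sum>k. a k * (\<integral>\<^sup>+y. (\<Sum>q. ennreal (e k q) * J q y) \<partial>N))"
        by (intro suminf_cong nn_integral_cmult) measurable
      also have "\<dots> = (\<Sum>k. a k * (\<Sum>q. \<integral>\<^sup>+y. ennreal (e k q) * J q y \<partial>N))"
        by (subst nn_integral_suminf) auto
      also have "\<dots> = (\<Sum>k. a k * (\<Sum>q. ennreal (e k q) * (\<integral>\<^sup>+y. J q y \<partial>N)))"
        by (subst nn_integral_cmult) auto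
      finally show ?thesis by (simp only: J_def)
    qed
    also have "\<dots> \<le> (\<Sum>k. \<Sum>q. ennreal (2 * c * l\<^sup>2 * r1 ^ k * r2 ^ q))"
      unfolding ennreal_suminf_cmult[symmetric]
    proof (intro suminf_le)
      fix k q
      have "(\<integral>\<^sup>+y. indicator {y. \<bar>x - y\<bar> \<le> 1 / real Q ^ q} y \<partial>N) \<le> ennreal (2 / real Q ^ q)"
        
      proof -
        have "(\<integral>\<^sup>+y. indicator {y. \<bar>x - y\<bar> \<le> 1 / real Q ^ q} y \<partial>N) 
           = (\<integral>\<^sup>+y. indicator {y. \<bar>x - y\<bar> \<le> 1 / real Q ^ q} y * indicator {0..<1} y \<partial>lborel)"
          unfolding N_def by (subst nn_integral_restrict_space) auto
        also have "\<dots> \<le> (\<integral>\<^sup>+y. indicator {x - 1 / real Q ^ q .. x + 1 / real Q ^ q} y \<partial>lborel)"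
          by (intro nn_integral_mono) (auto simp: indicator_def abs_le_iff)
        also have "\<dots> = ennreal (2 / real Q ^ q)" by simp
        finally show ?thesis .
      qed
      then have "a k * (ennreal (e k q) * (\<integral>\<^sup>+y. indicator {y. \<bar>x - y\<bar> \<le> 1 / real Q ^ q} y \<partial>N)) 
         \<le> a k * (ennreal (e k q) * ennreal (2 / real Q ^ q))" by (intro mult_left_mono) auto
      also have "\<dots> = ennreal (B powr (u * real k) * (e k q * (2 / real Q ^ q)))"
        using e0[of k q] unfolding a_def 
        by (simp only: ennreal_mult ennreal_mult' powr_ge_zero mult_nonneg_nonneg divide_nonneg_nonneg zero_le_numeral zero_le_power of_nat_0_le_iff)
      also have "B powr (u * real k) * (e k q * (2 / real Q ^ q)) = 2 * c * l\<^sup>2 * r1 ^ k * r2 ^ q"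
      proof -
        have "l powr (real q + 2 - real k) = l ^ q * l\<^sup>2 / l ^ k"
          using l by (simp add: powr_diff powr_add powr_realpow)
        moreover have "B powr (u * real k) * B powr (- real k) = (B powr (u - 1)) ^ k"
          using B_pos by (simp add: powr_powr algebra_simps flip: powr_add powr_realpow)
        moreover have "B powr (h * real q) = (B powr h) ^ q"
          using B_pos by (simp add: powr_powr flip: powr_realpow)
        ultimately show ?thesis
          unfolding e_def r1_def r2_def power_divide power_mult_distrib by (simp add: field_simps)
      qed
      finally show "a k * (ennreal (e k q) * (\<integral>\<^sup>+y. indicator {y. \<bar>x - y\<bar> \<le> 1 / real Q ^ q} y \<partial>N)) 
         \<le> ennreal (2 * c * l\<^sup>2 * r1 ^ k * r2 ^ q)" .
    qed auto
    also have "\<dots> = (\<Sum>k. ennreal (2 * c * l\<^sup>2 * r1 ^ k * (1 / (1 - r2))))"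
      using c r by (intro suminf_cong suminf_ennreal_eq sums_mult geometric_sums) auto
    also have "\<dots> = ennreal S"
    proof (intro suminf_ennreal_eq)
      have "(\<lambda>k. 2 * c * l\<^sup>2 * (1 / (1 - r2)) * r1 ^ k) sums (2 * c * l\<^sup>2 * (1 / (1 - r2)) * (1 / (1 - r1)))"
        using r by (intro sums_mult geometric_sums) auto
      then show "(\<lambda>k. 2 * c * l\<^sup>2 * r1 ^ k * (1 / (1 - r2))) sums S" by (simp add: S_def mult_ac)
    qed (use c r in auto)
    finally show ?thesis .
  qed
  \<comment> \<open>By Tonelli the expectation of the energy is computed pair by pair; its
    finiteness makes the energy of almost every path finite.\<close>
  have "(\<integral>\<^sup>+\<omega>. (\<integral>\<^sup>+p. g \<omega> p \<partial>(N \<Otimes>\<^sub>M N)) \<partial>M) = (\<integral>\<^sup>+p. (\<integral>\<^sup>+\<omega>. g \<omega> p \<partial>M) \<partial>(N \<Otimes>\<^sub>M N))"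
    using MNN.Fubini[OF gm] by simp
  also have "\<dots> = (\<integral>\<^sup>+x. (\<integral>\<^sup>+y. (\<integral>\<^sup>+\<omega>. g \<omega> (x, y) \<partial>M) \<partial>N) \<partial>N)"
    
  proof (rule N.nn_integral_fst[symmetric])
    have "(\<lambda>(p, \<omega>). g \<omega> p) \<in> borel_measurable ((N \<Otimes>\<^sub>M N) \<Otimes>\<^sub>M M)"
      using measurable_pair_swap[OF gm] by (simp add: case_prod_beta)
    then show "(\<lambda>p. \<integral>\<^sup>+\<omega>. g \<omega> p \<partial>M) \<in> borel_measurable (N \<Otimes>\<^sub>M N)"
      by (rule borel_measurable_nn_integral)
  qed
  also have "\<dots> \<le> (\<integral>\<^sup>+x. ennreal S \<partial>N)" by (intro nn_integral_mono inner)
  also have "\<dots> = ennreal S" by (simp add: N.emeasure_space_1)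
  finally have fin: "(\<integral>\<^sup>+\<omega>. (\<integral>\<^sup>+p. g \<omega> p \<partial>(N \<Otimes>\<^sub>M N)) \<partial>M) < \<infinity>" by (simp add: le_less_trans[OF _ ennreal_less_top])
  have "AE \<omega> in M. (\<integral>\<^sup>+p. g \<omega> p \<partial>(N \<Otimes>\<^sub>M N)) \<noteq> \<infinity>"
    using fin by (intro nn_integral_PInf_AE) auto
  with AE_space show ?thesis
  proof eventually_elim
    case (elim \<omega>)
    have Zm: "Z \<omega> \<in> borel_measurable N" unfolding Z_def using elim(1) by measurable
    show ?case
    proof (rule hausdorff_dim_ge_mass[OF \<open>prob_space N\<close> Zm _ _ B1])
      show "Z \<omega> ` space N \<subseteq> path_graph Y \<omega>"
        using T_sums(2,3) unfolding spN path_graph_def Z_def by force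
      show "0 < u" using u by simp
      have gm': "g \<omega> \<in> borel_measurable (N \<Otimes>\<^sub>M N)"
        using measurable_compose[OF measurable_Pair1'[OF elim(1)] gm] by simp
      have "(\<integral>\<^sup>+p. g \<omega> p \<partial>(N \<Otimes>\<^sub>M N)) = (\<integral>\<^sup>+x. (\<integral>\<^sup>+y. g \<omega> (x, y) \<partial>N) \<partial>N)"
        by (rule N.nn_integral_fst[OF gm', symmetric])
      also have "\<dots> = (\<integral>\<^sup>+x. (\<Sum>k. a k * emeasure N {y \<in> space N. dist (Z \<omega> x) (Z \<omega> y) \<le> B powr (- real k)}) \<partial>N)"
        
      proof (rule nn_integral_cong)
        fix x assume x: "x \<in> space N"
        have set: "{y \<in> space N. dist (Z \<omega> x) (Z \<omega> y) \<le> r} \<in> sets N" for r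
          using Zm by measurable
        have Req: "(\<integral>\<^sup>+y. R k \<omega> (x, y) \<partial>N) = emeasure N {y \<in> space N. dist (Z \<omega> x) (Z \<omega> y) \<le> B powr (- real k)}" for k
          unfolding nn_integral_indicator[OF set, symmetric]
          by (intro nn_integral_cong) (auto simp: R_def indicator_def)
        have Rm': "(\<lambda>y. R k \<omega> (x, y) :: ennreal) \<in> borel_measurable N" for k
        proof -
          have "(\<lambda>y. indicator {y \<in> space N. dist (Z \<omega> x) (Z \<omega> y) \<le> B powr (- real k)} y :: ennreal) \<in> borel_measurable N"
            using set by (rule borel_measurable_indicator)
          then show ?thesis by (rule measurable_cong[THEN iffD1, rotated]) (auto simp: R_def indicator_def)
        qed
        show "(\<integral>\<^sup>+y. g \<omega> (x, y) \<partial>N) = (\<Sum>k. a k * emeasure N {y \<in> space N. dist (Z \<omega> x) (Z \<omega> y) \<le> B powr (- real k)})"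
          unfolding g_def using Rm' by (simp add: nn_integral_suminf nn_integral_cmult Req)
      qed
      finally show "(\<integral>\<^sup>+x. (\<Sum>k. ennreal (B powr (u * real k)) * emeasure N {y \<in> space N. dist (Z \<omega> x) (Z \<omega> y) \<le> B powr (- real k)}) \<partial>N) < \<infinity>"
        using elim(2) by (simp add: a_def less_top)
    qed
  qed
qed

end

section \<open>Choice of the digit system and conclusion\<close>

context fww_bridge
begin

text \<open>Here \<open>e\<close> is going to be u + h - 1. With words of length m^2 + m + 1 and Q =
  b^(m^2-m) of them, the inequality says (m^2 + m + 1) e < m^2 - m, which follows from m (1 - e) >
  4. Taking \<open>m\<close> at least \<open>m0\<close> secures \<alpha>^L <= 1/3.\<close>

lemma exists_fww_digits:
  assumes e: "0 \<le> e" "e < 1"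
  obtains m L Q D where "fww_digits M H W \<alpha> \<tau> b \<kappa> m L Q D" "(real b ^ L) powr e < real Q"
proof -
  obtain m0 where m0: "\<alpha> ^ m0 < 1/3" using real_arch_pow_inv[of "1/3" \<alpha>] \<alpha> by auto
  define m where "m = m0 + nat \<lceil>4 / (1 - e)\<rceil> + 2"
  have m_ge: "2 \<le> m" "m0 \<le> m" by (auto simp: m_def)
  have "4 / (1 - e) < real m" unfolding m_def by linarith
  then have m4: "4 < real m * (1 - e)" using e by (simp add: pos_divide_less_eq)
  define L where "L = m * m + m + 1"
  define Q where "Q = b ^ ((m - 1) * m)"
  obtain D where "digit_system b m L Q D" unfolding L_def Q_def using exists_digit_system[OF b m_ge(1)] by blast
  then interpret digit_system b m L Q D .
  have "m0 \<le> L" using m_ge by (simp add: L_def)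
  then have "\<alpha> ^ L \<le> \<alpha> ^ m0" using \<alpha> by (intro power_decreasing) auto
  then have "fww_digits M H W \<alpha> \<tau> b \<kappa> m L Q D"
    using m0 by unfold_locales simp
  moreover have "(real b ^ L) powr e < real Q"
  proof -
    have "real m * 4 < real m * (real m * (1 - e))" using m4 m_ge by (intro mult_strict_left_mono) auto
    also have "\<dots> = real m * real m - real m * real m * e" by (simp add: algebra_simps)
    finally have "real m * 4 < real m * real m - real m * real m * e" .
    moreover have "real m * e \<le> real m" using e by (simp add: mult_left_le)
    moreover have "real L * e = real m * real m * e + real m * e + e" by (simp add: L_def algebra_simps)
    moreover have "(real m - 1) * real m = real m * real m - real m" by (simp add: algebra_simps)
    moreover have "2 \<le> real m" using m_ge by simp
    ultimately have "real L * e < (real m - 1) * real m" using e by linarith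
    also have "\<dots> = real ((m - 1) * m)" using m_ge by (simp add: of_nat_diff)
    finally have "real b powr (real L * e) < real b powr real ((m - 1) * m)" using b by (intro powr_less_mono) auto
    then show ?thesis using b by (simp add: Q_def powr_powr powr_realpow[symmetric] del: of_nat_mult)
  qed
  ultimately show thesis by (rule that)
qed

lemma AE_dim_ge:
  assumes u: "1 \<le> u" "u < 2 - h"
  shows "AE \<omega> in M. ereal u \<le> hausdorff_dim (path_graph Y \<omega>)"
proof -
  obtain m L Q D where "fww_digits M H W \<alpha> \<tau> b \<kappa> m L Q D" and lt: "(real b ^ L) powr (u + h - 1) < real Q"
  proof (rule exists_fww_digits)
    show "0 \<le> u + h - 1" "u + h - 1 < 1" using u h by auto
  qed
  then interpret fww_digits M H W \<alpha> \<tau> b \<kappa> m L Q D by simp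
  show ?thesis using lt u by (intro AE_dim_ge_digits) (simp_all add: B_def)
qed

lemma AE_dim_eq: "AE \<omega> in M. hausdorff_dim (path_graph Y \<omega>) = ereal (2 - h)"
proof -
  \<comment> \<open>Countably many exponents approach h and 2 - h, so that the exceptional null sets
    can be united. The shifts in the denominators keep \<open>\<gamma> n\<close> positive and
    \<open>u n\<close> at least 1 already for n = 0.\<close>
  define \<gamma> where "\<gamma> n = h - h / (real n + 2)" for n :: nat
  define u where "u n = 2 - h - (1 - h) / (real n + 1)" for n :: nat
  have \<gamma>: "0 < \<gamma> n" "\<gamma> n < h" for n using h by (auto simp: \<gamma>_def field_simps intro: add_pos_nonneg)
  have u: "1 \<le> u n" "u n < 2 - h" for n
  proof -
    have "(1 - h) / (real n + 1) \<le> (1 - h) / 1" using h by (intro divide_left_mono) auto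
    then show "1 \<le> u n" by (simp add: u_def)
    show "u n < 2 - h" using h by (simp add: u_def)
  qed
  have "AE \<omega> in M. \<forall>n. hausdorff_dim (path_graph Y \<omega>) \<le> ereal (2 - \<gamma> n)"
    using AE_dim_le[OF \<gamma>] by (simp add: AE_all_countable)
  moreover have "AE \<omega> in M. \<forall>n. ereal (u n) \<le> hausdorff_dim (path_graph Y \<omega>)"
    using AE_dim_ge[OF u] by (simp add: AE_all_countable)
  ultimately show ?thesis
  proof eventually_elim
    case (elim \<omega>)
    have "\<gamma> \<longlonglongrightarrow> h" unfolding \<gamma>_def by real_asymp
    then have "(\<lambda>n. ereal (2 - \<gamma> n)) \<longlonglongrightarrow> ereal (2 - h)" by (intro tendsto_intros)
    then have "hausdorff_dim (path_graph Y \<omega>) \<le> ereal (2 - h)" by (rule LIMSEQ_le_const) (use elim(1) in auto)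
    moreover have "u \<longlonglongrightarrow> 2 - h" unfolding u_def by real_asymp
    then have "(\<lambda>n. ereal (u n)) \<longlonglongrightarrow> ereal (2 - h)" by (intro tendsto_intros)
    then have "ereal (2 - h) \<le> hausdorff_dim (path_graph Y \<omega>)" by (rule LIMSEQ_le_const2) (use elim(2) in auto)
    ultimately show ?case by (rule antisym)
  qed
qed

end

theorem corollary2p7:
  fixes M :: "'w measure" and H \<alpha> \<tau> :: real and b :: nat
    and W :: "real \<Rightarrow> 'w \<Rightarrow> real" and \<kappa> :: "real \<Rightarrow> real"
  assumes "prob_space M"
    and "0 < H" "H < 1"
    and "continuous_fbm M H W"
    and "\<kappa> ` {0..1} \<subseteq> {0..1}" "\<kappa> 0 = 0" "\<kappa> 1 = 1"
    and "H < \<tau>" "\<tau> \<le> 1" "holder_on \<tau> {0..1} \<kappa>"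
    and "0 < \<alpha>" "\<alpha> < 1" "2 \<le> b"
  defines "K \<equiv> min 1 (- log (real b) \<alpha>)"
  shows "AE \<omega> in M. hausdorff_dim (path_graph (ww_bridge \<alpha> b \<kappa> W) \<omega>)
                      = ereal (max (2 - H) (2 - K))"
proof -
  interpret prob_space M by fact
  interpret fww_bridge M H W \<alpha> \<tau> b \<kappa>
    by unfold_locales (use assms in auto)
  have "max (2 - H) (2 - K) = 2 - h" using H by (auto simp: K_def h_def s_def)
  then show ?thesis using AE_dim_eq by simp
qed

end
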